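(* Let $f=x^{a}(x-x_{1})^{b}\in\mathbb{C}\{x,x_1\}$ for some integers $a,b\ge 1$. Then there exist $\varphi_{1},\varphi_{2} \in \mathcal{D}_{f} \subset \mathrm{Diff}_{up}(\mathbb{C}^{2},0)$ such that $\varphi_{1} \sim_{*} \varphi_{2}$ but not $\varphi_{1} \stackrel{t}{\sim}_{*} \varphi_{2}$.
   Context: Coordinates on $\mathbb{C}^{2}$ are $(x,x_1)$. $\mathrm{Diff}_{up}(\mathbb{C}^{2},0)$ is the group of germs at $0$ of complex analytic diffeomorphisms $\varphi$ of $\mathbb{C}^2$ fixing $0$ with $x_1\circ\varphi=x_1$ and $(\partial(x\circ\varphi)/\partial x)(0)=1$. $\widehat{\mathrm{Diff}}_{p}(\mathbb{C}^{2},0)$ is the group of formal diffeomorphisms $\hat\sigma$ at $0$ (power series components without constant term, invertible linear part) with $x_1\circ\hat\sigma=x_1$. $\mathcal{D}_f$ is the set of $\varphi\in\mathrm{Diff}_{up}(\mathbb{C}^{2},0)$ such that $(x\circ\varphi-x)/f$ is a unit of $\mathbb{C}\{x,x_1\}$. For a germ of analytic set $\gamma$ at $0$, $I(\gamma)$ is the ideal of holomorphic germs vanishing on $\gamma$; we use the same notation for the ideal it generates in the formal power series ring. A germ of analytic set is fibered if it is a union of orbits of $\partial/\partial x$ (here no irreducible component of $f=0$ is fibered). $\hat\sigma\in\widehat{\mathrm{Diff}}_{p}(\mathbb{C}^{2},0)$ is normalized (with respect to $f=0$) if $x\circ\hat\sigma-x\in I(\gamma)$ for every non-fibered irreducible component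 $\gamma$ of $f=0$. $\hat\sigma$ is transversally formal along $f=0$ if each component $g$ of $\hat\sigma$ can be written as $g=\sum_{k\ge0}c_k$ with $c_k\in\mathbb{C}\{x,x_1\}\cap I(\{f=0\})^k$ for all $k\ge 0$. For $\varphi_1,\varphi_2\in\mathcal{D}_f$: $\varphi_1\sim_*\varphi_2$ means that there is a normalized $\hat\sigma\in\widehat{\mathrm{Diff}}_{p}(\mathbb{C}^{2},0)$ with $\hat\sigma\circ\varphi_1=\varphi_2\circ\hat\sigma$; $\varphi_1\stackrel{t}{\sim}_*\varphi_2$ means that such a normalized $\hat\sigma$ can be chosen transversally formal along $f=0$. *)

theory Defs
  imports "HOL-Analysis.Analysis" "HOL-Computational_Algebra.Formal_Power_Series"
begin

unbundle no vec_syntax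
unbundle fps_syntax

text \<open>
  The ring of formal power series in \<open>(x, x1)\<close> is \<open>complex fps fps\<close>; the outer variable is \<open>x\<close>,
  so that the coefficient of \<open>x ^ i * x1 ^ j\<close> is \<open>g $ i $ j\<close> and the derivation by \<open>x\<close> is
  \<^const>\<open>fps_deriv\<close>.
\<close>

type_synonym series2 = "complex fps fps"

abbreviation var_x :: series2 where "var_x \<equiv> fps_X"

abbreviation var_x1 :: series2 where "var_x1 \<equiv> fps_const fps_X"

text \<open>Germs of holomorphic functions at the origin are identified with their Taylor series.\<close>

definition convergent_series :: "series2 set" where
  "convergent_series =
     {g. \<exists>r>0. (\<lambda>(i, j). norm (g $ i $ j) * r ^ (i + j)) summable_on UNIV}"

definition eval_series :: "series2 \<Rightarrow> complex \<times> complex \<Rightarrow> complex" where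
  "eval_series g p = (\<Sum>\<^sub>\<infinity>(i, j). g $ i $ j * fst p ^ i * snd p ^ j)"

text \<open>
  The series \<open>g (h, k)\<close>, meaningful if \<open>h\<close> and \<open>k\<close> have no constant term: then \<open>h ^ i * k ^ j\<close>
  has order at least \<open>i + j\<close>, so that the omitted summands all vanish.
\<close>

definition subst2 :: "series2 \<Rightarrow> series2 \<Rightarrow> series2 \<Rightarrow> series2" where
  "subst2 g h k =
     Abs_fps (\<lambda>m. Abs_fps (\<lambda>n.
       \<Sum>(i, j)\<in>{(i, j). i + j \<le> m + n}. g $ i $ j * (h ^ i * k ^ j) $ m $ n))"

text \<open>A formal map is the pair of its components \<open>x \<circ> \<sigma>\<close> and \<open>x1 \<circ> \<sigma>\<close>.\<close>

type_synonym formal_map = "series2 \<times> series2"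

definition comp_map :: "formal_map \<Rightarrow> formal_map \<Rightarrow> formal_map" where
  "comp_map \<sigma> \<tau> =
     (subst2 (fst \<sigma>) (fst \<tau>) (snd \<tau>), subst2 (snd \<sigma>) (fst \<tau>) (snd \<tau>))"

definition formal_diffeos :: "formal_map set" where
  "formal_diffeos =
     {(g, h). g $ 0 $ 0 = 0 \<and> h $ 0 $ 0 = 0 \<and>
        g $ 1 $ 0 * h $ 0 $ 1 - g $ 0 $ 1 * h $ 1 $ 0 \<noteq> 0}"

definition formal_diff_p :: "formal_map set" where
  "formal_diff_p = {\<sigma> \<in> formal_diffeos. snd \<sigma> = var_x1}"

definition diff_up :: "formal_map set" where
  "diff_up =
     {\<phi> \<in> formal_diffeos. fst \<phi> \<in> convergent_series \<and> snd \<phi> \<in> convergent_series \<and>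
        snd \<phi> = var_x1 \<and> fps_deriv (fst \<phi>) $ 0 $ 0 = 1}"

text \<open>The quotient of \<open>x \<circ> \<phi> - x\<close> by \<open>f\<close> is \<open>u\<close>, whose inverse in the ring of convergent series is \<open>v\<close>.\<close>

definition D_set :: "series2 \<Rightarrow> formal_map set" where
  "D_set f =
     {\<phi> \<in> diff_up. \<exists>u\<in>convergent_series. \<exists>v\<in>convergent_series.
        u * v = 1 \<and> fst \<phi> - var_x = u * f}"

text \<open>
  A germ of set at the origin is given by any representing set; all notions below depend on the
  set only through its intersection with small neighbourhoods of the origin.
\<close>

definition germ_subset :: "(complex \<times> complex) set \<Rightarrow> (complex \<times> complex) set \<Rightarrow> bool" where
  "germ_subset A B \<longleftrightarrow> (\<forall>\<^sub>F p in nhds 0. p \<in> A \<longrightarrow> p \<in> B)"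

definition germ_eq :: "(complex \<times> complex) set \<Rightarrow> (complex \<times> complex) set \<Rightarrow> bool" where
  "germ_eq A B \<longleftrightarrow> (\<forall>\<^sub>F p in nhds 0. p \<in> A \<longleftrightarrow> p \<in> B)"

definition zero_set :: "series2 set \<Rightarrow> (complex \<times> complex) set" where
  "zero_set F = {p. \<forall>g\<in>F. eval_series g p = 0}"

definition analytic_germ :: "(complex \<times> complex) set \<Rightarrow> bool" where
  "analytic_germ A \<longleftrightarrow>
     (\<exists>F. finite F \<and> F \<subseteq> convergent_series \<and> germ_eq A (zero_set F))"

definition irreducible_germ :: "(complex \<times> complex) set \<Rightarrow> bool" where
  "irreducible_germ A \<longleftrightarrow>
     analytic_germ A \<and> \<not> germ_eq A {} \<and>
     (\<forall>B C. analytic_germ B \<and> analytic_germ C \<and> germ_eq A (B \<union> C) \<longrightarrow>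
        germ_eq A B \<or> germ_eq A C)"

definition irreducible_component ::
    "(complex \<times> complex) set \<Rightarrow> (complex \<times> complex) set \<Rightarrow> bool" where
  "irreducible_component \<gamma> A \<longleftrightarrow>
     irreducible_germ \<gamma> \<and> germ_subset \<gamma> A \<and>
     (\<forall>\<delta>. irreducible_germ \<delta> \<and> germ_subset \<gamma> \<delta> \<and> germ_subset \<delta> A \<longrightarrow> germ_eq \<gamma> \<delta>)"

text \<open>In a small polydisc, the orbits of \<open>\<partial>/\<partial>x\<close> are the discs where \<open>x1\<close> is constant.\<close>

definition fibered_germ :: "(complex \<times> complex) set \<Rightarrow> bool" where
  "fibered_germ A \<longleftrightarrow>
     (\<exists>r>0. \<forall>s t y. norm s < r \<and> norm t < r \<and> norm y < r \<longrightarrow> ((s, y) \<in> A \<longleftrightarrow> (t, y) \<in> A))"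

definition vanishing_germs :: "(complex \<times> complex) set \<Rightarrow> series2 set" where
  "vanishing_germs A = {g \<in> convergent_series. germ_subset A (zero_set {g})}"

text \<open>Ideals of a commutative ring are its submodules; the span is the ideal generated by a set.\<close>

definition ideal_gen :: "series2 set \<Rightarrow> series2 set" where
  "ideal_gen S = module.span (*) S"

text \<open>The ideal of formal series generated by the holomorphic germs vanishing on \<open>A\<close>.\<close>

definition formal_ideal :: "(complex \<times> complex) set \<Rightarrow> series2 set" where
  "formal_ideal A = ideal_gen (vanishing_germs A)"

primrec ideal_power :: "series2 set \<Rightarrow> nat \<Rightarrow> series2 set" where
  "ideal_power I 0 = UNIV"
| "ideal_power I (Suc k) = ideal_gen {g * h |g h. g \<in> I \<and> h \<in> ideal_power I k}"

definition normalized :: "series2 \<Rightarrow> formal_map \<Rightarrow> bool" where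
  "normalized f \<sigma> \<longleftrightarrow>
     (\<forall>\<gamma>. irreducible_component \<gamma> (zero_set {f}) \<and> \<not> fibered_germ \<gamma> \<longrightarrow>
        fst \<sigma> - var_x \<in> formal_ideal \<gamma>)"

text \<open>
  Convergence for the topology of formal power series (adic for the maximal ideal): every
  coefficient of the partial sums is eventually constant. The topology on the library type
  \<^typ>\<open>complex fps fps\<close> is adic with respect to the outer variable only, hence not the right one.
\<close>

definition formal_sums :: "(nat \<Rightarrow> series2) \<Rightarrow> series2 \<Rightarrow> bool" where
  "formal_sums c g \<longleftrightarrow> (\<forall>i j. \<forall>\<^sub>F n in sequentially. (\<Sum>k<n. c k) $ i $ j = g $ i $ j)"

definition transversally_formal_series :: "series2 \<Rightarrow> series2 \<Rightarrow> bool" where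
  "transversally_formal_series f g \<longleftrightarrow>
     (\<exists>c. (\<forall>k. c k \<in> convergent_series \<inter> ideal_power (formal_ideal (zero_set {f})) k) \<and>
        formal_sums c g)"

definition transversally_formal :: "series2 \<Rightarrow> formal_map \<Rightarrow> bool" where
  "transversally_formal f \<sigma> \<longleftrightarrow>
     transversally_formal_series f (fst \<sigma>) \<and> transversally_formal_series f (snd \<sigma>)"

definition formally_conjugate :: "series2 \<Rightarrow> formal_map \<Rightarrow> formal_map \<Rightarrow> bool" where
  "formally_conjugate f \<phi>1 \<phi>2 \<longleftrightarrow>
     (\<exists>\<sigma>\<in>formal_diff_p. normalized f \<sigma> \<and> comp_map \<sigma> \<phi>1 = comp_map \<phi>2 \<sigma>)"

definition transversally_conjugate :: "series2 \<Rightarrow> formal_map \<Rightarrow> formal_map \<Rightarrow> bool" where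
  "transversally_conjugate f \<phi>1 \<phi>2 \<longleftrightarrow>
     (\<exists>\<sigma>\<in>formal_diff_p. normalized f \<sigma> \<and> transversally_formal f \<sigma> \<and>
        comp_map \<sigma> \<phi>1 = comp_map \<phi>2 \<sigma>)"

end

(*
  Write X = f d/dx and let E_w be the flow of X at the variable time w. Take phi2 = E_1 and
  phi1 = E_{1 + s f} for a complex parameter s. A normalized formal map conjugates them if and only
  if it is E_alpha with alpha o phi1 - alpha = - s f, and alpha is unique up to a series in x1. So
  delta_s = alpha(x1, x1) - alpha(0, x1) is an invariant, and it converges if the conjugacy is
  transversally formal.
  The coefficients of delta_s are polynomials in s. If delta_s converged for all s, the Baire
  category theorem and Cauchy's inequalities would make the coefficient of s^2 convergent too. By
  the Euler-Maclaurin formula this coefficient is the integral from 0 to x1 of sum_n b_n X^n f,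
  where the b_n are, up to sign, the coefficients of z / (e^z - 1). Put F = y^a (y - 1)^b. By
  homogeneity, the n-th term is a monomial in x1, with coefficient b_n times the integral over
  [0, 1] of (F d/dy)^n F. For n = 2 k integration by parts turns this integral into that of F R_k^2
  up to sign, with a polynomial R_k whose leading coefficient is at least k!. It is therefore at
  least k!^2 up to exponential factors, so that z / (e^z - 1) would be entire, against its poles
  at the nonzero multiples of 2 pi i.
*)
theory Submission
  imports Defs "HOL-Complex_Analysis.Cauchy_Integral_Formula"
begin

unbundle no vec_syntax
unbundle fps_syntax

text \<open>The conjugacy equation becomes linear because it is read through times: E_w is a ring
  homomorphism for every series w, and E_w E_v is the flow at time w + E_w(v). Both sides of the
  equation are then flows, at the times 1 + s f + alpha o phi1 and alpha + 1, and the time is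
  determined by the flow. Such an alpha exists only if the displacement of the conjugacy is
  divisible by f, while normalization gives divisibility by x (x - x1) alone. If a > 1 or b > 1, the
  missing powers are extracted from the conjugacy equation, one line at a time. For the same reason
  the time on a line is read off from a transverse jet of the conjugacy, of order equal to the
  multiplicity of the line in f; transversal formality makes such jets converge. The coefficient of
  s in delta_s is - x1: all boundary terms of the Euler-Maclaurin formula contain f and vanish on
  both lines. So s^2 is the first order that can obstruct convergence. Only even n are used, because
  there the integral becomes one of a function of constant sign; for odd n > 1 the numbers b_n
  vanish.\<close>

section \<open>Filtration of the series ring by the order in both variables\<close>

definition order_ge :: "nat \<Rightarrow> series2 \<Rightarrow> bool" where
  "order_ge n g \<longleftrightarrow> (\<forall>i j. i + j < n \<longrightarrow> g $ i $ j = 0)"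

lemma order_ge_0 [simp]: "order_ge 0 g"
  by (simp add: order_ge_def)

lemma order_ge_zero [simp]: "order_ge n 0"
  by (simp add: order_ge_def)

lemma order_ge_mono: "order_ge n g \<Longrightarrow> m \<le> n \<Longrightarrow> order_ge m g"
  by (auto simp: order_ge_def)

lemma order_ge_add: "order_ge n g \<Longrightarrow> order_ge n h \<Longrightarrow> order_ge n (g + h)"
  by (simp add: order_ge_def)

lemma order_ge_minus: "order_ge n g \<Longrightarrow> order_ge n (- g)"
  by (simp add: order_ge_def)

lemma order_ge_diff: "order_ge n g \<Longrightarrow> order_ge n h \<Longrightarrow> order_ge n (g - h)"
  by (simp add: order_ge_def)

lemma order_ge_sum: "(\<And>k. k \<in> A \<Longrightarrow> order_ge n (u k)) \<Longrightarrow> order_ge n (sum u A)"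
  by (induction A rule: infinite_finite_induct) (auto intro: order_ge_add)

lemma nth2_sum: "sum u A $ i $ j = (\<Sum>k\<in>A. u k $ i $ j)"
  by (simp add: fps_sum_nth)

lemma mult_nth2:
  "((g :: series2) * h) $ i $ j = (\<Sum>k=0..i. \<Sum>l=0..j. g $ k $ l * h $ (i - k) $ (j - l))"
  by (simp add: fps_mult_nth fps_sum_nth)

lemma order_ge_mult:
  assumes "order_ge m g" "order_ge n h"
  shows "order_ge (m + n) (g * h)"
  unfolding order_ge_def
proof (intro allI impI)
  fix i j assume ij: "i + j < m + n"
  have "g $ k $ l * h $ (i - k) $ (j - l) = 0" if "k \<le> i" "l \<le> j" for k l
  proof -
    have "k + l < m \<or> (i - k) + (j - l) < n" using ij that by linarith
    then show ?thesis using assms by (auto simp: order_ge_def)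
  qed
  then show "(g * h) $ i $ j = 0" unfolding mult_nth2 by (intro sum.neutral ballI) auto
qed

lemma order_ge_mult_right: "order_ge n h \<Longrightarrow> order_ge n (g * h)"
  using order_ge_mult[of 0 g n h] by simp

lemma order_ge_mult_left: "order_ge n g \<Longrightarrow> order_ge n (g * h)"
  using order_ge_mult[of n g 0 h] by simp

lemma order_ge_power: "order_ge m g \<Longrightarrow> order_ge (n * m) (g ^ n)"
  by (induction n) (auto intro: order_ge_mult)

lemma order_ge_deriv: "order_ge (Suc n) g \<Longrightarrow> order_ge n (fps_deriv g)"
  by (auto simp: order_ge_def numeral_fps_const fps_of_nat[symmetric] simp del: of_nat_Suc)

lemma order_ge_eq_0: "(\<And>n. order_ge n g) \<Longrightarrow> g = 0"
  unfolding order_ge_def by (intro fps_ext) (metis fps_zero_nth lessI)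

lemma order_ge_eqI: "(\<And>n. order_ge n (g - h)) \<Longrightarrow> g = h"
  using order_ge_eq_0[of "g - h"] by simp

text \<open>Uniqueness statements come from this: an estimate that improves every known order by one
  excludes a nonzero series.\<close>

lemma order_ge_raise_eq_0:
  assumes "\<And>n. order_ge n g \<Longrightarrow> order_ge (Suc n) g"
  shows "g = 0"
proof (rule order_ge_eq_0)
  show "order_ge n g" for n by (induction n) (auto intro: assms)
qed

lemma order_ge_trans:
  "order_ge n (g - h) \<Longrightarrow> order_ge n (h - k) \<Longrightarrow> order_ge n (g - k)"
  using order_ge_add[of n "g - h" "h - k"] by simp

lemma order_ge_sym: "order_ge n (g - h) \<Longrightarrow> order_ge n (h - g)"
  using order_ge_minus[of n "g - h"] by simp

lemma order_ge_1_iff: "order_ge (Suc 0) g \<longleftrightarrow> g $ 0 $ 0 = 0"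
  by (auto simp: order_ge_def)

lemma order_ge_var_x [simp]: "order_ge (Suc 0) var_x"
  by (simp add: order_ge_1_iff)

abbreviation scal :: "complex \<Rightarrow> series2" where
  "scal c \<equiv> fps_const (fps_const c)"

subsection \<open>Infinite sums\<close>

text \<open>Stabilization of each coefficient amounts to adic convergence, since only finitely many
  coefficients lie below a given order.\<close>

lemma formal_sums_iff:
  "formal_sums u g \<longleftrightarrow> (\<forall>N. \<forall>\<^sub>F M in sequentially. order_ge N (g - (\<Sum>n<M. u n)))"
proof
  assume L: "formal_sums u g"
  show "\<forall>N. \<forall>\<^sub>F M in sequentially. order_ge N (g - (\<Sum>n<M. u n))"
  proof
    fix N
    have "\<forall>\<^sub>F M in sequentially. \<forall>p\<in>{..<N}\<times>{..<N}. (\<Sum>k<M. u k) $ fst p $ snd p = g $ fst p $ snd p"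
      using L by (intro eventually_ball_finite) (auto simp: formal_sums_def)
    then show "\<forall>\<^sub>F M in sequentially. order_ge N (g - (\<Sum>n<M. u n))"
      by eventually_elim (auto simp: order_ge_def)
  qed
next
  assume R: "\<forall>N. \<forall>\<^sub>F M in sequentially. order_ge N (g - (\<Sum>n<M. u n))"
  show "formal_sums u g" unfolding formal_sums_def
  proof (intro allI)
    fix i j
    show "\<forall>\<^sub>F n in sequentially. (\<Sum>k<n. u k) $ i $ j = g $ i $ j"
      using R[rule_format, of "Suc (i + j)"] by eventually_elim (auto simp: order_ge_def)
  qed
qed

lemma formal_sums_unique:
  assumes "formal_sums u g" "formal_sums u h"
  shows "g = h"
proof (rule order_ge_eqI)
  fix N
  have "\<forall>\<^sub>F M in sequentially. order_ge N (g - (\<Sum>n<M. u n))"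
       "\<forall>\<^sub>F M in sequentially. order_ge N (h - (\<Sum>n<M. u n))"
    using assms by (auto simp: formal_sums_iff)
  then have "\<forall>\<^sub>F M in sequentially. order_ge N (g - h)"
  proof eventually_elim
    case (elim M)
    from order_ge_trans[OF elim(1) order_ge_sym[OF elim(2)]] show ?case .
  qed
  then show "order_ge N (g - h)" by simp
qed

text \<open>The series ring is adically complete, so terms tending to zero are already
  summable.\<close>

definition null_seq :: "(nat \<Rightarrow> series2) \<Rightarrow> bool" where
  "null_seq u \<longleftrightarrow> (\<forall>N. \<forall>\<^sub>F n in sequentially. order_ge N (u n))"

text \<open>A total function: each coefficient is summed over the indices that contribute, a finite
  set if the terms tend to zero. A coefficient with infinitely many contributions gets the value
  0.\<close>

definition sum_series :: "(nat \<Rightarrow> series2) \<Rightarrow> series2" where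
  "sum_series u = Abs_fps (\<lambda>i. Abs_fps (\<lambda>j. \<Sum>n | u n $ i $ j \<noteq> 0. u n $ i $ j))"

lemma null_seqI: "(\<And>n. order_ge n (u n)) \<Longrightarrow> null_seq u"
  by (auto simp: null_seq_def eventually_sequentially intro: order_ge_mono)

lemma null_seq_mult: "null_seq u \<Longrightarrow> null_seq (\<lambda>n. v n * u n)"
  unfolding null_seq_def eventually_sequentially by (meson order_ge_mult_right)

lemma null_seq_deriv: "null_seq u \<Longrightarrow> null_seq (\<lambda>n. fps_deriv (u n))"
  unfolding null_seq_def eventually_sequentially by (meson order_ge_deriv)

lemma null_seq_add:
  assumes "null_seq u" "null_seq v"
  shows "null_seq (\<lambda>n. u n + v n)"
  unfolding null_seq_def
proof
  fix N
  have "\<forall>\<^sub>F n in sequentially. order_ge N (u n)" "\<forall>\<^sub>F n in sequentially. order_ge N (v n)"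
    using assms by (auto simp: null_seq_def)
  then show "\<forall>\<^sub>F n in sequentially. order_ge N (u n + v n)"
    by eventually_elim (rule order_ge_add)
qed

lemma null_seq_Suc: "null_seq u \<Longrightarrow> null_seq (\<lambda>n. u (Suc n))"
  unfolding null_seq_def by (simp add: eventually_sequentially_Suc[of "\<lambda>n. order_ge _ (u n)"])

lemma sum_series_nth:
  assumes "\<And>n. M \<le> n \<Longrightarrow> u n $ i $ j = 0"
  shows "sum_series u $ i $ j = (\<Sum>n<M. u n $ i $ j)"
  unfolding sum_series_def fps_nth_Abs_fps
  using assms by (intro sum.mono_neutral_left) (auto simp: not_le[symmetric])

lemma sum_series_approx:
  assumes "\<And>n. M \<le> n \<Longrightarrow> order_ge N (u n)"
  shows "order_ge N (sum_series u - (\<Sum>n<M. u n))"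
  unfolding order_ge_def
proof (intro allI impI)
  fix i j assume "i + j < N"
  then have "sum_series u $ i $ j = (\<Sum>n<M. u n $ i $ j)"
    using assms by (intro sum_series_nth) (auto simp: order_ge_def)
  then show "(sum_series u - (\<Sum>n<M. u n)) $ i $ j = 0" by (simp add: fps_sum_nth)
qed

lemma formal_sums_sum_series:
  assumes "null_seq u"
  shows "formal_sums u (sum_series u)"
  unfolding formal_sums_iff
proof
  fix N
  obtain M where "\<And>n. M \<le> n \<Longrightarrow> order_ge N (u n)"
    using assms by (auto simp: null_seq_def eventually_sequentially)
  then show "\<forall>\<^sub>F M in sequentially. order_ge N (sum_series u - (\<Sum>n<M. u n))"
    unfolding eventually_sequentially by (meson order_trans sum_series_approx)
qed

lemma sum_series_eqI: "null_seq u \<Longrightarrow> formal_sums u g \<Longrightarrow> sum_series u = g"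
  using formal_sums_sum_series formal_sums_unique by blast

text \<open>Additive maps continuous for the adic topology; they commute with infinite sums. The
  index K may exceed N, because a derivation lowers orders.\<close>

definition formal_cont :: "(series2 \<Rightarrow> series2) \<Rightarrow> bool" where
  "formal_cont L \<longleftrightarrow> (\<forall>g h. L (g + h) = L g + L h) \<and>
     (\<forall>N. \<exists>K. \<forall>g. order_ge K g \<longrightarrow> order_ge N (L g))"

lemma formal_contI:
  assumes "\<And>g h. L (g + h) = L g + L h" "\<And>n g. order_ge (n + k) g \<Longrightarrow> order_ge n (L g)"
  shows "formal_cont L"
  using assms unfolding formal_cont_def by blast

lemma formal_cont_diff:
  assumes "formal_cont L" shows "L (g - h) = L g - L h"
  using assms unfolding formal_cont_def by (metis diff_add_cancel eq_diff_eq)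

lemma formal_cont_zero: "formal_cont L \<Longrightarrow> L 0 = 0"
  using formal_cont_diff[of L 0 0] by simp

lemma formal_cont_sum:
  "formal_cont L \<Longrightarrow> L (sum u A) = (\<Sum>k\<in>A. L (u k))"
  by (induction A rule: infinite_finite_induct)
    (auto simp: formal_cont_zero formal_cont_def)

lemma formal_sums_map:
  assumes "formal_cont L" "formal_sums u g"
  shows "formal_sums (\<lambda>n. L (u n)) (L g)"
  unfolding formal_sums_iff
proof
  fix N
  obtain K where K: "\<And>g. order_ge K g \<Longrightarrow> order_ge N (L g)"
    using assms(1) unfolding formal_cont_def by meson
  have "\<forall>\<^sub>F M in sequentially. order_ge K (g - (\<Sum>n<M. u n))"
    using assms(2) by (auto simp: formal_sums_iff)
  then show "\<forall>\<^sub>F M in sequentially. order_ge N (L g - (\<Sum>n<M. L (u n)))"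
    by eventually_elim
      (use K assms(1) in \<open>simp add: formal_cont_diff[symmetric] formal_cont_sum[symmetric]\<close>)
qed

lemma null_seq_map:
  assumes "formal_cont L" "null_seq u"
  shows "null_seq (\<lambda>n. L (u n))"
  unfolding null_seq_def
proof
  fix N
  obtain K where K: "\<And>g. order_ge K g \<Longrightarrow> order_ge N (L g)"
    using assms(1) unfolding formal_cont_def by meson
  have "\<forall>\<^sub>F n in sequentially. order_ge K (u n)"
    using assms(2) by (auto simp: null_seq_def)
  then show "\<forall>\<^sub>F n in sequentially. order_ge N (L (u n))"
    by eventually_elim (rule K)
qed

lemma sum_series_map:
  assumes "formal_cont L" "null_seq u"
  shows "L (sum_series u) = sum_series (\<lambda>n. L (u n))"
  using sum_series_eqI[OF null_seq_map[OF assms] formal_sums_map[OF assms(1) formal_sums_sum_series[OF assms(2)]]]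
  by simp

lemma formal_cont_mult: "formal_cont ((*) g)"
  by (rule formal_contI[of _ 0]) (simp_all add: distrib_left order_ge_mult_right)

lemma sum_series_mult: "null_seq u \<Longrightarrow> g * sum_series u = sum_series (\<lambda>n. g * u n)"
  using sum_series_map[OF formal_cont_mult] by blast

lemma formal_sums_add:
  assumes "formal_sums u g" "formal_sums v h"
  shows "formal_sums (\<lambda>n. u n + v n) (g + h)"
  unfolding formal_sums_iff
proof
  fix N
  have "\<forall>\<^sub>F M in sequentially. order_ge N (g - (\<Sum>n<M. u n))"
       "\<forall>\<^sub>F M in sequentially. order_ge N (h - (\<Sum>n<M. v n))"
    using assms by (auto simp: formal_sums_iff)
  then show "\<forall>\<^sub>F M in sequentially. order_ge N (g + h - (\<Sum>n<M. u n + v n))"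
  proof eventually_elim
    case (elim M)
    from order_ge_add[OF elim] show ?case by (simp add: sum.distrib algebra_simps)
  qed
qed

lemma sum_series_add:
  "null_seq u \<Longrightarrow> null_seq v \<Longrightarrow> sum_series (\<lambda>n. u n + v n) = sum_series u + sum_series v"
  by (rule sum_series_eqI[OF null_seq_add formal_sums_add[OF formal_sums_sum_series formal_sums_sum_series]])

lemma sum_series_minus: "null_seq u \<Longrightarrow> sum_series (\<lambda>n. - u n) = - sum_series u"
  using sum_series_mult[of u "-1"] by simp

lemma sum_series_diff:
  assumes "null_seq u" "null_seq v"
  shows "sum_series (\<lambda>n. u n - v n) = sum_series u - sum_series v"
  using sum_series_add[of u "\<lambda>n. - v n"] assms null_seq_mult[of v "\<lambda>_. -1"]
  by (simp add: sum_series_minus)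

lemma sum_series_Suc:
  assumes "null_seq u"
  shows "sum_series u = u 0 + sum_series (\<lambda>n. u (Suc n))"
proof (rule sum_series_eqI[OF assms])
  show "formal_sums u (u 0 + sum_series (\<lambda>n. u (Suc n)))"
    unfolding formal_sums_iff
  proof
    fix N
    have "\<forall>\<^sub>F M in sequentially. order_ge N (sum_series (\<lambda>n. u (Suc n)) - (\<Sum>n<M. u (Suc n)))"
      using formal_sums_sum_series[OF null_seq_Suc[OF assms]] by (simp add: formal_sums_iff)
    then have "\<forall>\<^sub>F M in sequentially. order_ge N (u 0 + sum_series (\<lambda>n. u (Suc n)) - (\<Sum>n<Suc M. u n))"
      by eventually_elim (simp add: sum.lessThan_Suc_shift del: sum.lessThan_Suc)
    then show "\<forall>\<^sub>F M in sequentially. order_ge N (u 0 + sum_series (\<lambda>n. u (Suc n)) - (\<Sum>n<M. u n))"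
      by (rule eventually_sequentially_Suc[THEN iffD1])
  qed
qed

lemma order_ge_sum_series:
  assumes "\<And>n. order_ge N (u n)" shows "order_ge N (sum_series u)"
  using sum_series_approx[of 0 N u] assms by simp

lemma sum_series_single: "sum_series (\<lambda>n. if n = k then g else 0) = g"
proof (intro fps_ext)
  fix i j
  have "sum_series (\<lambda>n. if n = k then g else 0) $ i $ j = (\<Sum>n<Suc k. (if n = k then g else 0) $ i $ j)"
    by (rule sum_series_nth) auto
  also have "\<dots> = g $ i $ j" by simp
  finally show "sum_series (\<lambda>n. if n = k then g else 0) $ i $ j = g $ i $ j" .
qed

lemma sum_series_zero: "sum_series (\<lambda>n. 0) = 0"
  by (intro fps_ext) (simp add: sum_series_def)

text \<open>Modulo order N both sides are the finite sum over m + j < N, whichever way the pairs are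
  arranged.\<close>

lemma sum_series_triangle:
  assumes ord: "\<And>m j. order_ge (m + j) (a m j)"
  shows "sum_series (\<lambda>m. sum_series (a m)) = sum_series (\<lambda>n. \<Sum>m\<le>n. a m (n - m))"
proof (rule order_ge_eqI)
  fix N
  have M: "order_ge N (a m j)" if "N \<le> m + j" for m j using order_ge_mono[OF ord that] .
  have 1: "order_ge N (sum_series (a m) - (\<Sum>j<N - m. a m j))" for m
    by (rule sum_series_approx) (auto intro: M)
  have "order_ge N (sum_series (\<lambda>m. sum_series (a m)) - (\<Sum>m<N. sum_series (a m)))"
    by (rule sum_series_approx, rule order_ge_sum_series, rule M) simp
  moreover have "order_ge N ((\<Sum>m<N. sum_series (a m)) - (\<Sum>m<N. \<Sum>j<N - m. a m j))"
    unfolding sum_subtractf[symmetric] by (intro order_ge_sum 1)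
  moreover have "(\<Sum>m<N. \<Sum>j<N - m. a m j) = (\<Sum>n<N. \<Sum>m\<le>n. a m (n - m))"
    unfolding sum.triangle_reindex[symmetric]
    by (subst sum.Sigma) (auto intro!: sum.cong)
  moreover have "order_ge N (sum_series (\<lambda>n. \<Sum>m\<le>n. a m (n - m)) - (\<Sum>n<N. \<Sum>m\<le>n. a m (n - m)))"
  proof (rule sum_series_approx)
    fix n assume "N \<le> n"
    then have "order_ge N (a m (n - m))" if "m \<in> {..n}" for m
      using that by (intro M) auto
    then show "order_ge N (\<Sum>m\<le>n. a m (n - m))" by (rule order_ge_sum)
  qed
  ultimately show "order_ge N (sum_series (\<lambda>m. sum_series (a m)) - sum_series (\<lambda>n. \<Sum>m\<le>n. a m (n - m)))"
    by (simp only:) (blast intro: order_ge_sym order_ge_trans)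
qed

text \<open>Banach's fixed point theorem for the adic metric: every application of the map gains one
  order, so the iterates of 0 form a Cauchy sequence.\<close>

lemma fixed_point_series:
  assumes "\<And>n g h. order_ge n (g - h) \<Longrightarrow> order_ge (Suc n) (\<Phi> g - \<Phi> h)"
  shows "\<exists>g. \<Phi> g = g"
proof -
  define it where "it n = (\<Phi> ^^ n) 0" for n
  have it_Suc: "it (Suc n) = \<Phi> (it n)" for n by (simp add: it_def)
  have step: "order_ge n (it (Suc n) - it n)" for n
    by (induction n) (auto simp: it_Suc intro: assms)
  have stable: "order_ge n (it (n + k) - it n)" for n k
  proof (induction k)
    case (Suc k)
    show ?case using order_ge_trans[OF order_ge_mono[OF step[of "n + k"]] Suc] by simp
  qed simp
  \<comment> \<open>The coefficient at \<open>(i, j)\<close> is final from the iterate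
    \<open>Suc (i + j)\<close> on.\<close>
  define g where "g = Abs_fps (\<lambda>i. Abs_fps (\<lambda>j. it (Suc (i + j)) $ i $ j))"
  have g: "order_ge n (g - it n)" for n
    unfolding order_ge_def
  proof (intro allI impI)
    fix i j assume "i + j < n"
    then have "it n $ i $ j = it (Suc (i + j)) $ i $ j"
      using stable[of "Suc (i + j)" "n - Suc (i + j)"] by (auto simp: order_ge_def)
    then show "(g - it n) $ i $ j = 0" by (simp add: g_def)
  qed
  have "order_ge n (\<Phi> g - g)" for n
  proof -
    have "order_ge (Suc n) (\<Phi> g - it (Suc n))" using assms[OF g[of n]] by (simp add: it_Suc)
    then have "order_ge (Suc n) (\<Phi> g - g)"
      by (rule order_ge_trans) (rule order_ge_sym[OF g])
    then show ?thesis by (rule order_ge_mono) simp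
  qed
  then show ?thesis by (intro exI order_ge_eqI)
qed

lemma sum_series_cong: "(\<And>n. u n = v n) \<Longrightarrow> sum_series u = sum_series v"
  by presburger

lemma sum_series_times:
  assumes u: "\<And>n. order_ge n (u n)" and v: "\<And>n. order_ge n (v n)"
  shows "sum_series u * sum_series v = sum_series (\<lambda>n. \<Sum>m\<le>n. u m * v (n - m))"
proof -
  have "sum_series u * sum_series v = sum_series v * sum_series u" by (rule mult.commute)
  also have "\<dots> = sum_series (\<lambda>m. sum_series v * u m)"
    using u by (intro sum_series_mult null_seqI)
  also have "\<dots> = sum_series (\<lambda>m. sum_series (\<lambda>j. u m * v j))"
    using v by (subst mult.commute) (simp add: sum_series_mult null_seqI)
  also have "\<dots> = sum_series (\<lambda>n. \<Sum>m\<le>n. u m * v (n - m))"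
    by (intro sum_series_triangle order_ge_mult u v)
  finally show ?thesis .
qed

lemma of_nat_scal: "(of_nat k :: series2) = scal (of_nat k)"
  by (simp add: fps_of_nat)

lemma scal_mult_scal: "scal c * (scal d * g) = scal (c * d) * g"
  by (simp add: mult.assoc[symmetric])

lemma scal_choose:
  assumes "m \<le> n"
  shows "scal (1 / fact n) * (of_nat (n choose m) * g) = scal (1 / fact m) * (scal (1 / fact (n - m)) * g)"
  unfolding of_nat_scal scal_mult_scal using assms by (simp add: binomial_fact divide_simps)

lemma fps_X_mult_shift1: "\<phi> $ 0 = 0 \<Longrightarrow> (\<phi> :: 'a :: comm_ring_1 fps) = fps_X * fps_shift 1 \<phi>"
  by (intro fps_ext) auto

section \<open>The flow of a vector field along x at a variable time\<close>

text \<open>The condition \<open>f $ 0 = 0\<close> says that x divides f: the flow then preserves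
  the line x = 0 and can be substituted for the outer variable. Order at least 2 makes every
  application of the derivation raise the order.\<close>

locale planar_field =
  fixes f :: series2
  assumes order_f: "order_ge 2 f" and f_nth_0: "f $ 0 = 0" and f_neq_0: "f \<noteq> 0"
begin

definition X :: "series2 \<Rightarrow> series2" where
  "X h = f * fps_deriv h"

lemma X_add: "X (g + h) = X g + X h"
  by (simp add: X_def algebra_simps)

lemma X_mult: "X (g * h) = X g * h + g * X h"
  by (simp add: X_def algebra_simps)

lemma X_fps_const [simp]: "X (fps_const c) = 0"
  by (simp add: X_def)

lemma X_fps_const_mult: "X (fps_const c * g) = fps_const c * X g"
  by (simp add: X_mult)

lemma X_0 [simp]: "X 0 = 0"
  by (simp add: X_def)

lemma X_sum: "X (sum u A) = (\<Sum>k\<in>A. X (u k))"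
  by (induction A rule: infinite_finite_induct) (auto simp: X_add)

lemma order_X:
  assumes "order_ge n h" shows "order_ge (Suc n) (X h)"
proof (cases n)
  case 0
  show ?thesis unfolding X_def 0
    by (rule order_ge_mult_left, rule order_ge_mono[OF order_f]) simp
next
  case (Suc m)
  then have "order_ge m (fps_deriv h)" using assms by (simp add: order_ge_deriv)
  then show ?thesis using order_ge_mult[OF order_f] Suc by (simp add: X_def)
qed

lemma order_Xpow:
  "order_ge k h \<Longrightarrow> order_ge (n + k) ((X ^^ n) h)"
  by (induction n) (auto intro: order_X)

lemma order_Xpow0: "order_ge n ((X ^^ n) h)"
  using order_Xpow[of 0 h n] by simp

lemma Xpow_add: "(X ^^ n) (g + h) = (X ^^ n) g + (X ^^ n) h"
  by (induction n) (auto simp: X_add)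

lemma Xpow_fps_const_mult: "(X ^^ n) (fps_const c * g) = fps_const c * (X ^^ n) g"
  by (induction n) (auto simp: X_fps_const_mult)

lemma Xpow_fps_const: "(X ^^ n) (fps_const c) = (if n = 0 then fps_const c else 0)"
  by (induction n) auto

lemma formal_cont_Xpow: "formal_cont (X ^^ n)"
  by (rule formal_contI[of _ 0]) (auto simp: Xpow_add intro: order_ge_mono[OF order_Xpow])

lemma Xpow_mult:
  "(X ^^ n) (g * h) = (\<Sum>m\<le>n. of_nat (n choose m) * ((X ^^ m) g * (X ^^ (n - m)) h))"
proof (induction n)
  case (Suc n)
  define T where "T m = (X ^^ m) g * (X ^^ (Suc n - m)) h" for m
  have X_of_nat: "X (of_nat k * u) = of_nat k * X u" for k u
    by (simp add: of_nat_scal X_fps_const_mult)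
  have "(X ^^ Suc n) (g * h)
      = (\<Sum>m\<le>n. of_nat (n choose m) * X ((X ^^ m) g * (X ^^ (n - m)) h))"
    by (simp add: Suc.IH X_sum X_of_nat)
  also have "\<dots> = (\<Sum>m\<le>n. of_nat (n choose m) * (T (Suc m) + T m))"
    by (intro sum.cong refl) (simp add: T_def X_mult Suc_diff_le)
  also have "\<dots> = (\<Sum>m\<le>n. of_nat (n choose m) * T (Suc m)) + (\<Sum>m\<le>n. of_nat (n choose m) * T m)"
    by (simp add: algebra_simps sum.distrib)
  also have "(\<Sum>m\<le>n. of_nat (n choose m) * T m) = (\<Sum>m\<le>Suc n. of_nat (n choose m) * T m)"
    by simp
  also have "\<dots> = T 0 + (\<Sum>m\<le>n. of_nat (n choose Suc m) * T (Suc m))"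
    by (subst sum.atMost_Suc_shift) simp
  also have "(\<Sum>m\<le>n. of_nat (n choose m) * T (Suc m)) + (T 0 + (\<Sum>m\<le>n. of_nat (n choose Suc m) * T (Suc m)))
      = T 0 + (\<Sum>m\<le>n. of_nat (Suc n choose Suc m) * T (Suc m))"
    by (simp add: algebra_simps sum.distrib)
  also have "\<dots> = (\<Sum>m\<le>Suc n. of_nat (Suc n choose m) * T m)"
    by (simp only: sum.atMost_Suc_shift binomial_n_0 of_nat_1 mult_1_left)
  finally show ?case by (simp add: T_def)
qed simp

text \<open>The substitution of \<open>x\<close> by its image under the flow of \<open>f \<partial>/\<partial>x\<close> at the (variable) time \<open>w\<close>.\<close>

definition flow :: "series2 \<Rightarrow> series2 \<Rightarrow> series2" where
  "flow w h = sum_series (\<lambda>n. scal (1 / fact n) * (w ^ n * (X ^^ n) h))"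

lemma order_flow_term: "order_ge k h \<Longrightarrow> order_ge (n + k) (scal c * (w * (X ^^ n) h))"
  by (intro order_ge_mult_right order_Xpow)

lemma order_flow_term0: "order_ge n (scal c * (w * (X ^^ n) h))"
  by (intro order_ge_mult_right order_Xpow0)

lemma vanishing_flow_term: "null_seq (\<lambda>n. scal (c n) * (w n * (X ^^ n) h))"
  by (intro null_seqI order_flow_term0)

lemma order_flow: "order_ge k h \<Longrightarrow> order_ge k (flow w h)"
  unfolding flow_def by (intro order_ge_sum_series order_ge_mono[OF order_flow_term]) auto

lemma flow_add: "flow w (g + h) = flow w g + flow w h"
  unfolding flow_def
  by (subst sum_series_add[OF vanishing_flow_term vanishing_flow_term, symmetric])
    (simp only: Xpow_add distrib_left)

lemma formal_cont_flow: "formal_cont (flow w)"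
  by (rule formal_contI[of _ 0]) (auto simp: flow_add order_flow)

lemma flow_diff: "flow w (g - h) = flow w g - flow w h"
  by (rule formal_cont_diff[OF formal_cont_flow])

lemma flow_sum: "flow w (sum u A) = (\<Sum>k\<in>A. flow w (u k))"
  by (rule formal_cont_sum[OF formal_cont_flow])

text \<open>Leibniz's rule and the binomial coefficients combine as for the exponential of a
  derivation. It is harmless that the time is itself a series, since it is only multiplied and never
  differentiated.\<close>

lemma flow_mult: "flow w (g * h) = flow w g * flow w h"
proof -
  define T where "T n u = scal (1 / fact n) * (w ^ n * (X ^^ n) u)" for n u
  have "flow w g * flow w h = sum_series (\<lambda>n. \<Sum>m\<le>n. T m g * T (n - m) h)"
    unfolding flow_def T_def by (intro sum_series_times order_flow_term0)
  also have "\<dots> = sum_series (\<lambda>n. T n (g * h))"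
  proof (rule sum_series_cong)
    fix n
    have "T n (g * h)
        = (\<Sum>m\<le>n. scal (1 / fact n) * (of_nat (n choose m) * (w ^ n * ((X ^^ m) g * (X ^^ (n - m)) h))))"
      unfolding T_def Xpow_mult by (simp only: sum_distrib_left mult_ac)
    also have "\<dots> = (\<Sum>m\<le>n. scal (1 / fact m) * (scal (1 / fact (n - m)) * (w ^ n * ((X ^^ m) g * (X ^^ (n - m)) h))))"
      by (intro sum.cong refl scal_choose) auto
    also have "\<dots> = (\<Sum>m\<le>n. T m g * T (n - m) h)"
    proof (intro sum.cong refl)
      fix m assume "m \<in> {..n}"
      then have w: "w ^ n = w ^ m * w ^ (n - m)" by (simp add: power_add[symmetric])
      show "scal (1 / fact m) * (scal (1 / fact (n - m)) * (w ^ n * ((X ^^ m) g * (X ^^ (n - m)) h)))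
        = T m g * T (n - m) h"
        unfolding T_def w by (simp only: mult_ac)
    qed
    finally show "(\<Sum>m\<le>n. T m g * T (n - m) h)
       = T n (g * h)" by simp
  qed
  finally show ?thesis by (simp add: flow_def T_def)
qed

lemma flow_fps_const: "flow w (fps_const c) = fps_const c"
proof -
  have "flow w (fps_const c) = sum_series (\<lambda>n. if n = 0 then fps_const c else 0)"
    unfolding flow_def by (intro sum_series_cong) (simp add: Xpow_fps_const)
  then show ?thesis by (simp add: sum_series_single)
qed

lemma flow_1 [simp]: "flow w 1 = 1"
  using flow_fps_const[of w 1] by simp

lemma flow_power: "flow w (g ^ n) = flow w g ^ n"
  by (induction n) (auto simp: flow_mult)

text \<open>Taylor expansion in the time: neither w nor v is differentiated, so the powers of w + v
  expand by the binomial theorem.\<close>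

lemma flow_plus: "flow (w + v) h = sum_series (\<lambda>n. scal (1 / fact n) * (v ^ n * flow w ((X ^^ n) h)))"
proof -
  define a where "a n j = scal (1 / fact n) * (v ^ n * (scal (1 / fact j) * (w ^ j * (X ^^ j) ((X ^^ n) h))))" for n j
  have a: "order_ge (n + j) (a n j)" for n j
  proof -
    have "order_ge (j + n) ((X ^^ j) ((X ^^ n) h))" by (intro order_Xpow order_Xpow0)
    then show ?thesis unfolding a_def by (intro order_ge_mult_right) (simp add: add.commute)
  qed
  have "sum_series (\<lambda>n. scal (1 / fact n) * (v ^ n * flow w ((X ^^ n) h))) = sum_series (\<lambda>n. sum_series (a n))"
  proof (rule sum_series_cong)
    fix n
    show "scal (1 / fact n) * (v ^ n * flow w ((X ^^ n) h)) = sum_series (a n)"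
      unfolding flow_def mult.assoc[symmetric, of "scal (1 / fact n)"]
      by (subst sum_series_mult[OF vanishing_flow_term]) (auto simp: a_def mult.assoc intro: sum_series_cong)
  qed
  also have "\<dots> = sum_series (\<lambda>n. \<Sum>m\<le>n. a m (n - m))"
    using a by (rule sum_series_triangle)
  also have "\<dots> = flow (w + v) h"
    unfolding flow_def
  proof (rule sum_series_cong)
    fix n
    have "scal (1 / fact n) * ((w + v) ^ n * (X ^^ n) h)
        = (\<Sum>m\<le>n. scal (1 / fact n) * (of_nat (n choose m) * (v ^ m * w ^ (n - m) * (X ^^ n) h)))"
      unfolding add.commute[of w v] binomial_ring by (simp only: sum_distrib_left sum_distrib_right mult_ac)
    also have "\<dots> = (\<Sum>m\<le>n. scal (1 / fact m) * (scal (1 / fact (n - m)) * (v ^ m * w ^ (n - m) * (X ^^ n) h)))"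
      by (intro sum.cong refl scal_choose) auto
    also have "\<dots> = (\<Sum>m\<le>n. a m (n - m))"
    proof (intro sum.cong refl)
      fix m assume "m \<in> {..n}"
      then have "(X ^^ (n - m)) ((X ^^ m) h) = (X ^^ n) h" by (simp add: funpow_add[THEN fun_cong, symmetric, unfolded o_def])
      then show "scal (1 / fact m) * (scal (1 / fact (n - m)) * (v ^ m * w ^ (n - m) * (X ^^ n) h)) = a m (n - m)"
        unfolding a_def by (simp only: mult_ac)
    qed
    finally show "(\<Sum>m\<le>n. a m (n - m)) = scal (1 / fact n) * ((w + v) ^ n * (X ^^ n) h)" by simp
  qed
  finally show ?thesis by simp
qed

text \<open>The time v is a function, which the outer flow moves as well. This composition law turns
  equations between maps into equations between times.\<close>

lemma flow_flow: "flow w (flow v h) = flow (w + flow w v) h"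
proof -
  have "flow w (flow v h) = sum_series (\<lambda>n. flow w (scal (1 / fact n) * (v ^ n * (X ^^ n) h)))"
    unfolding flow_def[of v] by (rule sum_series_map[OF formal_cont_flow vanishing_flow_term])
  also have "\<dots> = sum_series (\<lambda>n. scal (1 / fact n) * (flow w v ^ n * flow w ((X ^^ n) h)))"
    by (simp only: flow_mult flow_power flow_fps_const)
  finally show ?thesis by (simp add: flow_plus)
qed

lemma flow_var_x_nth_0: "flow w var_x $ 0 = 0"
proof -
  have 1: "((X ^^ n) var_x) $ 0 = 0" for n
    by (cases n) (auto simp: X_def f_nth_0)
  have "(flow w var_x) $ 0 $ j = 0" for j
  proof -
    have "flow w var_x $ 0 $ j = (\<Sum>n<Suc j. (scal (1 / fact n) * (w ^ n * (X ^^ n) var_x)) $ 0 $ j)"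
      unfolding flow_def
    proof (rule sum_series_nth)
      fix n assume "Suc j \<le> n"
      then show "(scal (1 / fact n) * (w ^ n * (X ^^ n) var_x)) $ 0 $ j = 0"
        using order_flow_term0[of n "1 / fact n" "w ^ n" var_x, unfolded order_ge_def, rule_format, of 0 j]
        by linarith
    qed
    also have "\<dots> = 0" by (simp add: 1)
    finally show ?thesis .
  qed
  then show ?thesis by (intro fps_ext) simp
qed

text \<open>Both sides are ring homomorphisms in g that fix the series in x1 and agree on x. The
  coefficient of x^m only sees g modulo x^(m+1), because x divides the flow of x; this reduces the
  claim to polynomials in x.\<close>

lemma compose_flow: "g oo flow w var_x = flow w g"
proof (intro fps_ext[where ?'a = "complex fps"])
  fix m
  define \<phi> where "\<phi> = flow w var_x"
  have \<phi>0: "\<phi> $ 0 = 0" unfolding \<phi>_def by (rule flow_var_x_nth_0)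
  define S where "S = (\<Sum>i=0..m. fps_const (g $ i) * var_x ^ i)"
  define R where "R = fps_shift (Suc m) g"
  have g: "g = S + var_x ^ Suc m * R"
  proof (intro fps_ext[where ?'a = "complex fps"])
    fix n
    show "g $ n = (S + var_x ^ Suc m * R) $ n"
      unfolding S_def R_def fps_add_nth fps_sum_rep_nth fps_X_power_mult_nth by auto
  qed
  have "(\<phi> ^ Suc m * h) $ m = 0" for h
  proof -
    have "\<phi> ^ Suc m * h = fps_X ^ Suc m * (fps_shift 1 \<phi> ^ Suc m * h)"
      by (subst fps_X_mult_shift1[OF \<phi>0]) (simp only: power_mult_distrib mult.assoc)
    then show ?thesis by (simp only: fps_X_power_mult_nth) simp
  qed
  note 0 = this
  have "S oo \<phi> = flow w S"
    unfolding S_def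
    by (simp add: fps_compose_sum_distrib fps_compose_mult_distrib[OF \<phi>0] fps_compose_power[OF \<phi>0, symmetric] \<phi>0
        flow_sum flow_mult flow_power flow_fps_const) (simp add: \<phi>_def)
  then have "(S oo \<phi>) $ m = flow w S $ m" by simp
  moreover have "((var_x ^ Suc m * R) oo \<phi>) $ m = 0"
    using 0[of "R oo \<phi>"]
    by (simp add: fps_compose_mult_distrib[OF \<phi>0] fps_compose_power[OF \<phi>0, symmetric] \<phi>0 del: power_Suc)
  moreover have "flow w (var_x ^ Suc m * R) $ m = 0"
    using 0[of "flow w R"] by (simp add: flow_mult flow_power \<phi>_def del: power_Suc)
  ultimately show "(g oo flow w var_x) $ m = flow w g $ m"
    unfolding \<phi>_def[symmetric] by (subst (1 2) g) (simp only: fps_compose_add_distrib flow_add fps_add_nth)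
qed

text \<open>The displacement of the flow divided by f: the identity term drops out, and the
  outermost application of X in every other term supplies the factor f.\<close>

definition flow_quot :: "series2 \<Rightarrow> series2 \<Rightarrow> series2" where
  "flow_quot w g = sum_series (\<lambda>m. scal (1 / fact (Suc m)) * (w ^ Suc m * fps_deriv ((X ^^ m) g)))"

lemma vanishing_deriv_Xpow: "null_seq (\<lambda>m. fps_deriv ((X ^^ m) g))"
  by (intro null_seq_deriv null_seqI order_Xpow0)

lemma flow_eq: "flow w g = g + f * flow_quot w g"
proof -
  have "flow w g = g + sum_series (\<lambda>n. scal (1 / fact (Suc n)) * (w ^ Suc n * (X ^^ Suc n) g))"
    unfolding flow_def by (subst sum_series_Suc[OF vanishing_flow_term]) simp
  also have "sum_series (\<lambda>n. scal (1 / fact (Suc n)) * (w ^ Suc n * (X ^^ Suc n) g))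
      = sum_series (\<lambda>n. f * (scal (1 / fact (Suc n)) * (w ^ Suc n * fps_deriv ((X ^^ n) g))))"
    by (rule sum_series_cong) (simp only: funpow.simps o_apply X_def mult_ac)
  also have "\<dots> = f * flow_quot w g"
    unfolding flow_quot_def
    by (rule sum_series_mult[symmetric]) (intro null_seq_mult vanishing_deriv_Xpow)
  finally show ?thesis .
qed

text \<open>Beyond the linear term, each term carries a series of positive order. The map from the
  time to the quotient is thus the identity plus a contraction, whence existence and uniqueness of
  the time.\<close>

lemma flow_quot_var_x_diff:
  assumes "order_ge n (\<alpha> - \<beta>)"
  shows "order_ge (Suc n) ((flow_quot \<alpha> var_x - \<alpha>) - (flow_quot \<beta> var_x - \<beta>))"
proof -
  define r where "r m = fps_deriv ((X ^^ Suc m) var_x)" for m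
  have r: "order_ge (Suc m) (r m)" for m
    unfolding r_def using order_Xpow[of 1 var_x "Suc m"] by (intro order_ge_deriv) auto
  have tail: "flow_quot \<gamma> var_x - \<gamma> = sum_series (\<lambda>m. scal (1 / fact (Suc (Suc m))) * (\<gamma> ^ Suc (Suc m) * r m))" for \<gamma>
  proof -
    have "null_seq (\<lambda>m. scal (1 / fact (Suc m)) * (\<gamma> ^ Suc m * fps_deriv ((X ^^ m) var_x)))"
      by (intro null_seq_mult vanishing_deriv_Xpow)
    from sum_series_Suc[OF this] show ?thesis unfolding flow_quot_def r_def by simp
  qed
  have van: "null_seq (\<lambda>m. scal (1 / fact (Suc (Suc m))) * (\<gamma> ^ Suc (Suc m) * r m))" for \<gamma>
    by (intro null_seq_mult null_seqI order_ge_mono[OF r]) auto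
  show ?thesis
    unfolding tail sum_series_diff[OF van van, symmetric]
  proof (rule order_ge_sum_series)
    fix m
    have "order_ge n (\<alpha> ^ k - \<beta> ^ k)" for k
      unfolding power_diff_sumr2 by (rule order_ge_mult_left[OF assms])
    then have "order_ge (n + Suc m) ((\<alpha> ^ Suc (Suc m) - \<beta> ^ Suc (Suc m)) * r m)"
      by (intro order_ge_mult r)
    then have "order_ge (Suc n) (scal (1 / fact (Suc (Suc m))) * ((\<alpha> ^ Suc (Suc m) - \<beta> ^ Suc (Suc m)) * r m))"
      by (rule order_ge_mult_right[OF order_ge_mono]) simp
    then show "order_ge (Suc n) (scal (1 / fact (Suc (Suc m))) * (\<alpha> ^ Suc (Suc m) * r m) - scal (1 / fact (Suc (Suc m))) * (\<beta> ^ Suc (Suc m) * r m))"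
      by (simp only: left_diff_distrib right_diff_distrib)
  qed
qed

lemma flow_surj:
  obtains \<alpha> where "flow \<alpha> var_x = var_x + f * W"
proof -
  define \<Phi> where "\<Phi> \<alpha> = W - (flow_quot \<alpha> var_x - \<alpha>)" for \<alpha>
  have "\<exists>\<alpha>. \<Phi> \<alpha> = \<alpha>"
  proof (rule fixed_point_series)
    fix n g h assume "order_ge n (g - h)"
    from order_ge_minus[OF flow_quot_var_x_diff[OF this]]
    show "order_ge (Suc n) (\<Phi> g - \<Phi> h)" by (simp add: \<Phi>_def algebra_simps)
  qed
  then obtain \<alpha> where "\<Phi> \<alpha> = \<alpha>" ..
  then have "flow_quot \<alpha> var_x = W" by (simp add: \<Phi>_def algebra_simps)
  then show ?thesis using that flow_eq[of \<alpha> var_x] by simp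
qed

lemma flow_inj:
  assumes "flow \<alpha> var_x = flow \<beta> var_x"
  shows "\<alpha> = \<beta>"
proof -
  have "f * flow_quot \<alpha> var_x = f * flow_quot \<beta> var_x" using assms by (simp add: flow_eq)
  then have eq: "flow_quot \<alpha> var_x = flow_quot \<beta> var_x" using f_neq_0 by simp
  have "\<alpha> - \<beta> = 0"
  proof (rule order_ge_raise_eq_0)
    fix n assume "order_ge n (\<alpha> - \<beta>)"
    from order_ge_minus[OF flow_quot_var_x_diff[OF this]] show "order_ge (Suc n) (\<alpha> - \<beta>)"
      by (simp add: eq algebra_simps)
  qed
  then show ?thesis by simp
qed

text \<open>The first term of the quotient is a unit times the derivative of \<open>\<beta>\<close>;
  all others have higher order because f has order at least 2. So an invariant function depends on
  x1 alone.\<close>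

lemma flow_invariant:
  assumes inv: "flow (1 + v) \<beta> = \<beta>" and v: "v $ 0 $ 0 = 0"
  shows "fps_deriv \<beta> = 0"
proof (rule order_ge_raise_eq_0)
  fix n assume n: "order_ge n (fps_deriv \<beta>)"
  let ?w = "1 + v"
  let ?u = "\<lambda>m. scal (1 / fact (Suc m)) * (?w ^ Suc m * fps_deriv ((X ^^ m) \<beta>))"
  have "f * flow_quot ?w \<beta> = 0" using inv flow_eq[of ?w \<beta>] by simp
  then have 0: "sum_series ?u = 0" using f_neq_0 by (simp add: flow_quot_def)
  have "sum_series ?u = ?u 0 + sum_series (\<lambda>m. ?u (Suc m))"
    by (rule sum_series_Suc) (intro null_seq_mult vanishing_deriv_Xpow)
  then have u0: "?u 0 = - sum_series (\<lambda>m. ?u (Suc m))"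
    unfolding 0 by (simp only: eq_neg_iff_add_eq_0)
  have "order_ge (Suc n) (sum_series (\<lambda>m. ?u (Suc m)))"
  proof (rule order_ge_sum_series, intro order_ge_mult_right)
    fix m
    have "order_ge (2 + n) (X \<beta>)" unfolding X_def by (intro order_ge_mult order_f n)
    from order_Xpow[OF this, of m] have "order_ge (m + (2 + n)) ((X ^^ Suc m) \<beta>)"
      by (simp add: funpow_swap1)
    from order_ge_deriv[OF order_ge_mono[OF this]] show "order_ge (Suc n) (fps_deriv ((X ^^ Suc m) \<beta>))" by simp
  qed
  then have "order_ge (Suc n) (?u 0)"
    unfolding u0 by (rule order_ge_minus)
  moreover have "order_ge (Suc n) (v * fps_deriv \<beta>)"
    using order_ge_mult[of 1 v n "fps_deriv \<beta>"] v n by (simp add: order_ge_1_iff)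
  ultimately show "order_ge (Suc n) (fps_deriv \<beta>)"
    using order_ge_diff[of "Suc n" "?u 0" "v * fps_deriv \<beta>"] by (simp add: algebra_simps)
qed

section \<open>Power series in the derivation\<close>

text \<open>The operator c(X). Products of series become compositions of operators, so that
  identities between e^z and z / (e^z - 1) carry over.\<close>

definition oper :: "complex fps \<Rightarrow> series2 \<Rightarrow> series2" where
  "oper c h = sum_series (\<lambda>n. scal (c $ n) * (X ^^ n) h)"

lemma order_oper_term: "order_ge k h \<Longrightarrow> order_ge (n + k) (scal c * (X ^^ n) h)"
  by (intro order_ge_mult_right order_Xpow)

lemma vanishing_oper_term: "null_seq (\<lambda>n. scal (c n) * (X ^^ n) h)"
  by (intro null_seqI order_ge_mult_right order_Xpow0)

lemma order_oper: "order_ge k h \<Longrightarrow> order_ge k (oper c h)"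
  unfolding oper_def by (intro order_ge_sum_series order_ge_mono[OF order_oper_term]) auto

lemma oper_add: "oper c (g + h) = oper c g + oper c h"
  unfolding oper_def
  by (subst sum_series_add[OF vanishing_oper_term vanishing_oper_term, symmetric])
    (simp only: Xpow_add distrib_left)

lemma formal_cont_oper: "formal_cont (oper c)"
  by (rule formal_contI[of _ 0]) (auto simp: oper_add order_oper)

lemma oper_diff: "oper c (g - h) = oper c g - oper c h"
  by (rule formal_cont_diff[OF formal_cont_oper])

lemma oper_minus: "oper c (- h) = - oper c h"
  using oper_diff[of c 0 h] formal_cont_zero[OF formal_cont_oper, of c] by simp

lemma oper_oper: "oper c (oper d h) = oper (c * d) h"
proof -
  define a where "a n j = scal (c $ n) * (scal (d $ j) * (X ^^ (n + j)) h)" for n j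
  have a: "order_ge (n + j) (a n j)" for n j
    unfolding a_def by (intro order_ge_mult_right order_Xpow0)
  have "oper c (oper d h) = sum_series (\<lambda>n. sum_series (a n))"
    unfolding oper_def[of c]
  proof (rule sum_series_cong)
    fix n
    have "(X ^^ n) (oper d h) = sum_series (\<lambda>j. (X ^^ n) (scal (d $ j) * (X ^^ j) h))"
      unfolding oper_def by (rule sum_series_map[OF formal_cont_Xpow vanishing_oper_term])
    also have "\<dots> = sum_series (\<lambda>j. scal (d $ j) * (X ^^ (n + j)) h)"
      by (simp only: Xpow_fps_const_mult funpow_add o_def)
    finally have eq: "(X ^^ n) (oper d h) = sum_series (\<lambda>j. scal (d $ j) * (X ^^ (n + j)) h)" .
    have van: "null_seq (\<lambda>j. scal (d $ j) * (X ^^ (n + j)) h)"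
    proof (rule null_seqI)
      fix j
      have "order_ge j ((X ^^ (n + j)) h)" by (rule order_ge_mono[OF order_Xpow0]) simp
      then show "order_ge j (scal (d $ j) * (X ^^ (n + j)) h)" by (rule order_ge_mult_right)
    qed
    show "scal (c $ n) * (X ^^ n) (oper d h) = sum_series (a n)"
      unfolding eq sum_series_mult[OF van] by (rule sum_series_cong) (simp only: a_def)
  qed
  also have "\<dots> = sum_series (\<lambda>n. \<Sum>m\<le>n. a m (n - m))"
    using a by (rule sum_series_triangle)
  also have "\<dots> = oper (c * d) h"
    unfolding oper_def
  proof (rule sum_series_cong)
    fix n
    have "(\<Sum>m\<le>n. a m (n - m)) = (\<Sum>m\<le>n. scal (c $ m * d $ (n - m)) * (X ^^ n) h)"
      unfolding a_def scal_mult_scal by (intro sum.cong) auto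
    also have "\<dots> = (\<Sum>m\<le>n. scal (c $ m * d $ (n - m))) * (X ^^ n) h"
      by (simp add: sum_distrib_right)
    also have "(\<Sum>m\<le>n. scal (c $ m * d $ (n - m))) = scal ((c * d) $ n)"
      unfolding fps_mult_nth atLeast0AtMost
      by (induction n) (auto intro!: fps_ext simp: nth2_sum fps_sum_nth)
    finally show "(\<Sum>m\<le>n. a m (n - m)) = scal ((c * d) $ n) * (X ^^ n) h" .
  qed
  finally show ?thesis .
qed

lemma oper_fps_X: "oper fps_X h = X h"
proof -
  have "oper fps_X h = sum_series (\<lambda>n. if n = 1 then X h else 0)"
    unfolding oper_def by (intro sum_series_cong) auto
  then show ?thesis by (simp add: sum_series_single)
qed

lemma oper_1: "oper 1 h = h"
proof -
  have "oper 1 h = sum_series (\<lambda>n. if n = 0 then h else 0)"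
    unfolding oper_def by (intro sum_series_cong) auto
  then show ?thesis by (simp add: sum_series_single)
qed

lemma oper_exp: "oper (fps_exp 1) h = flow 1 h"
  unfolding oper_def flow_def by simp

lemma oper_add_left: "oper (c + d) h = oper c h + oper d h"
  unfolding oper_def
  by (subst sum_series_add[symmetric]) (auto simp: algebra_simps vanishing_oper_term simp flip: fps_const_add)

end

section \<open>Restriction of series to lines through the origin\<close>

text \<open>The restriction of a series to the line through the origin with direction \<open>(c, e)\<close>.\<close>

definition restr :: "complex \<Rightarrow> complex \<Rightarrow> series2 \<Rightarrow> complex fps" where
  "restr c e g = Abs_fps (\<lambda>n. \<Sum>i\<le>n. g $ i $ (n - i) * (c ^ i * e ^ (n - i)))"

lemma restr_add: "restr c e (g + h) = restr c e g + restr c e h"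
  by (intro fps_ext) (simp add: restr_def algebra_simps sum.distrib)

lemma restr_diff: "restr c e (g - h) = restr c e g - restr c e h"
  by (intro fps_ext) (simp add: restr_def algebra_simps sum_subtractf)

lemma restr_0 [simp]: "restr c e 0 = 0"
  by (intro fps_ext) (simp add: restr_def)

lemma restr_sum: "restr c e (sum u A) = (\<Sum>k\<in>A. restr c e (u k))"
  by (induction A rule: infinite_finite_induct) (auto simp: restr_add)

lemma restr_mult: "restr c e (g * h) = restr c e g * restr c e h"
proof (intro fps_ext)
  fix n
  define F where "F k l i j = g $ k $ l * h $ i $ j * (c ^ (k + i) * e ^ (l + j))" for k l i j
  have "restr c e (g * h) $ n
      = (\<Sum>i\<le>n. \<Sum>k\<le>i. \<Sum>l\<le>n - i. F k l (i - k) (n - i - l))"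
    unfolding restr_def fps_nth_Abs_fps mult_nth2 atLeast0AtMost sum_distrib_right
  proof (intro sum.cong refl)
    fix i k l assume "i \<in> {..n}" "k \<in> {..i}" "l \<in> {..n - i}"
    then have "c ^ i = c ^ (k + (i - k))" "e ^ (n - i) = e ^ (l + (n - i - l))" by auto
    then show "g $ k $ l * h $ (i - k) $ (n - i - l) * (c ^ i * e ^ (n - i)) = F k l (i - k) (n - i - l)"
      by (simp add: F_def)
  qed
  also have "\<dots> = (\<Sum>(i, k, l)\<in>(SIGMA i:{..n}. SIGMA k:{..i}. {..n - i}). F k l (i - k) (n - i - l))"
    by (simp add: sum.Sigma)
  also have "\<dots> = (\<Sum>(p, k, q)\<in>(SIGMA p:{..n}. SIGMA k:{..p}. {..n - p}). F k (p - k) q (n - p - q))"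
    by (rule sum.reindex_bij_witness[of _ "\<lambda>(p, k, q). (k + q, k, p - k)" "\<lambda>(i, k, l). (k + l, k, i - k)"])
      (auto simp: diff_diff_eq add_ac)
  also have "\<dots> = (\<Sum>p\<le>n. \<Sum>k\<le>p. \<Sum>q\<le>n - p. F k (p - k) q (n - p - q))"
    by (simp add: sum.Sigma)
  also have "\<dots> = (restr c e g * restr c e h) $ n"
    unfolding fps_mult_nth restr_def fps_nth_Abs_fps atLeast0AtMost sum_product
    by (intro sum.cong refl) (simp only: F_def power_add mult_ac)
  finally show "restr c e (g * h) $ n = (restr c e g * restr c e h) $ n" .
qed

lemma restr_fps_const: "restr c e (fps_const k) $ n = k $ n * e ^ n"
proof -
  have "restr c e (fps_const k) $ n = (\<Sum>i\<le>n. if i = 0 then k $ n * e ^ n else 0)"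
    unfolding restr_def fps_nth_Abs_fps by (intro sum.cong) auto
  then show ?thesis by simp
qed

lemma restr_scal [simp]: "restr c e (scal k) = fps_const k"
  by (intro fps_ext) (simp add: restr_fps_const)

lemma restr_1 [simp]: "restr c e 1 = 1"
  using restr_scal[of c e 1] by simp

lemma restr_power: "restr c e (g ^ n) = restr c e g ^ n"
  by (induction n) (auto simp: restr_mult)

lemma restr_of_nat [simp]: "restr c e (of_nat k) = of_nat k"
  by (induction k) (auto simp: restr_add)

lemma restr_var_x [simp]: "restr c e var_x = fps_const c * fps_X"
proof (intro fps_ext)
  fix n
  have "restr c e var_x $ n = (\<Sum>i\<le>n. if i = 1 then (if n = 1 then c else 0) else 0)"
    unfolding restr_def fps_nth_Abs_fps by (intro sum.cong) auto
  then show "restr c e var_x $ n = (fps_const c * fps_X) $ n" by auto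
qed

lemma restr_var_x1 [simp]: "restr c e var_x1 = fps_const e * fps_X"
  by (intro fps_ext) (auto simp: restr_fps_const le_Suc_eq)

lemma order_restr: "order_ge N g \<Longrightarrow> n < N \<Longrightarrow> restr c e g $ n = 0"
  by (auto simp: restr_def order_ge_def)

lemma restr_sum_series:
  assumes "\<And>k. M \<le> k \<Longrightarrow> order_ge (Suc n) (u k)"
  shows "restr c e (sum_series u) $ n = (\<Sum>k<M. restr c e (u k) $ n)"
  using order_restr[OF sum_series_approx[OF assms], where n = n and c = c and e = e]
  by (simp add: restr_diff restr_sum fps_sum_nth)

lemma restr_formal_sums:
  assumes "formal_sums u g"
  shows "\<forall>\<^sub>F M in sequentially. restr c e g $ n = (\<Sum>k<M. restr c e (u k) $ n)"
proof -
  have "\<forall>\<^sub>F M in sequentially. order_ge (Suc n) (g - (\<Sum>k<M. u k))"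
    using assms by (auto simp: formal_sums_iff)
  then show ?thesis
  proof eventually_elim
    case (elim M)
    from order_restr[OF this, of n c e] show ?case
      by (simp add: restr_diff restr_sum fps_sum_nth)
  qed
qed

subsection \<open>Divisibility by the equation of a line\<close>

definition line :: "complex \<Rightarrow> series2" where
  "line c = var_x - scal c * var_x1"

lemma deriv_line [simp]: "fps_deriv (line c) = 1"
  by (simp add: line_def)

lemma restr_line: "restr c 1 (line c') = fps_const (c - c') * fps_X"
  by (simp only: line_def restr_diff restr_mult restr_var_x restr_var_x1
      restr_scal fps_const_1_eq_1 mult_1_left fps_const_sub[symmetric] left_diff_distrib)

lemma restr_self [simp]: "restr c 1 (line c) = 0"
  by (simp add: restr_line)

lemma line_neq_0 [simp]: "line c \<noteq> 0"
  using deriv_line[of c] by (metis fps_deriv_0 zero_neq_one)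

text \<open>The remainder is the value at x = c x1, and the quotient collects the divided
  differences (x^i - (c x1)^i) / (x - c x1).\<close>

lemma line_division:
  "\<exists>q. g = line c * q + fps_const (restr c 1 g)"
proof -
  define q where "q = Abs_fps (\<lambda>i. Abs_fps (\<lambda>j. \<Sum>l\<le>j. g $ (i + 1 + l) $ (j - l) * c ^ l))"
  have "g $ i $ j = (line c * q + fps_const (restr c 1 g)) $ i $ j" for i j
  proof -
    have shift: "c * (\<Sum>l\<le>j'. g $ (i + 1 + l) $ (j' - l) * c ^ l) = (\<Sum>l=1..Suc j'. g $ (i + l) $ (Suc j' - l) * c ^ l)" for j'
      unfolding One_nat_def sum.shift_bounds_cl_Suc_ivl atMost_atLeast0 sum_distrib_left
      by (intro sum.cong) auto
    have x1q: "(scal c * var_x1 * q) $ i $ j = (\<Sum>l=1..j. g $ (i + l) $ (j - l) * c ^ l)"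
      using shift by (cases j) (auto simp: q_def mult.assoc)
    have lq: "(line c * q) $ i $ j = (if i = 0 then 0 else q $ (i - 1) $ j) - (\<Sum>l=1..j. g $ (i + l) $ (j - l) * c ^ l)"
      by (simp only: line_def left_diff_distrib fps_sub_nth x1q) simp
    have split: "(\<Sum>l\<le>j. g $ (i + l) $ (j - l) * c ^ l) = g $ i $ j + (\<Sum>l=1..j. g $ (i + l) $ (j - l) * c ^ l)"
      by (simp add: atMost_atLeast0 sum.atLeast_Suc_atMost)
    show ?thesis
    proof (cases i)
      case 0
      then show ?thesis using lq split by (simp add: restr_def)
    next
      case (Suc i')
      then show ?thesis using lq split by (simp add: q_def)
    qed
  qed
  then have "g = line c * q + fps_const (restr c 1 g)" by (intro fps_ext)
  then show ?thesis ..
qed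

lemma line_dvd_iff: "line c dvd g \<longleftrightarrow> restr c 1 g = 0"
proof
  assume "line c dvd g"
  then show "restr c 1 g = 0" by (auto simp: dvd_def restr_mult)
next
  assume 0: "restr c 1 g = 0"
  obtain q where "g = line c * q + fps_const (restr c 1 g)"
    using line_division by blast
  with 0 show "line c dvd g" by (metis add.right_neutral dvd_triv_left fps_const_0_eq_0)
qed

text \<open>The equation of a line is prime: a factor that does not vanish identically on the line
  can be cancelled.\<close>

lemma line_power_dvd_mult:
  assumes "restr c 1 q \<noteq> 0" "line c ^ k dvd q * g"
  shows "line c ^ k dvd g"
  using assms(2)
proof (induction k)
  case (Suc k)
  then obtain g' where g: "g = line c ^ k * g'"
    using dvd_trans[OF le_imp_power_dvd[of k "Suc k"]] by (auto simp: dvd_def)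
  obtain m where "q * g = line c ^ Suc k * m" using Suc.prems by (auto simp: dvd_def)
  then have "line c ^ k * (q * g') = line c ^ k * (line c * m)" by (simp add: g mult_ac)
  then have "q * g' = line c * m" by simp
  then have "restr c 1 (q * g') = 0" by (simp add: restr_mult)
  then have "line c dvd g'" using assms(1) by (simp add: line_dvd_iff restr_mult)
  then show ?case unfolding g power_Suc2 by (rule mult_dvd_mono[OF dvd_refl])
qed simp

lemma deriv_line_power_mult:
  "fps_deriv (line c ^ Suc m * V) = line c ^ m * (of_nat (Suc m) * V + line c * fps_deriv V)"
proof -
  have "fps_deriv (line c ^ Suc m) = of_nat (Suc m) * line c ^ m"
    by (simp only: fps_deriv_power' deriv_line mult_1_right diff_Suc_1)
  then show ?thesis by (simp only: fps_deriv_mult) (simp add: algebra_simps del: of_nat_Suc)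
qed

text \<open>Every derivative has to hit a factor \<open>line c\<close>, since otherwise the product
  vanishes on the line.\<close>

lemma restrict_deriv_line_power:
  "restr c 1 ((fps_deriv ^^ m) (line c ^ m * V)) = of_nat (fact m) * restr c 1 V"
proof (induction m arbitrary: V)
  case (Suc m)
  have "restr c 1 ((fps_deriv ^^ Suc m) (line c ^ Suc m * V))
      = restr c 1 ((fps_deriv ^^ m) (line c ^ m * (of_nat (Suc m) * V + line c * fps_deriv V)))"
    by (simp only: funpow_Suc_right o_apply deriv_line_power_mult)
  then show ?case unfolding Suc.IH
    by (simp add: restr_add restr_mult del: of_nat_Suc) (simp add: algebra_simps)
qed simp

lemma power_one_plus_expand: "\<exists>R. (1 + t) ^ m = 1 + of_nat m * t + t\<^sup>2 * (R :: 'a :: comm_ring_1)"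
proof (induction m)
  case (Suc m)
  then obtain R where "(1 + t) ^ m = 1 + of_nat m * t + t\<^sup>2 * R" by blast
  then have "(1 + t) ^ Suc m = 1 + of_nat (Suc m) * t + t\<^sup>2 * (of_nat m + R + t * R)"
    by (simp add: algebra_simps power2_eq_square)
  then show ?case by blast
qed (auto intro: exI[of _ 0])

text \<open>Write p for \<open>line c\<close> and \<open>q * \<rho>\<close> as p^i y. Modulo p^(i+1)
  the last factor is 1 and the derivative contributes (i + 1) p^i y, which leaves 1 + (i + 1) p^i y
  - (1 + p^i y)^m. For i > 0 the linear part (i + 1 - m) p^i y forces y to vanish on the line, as i
  + 1 < m.\<close>

lemma line_power_dvd_step:
  assumes \<rho>: "line c ^ i dvd \<rho>" and i: "Suc i < m" and q: "restr c 1 q \<noteq> 0" "q $ 0 $ 0 = 0"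
    and eq: "line c ^ (m - 1) dvd 1 + fps_deriv (line c * q * \<rho>) - (1 + q * \<rho>) ^ m * (1 + line c * \<rho>) ^ n"
  shows "line c ^ Suc i dvd \<rho>"
proof -
  define p where "p = line c"
  obtain \<eta> where \<eta>: "\<rho> = p ^ i * \<eta>" using \<rho> by (auto simp: dvd_def p_def)
  define y where "y = q * \<eta>"
  define D where "D = fps_deriv (p * q * \<rho>)"
  define A where "A = (1 + q * \<rho>) ^ m"
  define B where "B = (1 + p * \<rho>) ^ n"
  obtain R1 where R1: "B = 1 + of_nat n * (p * \<rho>) + (p * \<rho>)\<^sup>2 * R1"
    using power_one_plus_expand[of "p * \<rho>" n] by (auto simp: B_def)
  have 1: "p ^ Suc i dvd B - 1"
  proof -
    have "B - 1 = p ^ Suc i * (of_nat n * \<eta> + \<eta> * (p * \<rho>) * R1)"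
      unfolding R1 by (simp add: \<eta> power2_eq_square algebra_simps)
    then show ?thesis by simp
  qed
  have 2: "p ^ Suc i dvd D - of_nat (Suc i) * p ^ i * y"
  proof -
    have "p * q * \<rho> = p ^ Suc i * y" by (simp add: \<eta> y_def mult_ac)
    then have "D - of_nat (Suc i) * p ^ i * y = p ^ Suc i * fps_deriv y"
      unfolding D_def p_def by (simp only: deriv_line_power_mult) (simp add: algebra_simps del: of_nat_Suc)
    then show ?thesis by simp
  qed
  have 3: "p ^ Suc i dvd 1 + D - A * B"
    using eq dvd_trans[OF le_imp_power_dvd[of "Suc i" "m - 1" p]] i by (simp add: p_def A_def B_def D_def)
  have qr: "q * \<rho> = p ^ i * y" by (simp add: \<eta> y_def mult_ac)
  have "p ^ Suc i dvd (1 + D - A * B)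
      - (D - of_nat (Suc i) * p ^ i * y) + A * (B - 1)"
    by (intro dvd_add dvd_diff 1 2 3 dvd_mult)
  also have "(1 + D - A * B)
      - (D - of_nat (Suc i) * p ^ i * y) + A * (B - 1)
      = 1 + of_nat (Suc i) * p ^ i * y - (1 + p ^ i * y) ^ m"
    unfolding A_def qr by (simp add: algebra_simps)
  finally have main: "p ^ Suc i dvd 1 + of_nat (Suc i) * p ^ i * y - (1 + p ^ i * y) ^ m" .
  have "restr c 1 y = 0"
  proof (cases "i = 0")
    \<comment> \<open>For i = 0 the higher powers of y cannot be neglected. The equation on the line
      is 1 + Y = (1 + Y)^m, so 1 + Y is a root of unity, and it is 1 because Y has no constant
      term.\<close>
    case True
    define Y where "Y = restr c 1 y"
    have Y0: "Y $ 0 = 0" using q(2) by (simp add: Y_def y_def restr_def)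
    have "restr c 1 (1 + y - (1 + y) ^ m) = 0"
      using main True by (simp add: line_dvd_iff p_def)
    then have "1 + Y - (1 + Y) ^ m = 0"
      by (simp add: restr_diff restr_add restr_power Y_def)
    moreover have "(1 + Y) ^ m = (1 + Y) * (1 + Y) ^ (m - 1)"
      using i by (cases m) auto
    ultimately have "(1 + Y) * ((1 + Y) ^ (m - 1) - 1) = 0" by (simp add: algebra_simps)
    moreover have "(1 + Y) $ 0 \<noteq> 0" using Y0 by simp
    then have "1 + Y \<noteq> 0" by (metis fps_zero_nth)
    ultimately have "(1 + Y) ^ (m - 1) - 1 = 0" by simp
    then have "Y * (\<Sum>j<m - 1. (1 + Y) ^ j) = 0" by (simp add: power_diff_1_eq)
    moreover have "(\<Sum>j<m - 1. (1 + Y) ^ j) $ 0 \<noteq> 0"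
      using i Y0 by (simp add: fps_sum_nth fps_nth_power_0)
    then have "(\<Sum>j<m - 1. (1 + Y) ^ j) \<noteq> 0" by auto
    ultimately show ?thesis by (simp add: Y_def)
  next
    case False
    obtain R where R: "(1 + p ^ i * y) ^ m = 1 + of_nat m * (p ^ i * y) + (p ^ i * y)\<^sup>2 * R"
      using power_one_plus_expand by blast
    have pp: "p ^ i * p ^ i = p ^ i * (p * p ^ (i - 1))" using False by (cases i) auto
    have "1 + of_nat (Suc i) * p ^ i * y - (1 + p ^ i * y) ^ m
        = p ^ i * (of_nat (Suc i) * y - of_nat m * y) - (p ^ i * p ^ i) * (y * y * R)"
      unfolding R by (simp add: algebra_simps power2_eq_square)
    also have "\<dots> = p ^ i * (of_nat (Suc i) * y - of_nat m * y - p * (p ^ (i - 1) * (y * y * R)))"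
      unfolding pp by (simp add: algebra_simps)
    finally have "p ^ i * p dvd p ^ i * (of_nat (Suc i) * y - of_nat m * y - p * (p ^ (i - 1) * (y * y * R)))"
      using main by (simp add: mult_ac)
    then have "p dvd of_nat (Suc i) * y - of_nat m * y - p * (p ^ (i - 1) * (y * y * R))"
      by (simp add: p_def)
    then have "p dvd (of_nat (Suc i) * y - of_nat m * y - p * (p ^ (i - 1) * (y * y * R))) + p * (p ^ (i - 1) * (y * y * R))"
      by (intro dvd_add) auto
    then have "restr c 1 (of_nat (Suc i) * y - of_nat m * y) = 0"
      by (simp add: line_dvd_iff p_def)
    then have "(of_nat (Suc i) - of_nat m) * restr c 1 y = 0"
      by (simp add: restr_diff restr_mult left_diff_distrib del: of_nat_Suc)
    moreover have "of_nat (Suc i) - of_nat m \<noteq> (0 :: complex fps)"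
      using i by (metis eq_iff_diff_eq_0 nat_neq_iff of_nat_eq_iff)
    ultimately show ?thesis by simp
  qed
  then have "restr c 1 \<eta> = 0" using q(1) by (simp add: y_def restr_mult)
  then have "p dvd \<eta>" by (simp add: line_dvd_iff p_def)
  then show ?thesis unfolding \<eta> p_def[symmetric] power_Suc2 by (rule mult_dvd_mono[OF dvd_refl])
qed

section \<open>Displacement of a conjugacy along a line of fixed points\<close>

context planar_field
begin

text \<open>All terms beyond the first contain the derivative of a multiple of f, and one derivative
  lowers the multiplicity of the line by one only.\<close>

lemma flow_quot_mod_line:
  assumes f: "f = line c ^ Suc m * Q"
  shows "line c ^ m dvd flow_quot w g - w * fps_deriv g"
proof -
  define k where "k j = fps_deriv ((X ^^ j) g)" for j
  define v where "v j = of_nat (Suc m) * (Q * k j) + line c * fps_deriv (Q * k j)" for j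
  have dX: "fps_deriv ((X ^^ Suc j) g) = line c ^ m * v j" for j
  proof -
    have "(X ^^ Suc j) g = f * k j" by (simp add: X_def k_def)
    also have "\<dots> = line c ^ Suc m * (Q * k j)" by (subst f) (simp only: mult.assoc)
    finally show ?thesis by (simp only: deriv_line_power_mult v_def)
  qed
  have vk: "null_seq k" unfolding k_def by (rule vanishing_deriv_Xpow)
  have vv: "null_seq v" unfolding v_def
    by (intro null_seq_add null_seq_mult null_seq_deriv vk)
  let ?s = "\<lambda>j. scal (1 / fact (Suc (Suc j)))"
  have "flow_quot w g = w * fps_deriv g + sum_series (\<lambda>j. ?s j * (w ^ Suc (Suc j) * fps_deriv ((X ^^ Suc j) g)))"
  proof -
    have "null_seq (\<lambda>j. scal (1 / fact (Suc j)) * (w ^ Suc j * fps_deriv ((X ^^ j) g)))"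
      by (intro null_seq_mult vanishing_deriv_Xpow)
    from sum_series_Suc[OF this] show ?thesis unfolding flow_quot_def by simp
  qed
  also have "sum_series (\<lambda>j. ?s j * (w ^ Suc (Suc j) * fps_deriv ((X ^^ Suc j) g)))
      = sum_series (\<lambda>j. line c ^ m * (?s j * (w ^ Suc (Suc j) * v j)))"
    unfolding dX by (rule sum_series_cong) (simp only: mult_ac)
  also have "\<dots> = line c ^ m * sum_series (\<lambda>j. ?s j * (w ^ Suc (Suc j) * v j))"
    by (rule sum_series_mult[symmetric]) (intro null_seq_mult vv)
  finally show ?thesis by simp
qed

text \<open>Let \<open>?P\<close> be the quotient of f o \<sigma> by f. Dividing the displacements
  of both sides by f gives \<open>?P\<close> = d\<sigma>/dx modulo the power m - 1 of the line: to
  this precision \<sigma> preserves the vector field. The divisibility step then raises the exponent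
  in \<open>\<rho>\<close> up to m - 1, and the factor \<open>line c\<close> of the displacement
  supplies the last power.\<close>

lemma conjugacy_dvd:
  assumes f: "f = line c ^ m * line c' ^ n" and m: "m \<ge> 1" and c: "c \<noteq> c'"
    and \<sigma>: "\<sigma> = var_x + line c * line c' * \<rho>" "\<sigma> $ 0 = 0"
    and conj: "flow (1 + s * f) \<sigma> = flow 1 var_x oo \<sigma>"
  shows "line c ^ m dvd line c * line c' * \<rho>"
proof -
  define p where "p = line c"
  define q where "q = line c'"
  define U where "U = flow_quot 1 var_x"
  let ?P = "(1 + q * \<rho>) ^ m * (1 + p * \<rho>) ^ n"
  let ?w = "1 + s * f"
  obtain k where k: "m = Suc k" using m by (cases m) auto
  have fk: "f = line c ^ Suc k * q ^ n" by (simp add: f k q_def)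
  note comp = fps_compose_mult_distrib[OF \<sigma>(2)] fps_compose_power[OF \<sigma>(2), symmetric]
    fps_compose_add_distrib fps_compose_sub_distrib
  have line_oo: "line e oo \<sigma> = line e + p * q * \<rho>" for e
    by (simp add: line_def comp \<sigma>(2)) (simp add: \<sigma>(1) p_def q_def line_def)
  have f_oo: "f oo \<sigma> = f * ?P"
  proof -
    have "f oo \<sigma> = (p + p * q * \<rho>) ^ m * (q + p * q * \<rho>) ^ n"
      unfolding f comp line_oo by (simp add: p_def q_def)
    also have "p + p * q * \<rho> = p * (1 + q * \<rho>)" by (simp add: algebra_simps)
    also have "q + p * q * \<rho> = q * (1 + p * \<rho>)" by (simp add: algebra_simps)
    finally show ?thesis by (simp add: f power_mult_distrib p_def q_def mult_ac)
  qed
  have "f * flow_quot ?w \<sigma> = f * (?P * (U oo \<sigma>))"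
  proof -
    have "flow 1 var_x oo \<sigma> = \<sigma> + (f oo \<sigma>) * (U oo \<sigma>)"
      unfolding flow_eq[of 1] by (simp add: comp \<sigma>(2) U_def)
    then have "\<sigma> + f * flow_quot ?w \<sigma> = \<sigma> + f * (?P * (U oo \<sigma>))"
      unfolding flow_eq[of _ \<sigma>, symmetric] conj f_oo mult.assoc .
    then show ?thesis by (simp only: add_left_cancel)
  qed
  then have eq: "flow_quot ?w \<sigma> = ?P * (U oo \<sigma>)"
    using f_neq_0 by simp
  obtain V where V: "flow_quot ?w \<sigma> = ?w * fps_deriv \<sigma> + p ^ k * V"
    using flow_quot_mod_line[OF fk, of ?w \<sigma>] by (auto simp: dvd_def p_def algebra_simps)
  obtain V0 where V0: "U = 1 + p ^ k * V0"
    using flow_quot_mod_line[OF fk, of 1 var_x] by (auto simp: dvd_def p_def U_def algebra_simps)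
  have pk: "p oo \<sigma> = p * (1 + q * \<rho>)" unfolding p_def line_oo by (simp add: p_def algebra_simps)
  have Uo: "U oo \<sigma> = 1 + p ^ k * ((1 + q * \<rho>) ^ k * (V0 oo \<sigma>))"
    unfolding V0 comp pk by (simp add: power_mult_distrib mult_ac)
  have "1 + fps_deriv (p * q * \<rho>) - ?P
      = p ^ k * (?P * ((1 + q * \<rho>) ^ k * (V0 oo \<sigma>)) - V - s * p * q ^ n * fps_deriv \<sigma>)"
  proof -
    have "fps_deriv \<sigma> + s * f * fps_deriv \<sigma> + p ^ k * V = ?P + ?P * (p ^ k * ((1 + q * \<rho>) ^ k * (V0 oo \<sigma>)))"
      using eq unfolding V Uo by (simp add: algebra_simps)
    \<comment> \<open>The term from the parameter s is absorbed: f has the factor p^(k+1), one more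
      than the precision requires.\<close>
    moreover have "s * f * fps_deriv \<sigma> = p ^ k * (s * p * q ^ n * fps_deriv \<sigma>)"
      unfolding fk by (simp add: p_def mult_ac)
    moreover have "fps_deriv \<sigma> = 1 + fps_deriv (p * q * \<rho>)"
      by (simp only: \<sigma>(1) p_def q_def fps_deriv_add fps_deriv_fps_X)
    moreover have "1 + D - P = u * (P * B - V - Z)"
      if "D1 + S + u * V = P + P * (u * B)" "S = u * Z" "D1 = 1 + D" for D1 D S u V P B Z :: series2
    proof -
      have "1 + D - P = P * (u * B) - u * Z - u * V" using that by (simp add: algebra_simps)
      then show ?thesis by (simp add: algebra_simps)
    qed
    ultimately show ?thesis by blast
  qed
  then have main: "line c ^ (m - 1) dvd 1 + fps_deriv (line c * q * \<rho>) - (1 + q * \<rho>) ^ m * (1 + line c * \<rho>) ^ n"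
    unfolding p_def[symmetric] k by simp
  have q0: "restr c 1 q \<noteq> 0" "q $ 0 $ 0 = 0"
    unfolding q_def restr_line using c by (auto simp: line_def)
  have "i \<le> k \<Longrightarrow> line c ^ i dvd \<rho>" for i
  proof (induction i)
    case (Suc i)
    then show ?case by (intro line_power_dvd_step[OF _ _ q0 main]) (auto simp: k)
  qed simp
  from this[of k] have "line c * line c ^ k dvd line c * (q * \<rho>)"
    by (intro mult_dvd_mono dvd_refl dvd_mult) simp
  then show ?thesis by (simp add: k q_def mult.assoc)
qed

end

subsection \<open>Convergent series\<close>

abbreviation square_sum :: "real \<Rightarrow> series2 \<Rightarrow> nat \<Rightarrow> real" where
  "square_sum r g n \<equiv> (\<Sum>i\<le>n. \<Sum>j\<le>n. norm (g $ i $ j) * r ^ (i + j))"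

text \<open>Bounds the weighted l1 norm at radius r through its partial sums over squares. This norm
  is submultiplicative, and finite sums keep rearrangements elementary.\<close>

definition norm_bound :: "real \<Rightarrow> real \<Rightarrow> series2 \<Rightarrow> bool" where
  "norm_bound r B g \<longleftrightarrow> (\<forall>n. square_sum r g n \<le> B)"

lemma norm_bound_nonneg: "norm_bound r B g \<Longrightarrow> r \<ge> 0 \<Longrightarrow> B \<ge> 0"
  unfolding norm_bound_def by (rule order_trans[OF _ spec[of _ 0]]) (auto)

lemma norm_bound_imp_convergent:
  assumes "norm_bound r B g" "r > 0"
  shows "g \<in> convergent_series"
proof -
  let ?h = "\<lambda>(i, j). norm (g $ i $ j) * r ^ (i + j)"
  have "?h summable_on UNIV"
  proof (rule nonneg_bdd_above_summable_on)
    show "bdd_above (sum ?h ` {F. F \<subseteq> UNIV \<and> finite F})"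
    proof (rule bdd_aboveI2)
      fix F :: "(nat \<times> nat) set" assume "F \<in> {F. F \<subseteq> UNIV \<and> finite F}"
      then have fin: "finite F" by simp
      define n where "n = Max (insert 0 (fst ` F \<union> snd ` F))"
      have "F \<subseteq> {..n} \<times> {..n}"
      proof
        fix p assume "p \<in> F"
        then have "fst p \<le> n" "snd p \<le> n" unfolding n_def using fin by (auto intro!: Max_ge)
        then show "p \<in> {..n} \<times> {..n}" by (cases p) auto
      qed
      then have "sum ?h F \<le> sum ?h ({..n} \<times> {..n})"
        using assms(2) by (intro sum_mono2) auto
      also have "\<dots> = square_sum r g n"
        by (simp add: sum.cartesian_product)
      also have "\<dots> \<le> B" using assms(1) by (auto simp: norm_bound_def)
      finally show "sum ?h F \<le> B" .
    qed
  qed (use assms(2) in auto)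
  then show ?thesis using assms(2) by (auto simp: convergent_series_def)
qed

lemma convergent_imp_norm_bound:
  assumes "g \<in> convergent_series"
  obtains r B where "r > 0" "norm_bound r B g"
proof -
  obtain r where r: "r > 0" and s: "(\<lambda>(i, j). norm (g $ i $ j) * r ^ (i + j)) summable_on UNIV"
    using assms by (auto simp: convergent_series_def)
  let ?h = "\<lambda>(i, j). norm (g $ i $ j) * r ^ (i + j)"
  have "norm_bound r (infsum ?h UNIV) g"
    unfolding norm_bound_def
  proof
    fix n
    have "square_sum r g n = sum ?h ({..n} \<times> {..n})"
      by (simp add: sum.cartesian_product)
    also have "\<dots> \<le> infsum ?h UNIV"
      using r by (intro finite_sum_le_infsum s) auto
    finally show "square_sum r g n \<le> infsum ?h UNIV" .
  qed
  with r that show ?thesis by blast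
qed

lemma norm_bound_mono:
  assumes "norm_bound r B g" "B \<le> B'" "0 \<le> r'" "r' \<le> r"
  shows "norm_bound r' B' g"
  unfolding norm_bound_def
proof
  fix n
  have "square_sum r' g n \<le> square_sum r g n"
    using assms by (intro sum_mono mult_left_mono power_mono) auto
  also have "\<dots> \<le> B'" using assms by (auto simp: norm_bound_def intro: order_trans)
  finally show "square_sum r' g n \<le> B'" .
qed

lemma norm_bound_add:
  assumes "norm_bound r B g" "norm_bound r C h" "r \<ge> 0"
  shows "norm_bound r (B + C) (g + h)"
  unfolding norm_bound_def
proof
  fix n
  have "square_sum r (g + h) n
      \<le> (\<Sum>i\<le>n. \<Sum>j\<le>n. norm (g $ i $ j) * r ^ (i + j) + norm (h $ i $ j) * r ^ (i + j))"
    using assms(3) by (intro sum_mono) (auto simp: distrib_right[symmetric] intro!: mult_right_mono norm_triangle_ineq)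
  also have "\<dots> \<le> B + C"
    using assms(1,2) by (auto simp: sum.distrib norm_bound_def intro: add_mono)
  finally show "square_sum r (g + h) n \<le> B + C" .
qed

lemma triangle_sum_le:
  fixes a :: "nat \<Rightarrow> nat \<Rightarrow> real"
  assumes "\<And>k l. a k l \<ge> 0"
  shows "(\<Sum>i\<le>n. \<Sum>k\<le>i. a k (i - k)) \<le> (\<Sum>k\<le>n. \<Sum>l\<le>n. a k l)"
proof -
  have "(\<Sum>i\<le>n. \<Sum>k\<le>i. a k (i - k)) = (\<Sum>(k, l)\<in>{(k, l). k + l \<le> n}. a k l)"
    by (rule sum.triangle_reindex_eq[symmetric])
  also have "\<dots> \<le> (\<Sum>(k, l)\<in>{..n} \<times> {..n}. a k l)"
    using assms by (intro sum_mono2) auto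
  finally show ?thesis by (simp add: sum.cartesian_product)
qed

lemma norm_bound_mult:
  assumes "norm_bound r B g" "norm_bound r C h" "r \<ge> 0"
  shows "norm_bound r (B * C) (g * h)"
  unfolding norm_bound_def
proof
  fix n
  define G where "G k l = norm (g $ k $ l) * r ^ (k + l)" for k l
  define H where "H k l = norm (h $ k $ l) * r ^ (k + l)" for k l
  have nn: "G k l \<ge> 0" "H k l \<ge> 0" for k l using assms(3) by (auto simp: G_def H_def)
  have "square_sum r (g * h) n
      \<le> (\<Sum>i\<le>n. \<Sum>j\<le>n. \<Sum>k\<le>i. \<Sum>l\<le>j. G k l * H (i - k) (j - l))"
  proof (intro sum_mono)
    fix i j
    have "norm ((g * h) $ i $ j) * r ^ (i + j)
        \<le> (\<Sum>k\<le>i. \<Sum>l\<le>j. norm (g $ k $ l * h $ (i - k) $ (j - l))) * r ^ (i + j)"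
      unfolding mult_nth2 atLeast0AtMost using assms(3)
      by (intro mult_right_mono sum_norm_le order_refl) auto
    also have "\<dots> = (\<Sum>k\<le>i. \<Sum>l\<le>j. G k l * H (i - k) (j - l))"
      unfolding sum_distrib_right
    proof (intro sum.cong refl)
      fix k l assume "k \<in> {..i}" "l \<in> {..j}"
      then have "i + j = (k + l) + ((i - k) + (j - l))" by auto
      then have "r ^ (i + j) = r ^ (k + l) * r ^ ((i - k) + (j - l))" by (simp only: power_add)
      then show "norm (g $ k $ l * h $ (i - k) $ (j - l)) * r ^ (i + j) = G k l * H (i - k) (j - l)"
        by (simp add: G_def H_def norm_mult)
    qed
    finally show "norm ((g * h) $ i $ j) * r ^ (i + j) \<le> (\<Sum>k\<le>i. \<Sum>l\<le>j. G k l * H (i - k) (j - l))" .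
  qed
  also have "\<dots> = (\<Sum>i\<le>n. \<Sum>k\<le>i. \<Sum>j\<le>n. \<Sum>l\<le>j. G k l * H (i - k) (j - l))"
    by (intro sum.cong refl sum.swap)
  also have "\<dots> \<le> (\<Sum>k\<le>n. \<Sum>q\<le>n. \<Sum>j\<le>n. \<Sum>l\<le>j. G k l * H q (j - l))"
    by (rule triangle_sum_le[where a = "\<lambda>k q. \<Sum>j\<le>n. \<Sum>l\<le>j. G k l * H q (j - l)"])
      (auto intro!: sum_nonneg mult_nonneg_nonneg nn)
  also have "\<dots> \<le> (\<Sum>k\<le>n. \<Sum>q\<le>n. \<Sum>l\<le>n. \<Sum>p\<le>n. G k l * H q p)"
    by (intro sum_mono triangle_sum_le[where a = "\<lambda>l p. G _ l * H _ p"]) (auto intro!: mult_nonneg_nonneg nn)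
  also have "\<dots> = (\<Sum>k\<le>n. \<Sum>l\<le>n. G k l) * (\<Sum>q\<le>n. \<Sum>p\<le>n. H q p)"
    by (simp add: sum_product)
  also have "\<dots> \<le> B * C"
    using assms norm_bound_nonneg[OF assms(1,3)]
    by (intro mult_mono) (auto simp: norm_bound_def G_def H_def intro!: sum_nonneg)
  finally show "square_sum r (g * h) n \<le> B * C" .
qed

lemma norm_bound_scal: "norm_bound r (norm c) (scal c)"
  unfolding norm_bound_def
proof
  fix n
  have "square_sum r (scal c) n
      = (\<Sum>i\<le>n. \<Sum>j\<le>n. if j = 0 then (if i = 0 then norm c else 0) else 0)"
    by (intro sum.cong refl) auto
  then show "square_sum r (scal c) n \<le> norm c" by simp
qed

lemma norm_bound_scal_mult: 
  assumes "norm_bound r B g" "r \<ge> 0"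
  shows "norm_bound r (norm c * B) (scal c * g)"
  by (rule norm_bound_mult[OF norm_bound_scal assms])

lemma norm_bound_1: "norm_bound r 1 1"
  using norm_bound_scal[of r 1] by simp

lemma norm_bound_power: "norm_bound r B g \<Longrightarrow> r \<ge> 0 \<Longrightarrow> norm_bound r (B ^ n) (g ^ n)"
  by (induction n) (auto intro: norm_bound_1 norm_bound_mult)

lemma norm_bound_sum_series:
  assumes B: "\<And>n. norm_bound r (B n) (u n)" "summable B" and r: "r \<ge> 0" and u: "null_seq u"
  shows "norm_bound r (suminf B) (sum_series u)"
  unfolding norm_bound_def
proof
  fix n
  obtain M where M: "\<And>k. M \<le> k \<Longrightarrow> order_ge (Suc (n + n)) (u k)"
    using u by (auto simp: null_seq_def eventually_sequentially)
  have "norm_bound r (\<Sum>k<K. B k) (\<Sum>k<K. u k)" for K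
  proof (induction K)
    case 0
    show ?case by (simp add: norm_bound_def)
  next
    case (Suc K)
    from norm_bound_add[OF Suc B(1) r] show ?case by simp
  qed
  then have "square_sum r (\<Sum>k<M. u k) n \<le> (\<Sum>k<M. B k)"
    by (auto simp: norm_bound_def)
  also have "\<dots> \<le> suminf B"
    using norm_bound_nonneg[OF B(1) r] by (intro sum_le_suminf B) auto
  also have "square_sum r (\<Sum>k<M. u k) n
      = square_sum r (sum_series u) n"
  proof (intro sum.cong refl)
    fix i j assume "i \<in> {..n}" "j \<in> {..n}"
    then have "sum_series u $ i $ j = (\<Sum>k<M. u k $ i $ j)"
      using M by (intro sum_series_nth) (auto simp: order_ge_def)
    then show "norm ((\<Sum>k<M. u k) $ i $ j) * r ^ (i + j) = norm (sum_series u $ i $ j) * r ^ (i + j)"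
      by (simp add: nth2_sum)
  qed
  finally show "square_sum r (sum_series u) n \<le> suminf B" .
qed

lemma convergent_add:
  assumes "g \<in> convergent_series" "h \<in> convergent_series"
  shows "g + h \<in> convergent_series"
proof -
  obtain r B r' B' where *: "r > 0" "norm_bound r B g" "r' > 0" "norm_bound r' B' h"
    using assms by (meson convergent_imp_norm_bound)
  have "norm_bound (min r r') (B + B') (g + h)"
    by (intro norm_bound_add norm_bound_mono[OF *(2)] norm_bound_mono[OF *(4)]) (use * in auto)
  then show ?thesis by (rule norm_bound_imp_convergent) (use * in auto)
qed

lemma convergent_mult:
  assumes "g \<in> convergent_series" "h \<in> convergent_series"
  shows "g * h \<in> convergent_series"
proof -
  obtain r B r' B' where *: "r > 0" "norm_bound r B g" "r' > 0" "norm_bound r' B' h"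
    using assms by (meson convergent_imp_norm_bound)
  have "norm_bound (min r r') (B * B') (g * h)"
    by (intro norm_bound_mult norm_bound_mono[OF *(2)] norm_bound_mono[OF *(4)]) (use * in auto)
  then show ?thesis by (rule norm_bound_imp_convergent) (use * in auto)
qed

lemma convergent_scal: "scal c \<in> convergent_series"
  by (rule norm_bound_imp_convergent[OF norm_bound_scal, of 1]) simp

lemma convergent_diff: "g \<in> convergent_series \<Longrightarrow> h \<in> convergent_series \<Longrightarrow> g - h \<in> convergent_series"
  using convergent_add[OF _ convergent_mult[OF convergent_scal[of "-1"]], of g h]
  by (simp add: fps_const_neg[symmetric] del: fps_const_neg)

lemma convergent_power: "g \<in> convergent_series \<Longrightarrow> g ^ n \<in> convergent_series"
  by (induction n) (use convergent_scal[of 1] in \<open>auto intro: convergent_mult\<close>)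

lemma sum_Suc_left_le:
  fixes a :: "nat \<Rightarrow> nat \<Rightarrow> real"
  assumes "\<And>i j. a i j \<ge> 0"
  shows "(\<Sum>i\<le>n. \<Sum>j\<le>n. a (Suc i) j) \<le> (\<Sum>i\<le>Suc n. \<Sum>j\<le>Suc n. a i j)"
proof -
  have "(\<Sum>i\<le>n. \<Sum>j\<le>n. a (Suc i) j) \<le> (\<Sum>i\<le>n. \<Sum>j\<le>Suc n. a (Suc i) j)"
    using assms by (intro sum_mono sum_mono2) auto
  also have "\<dots> \<le> (\<Sum>i\<le>Suc n. \<Sum>j\<le>Suc n. a i j)"
    unfolding sum.atMost_Suc_shift[of "\<lambda>i. \<Sum>j\<le>Suc n. a i j"] using assms by (simp add: sum_nonneg)
  finally show ?thesis .
qed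

lemma convergent_deriv:
  assumes "g \<in> convergent_series" shows "fps_deriv g \<in> convergent_series"
proof -
  obtain r B where r: "r > 0" and B: "norm_bound r B g" using assms by (rule convergent_imp_norm_bound)
  \<comment> \<open>Halving the radius pays for the factor i + 1 \<le> 2^i of the derivative;
    dividing by r makes up for the shifted exponent.\<close>
  have "norm_bound (r / 2) (B / r) (fps_deriv g)"
    unfolding norm_bound_def
  proof
    fix n
    define G where "G i j = norm (g $ i $ j) * r ^ (i + j)" for i j
    have "square_sum (r / 2) (fps_deriv g) n
        \<le> (\<Sum>i\<le>n. \<Sum>j\<le>n. G (Suc i) j / r)"
    proof (intro sum_mono)
      fix i j
      have "real (Suc i) \<le> 2 ^ i" by (induction i) auto
      also have "\<dots> \<le> 2 ^ (i + j)" by (intro power_increasing) auto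
      finally have *: "real (Suc i) / 2 ^ (i + j) \<le> 1" by simp
      have "(of_nat (i + 1) :: complex fps) = fps_const (of_nat (Suc i))" by (simp only: fps_of_nat Suc_eq_plus1)
      then have "norm (fps_deriv g $ i $ j) = real (Suc i) * norm (g $ Suc i $ j)"
        by (simp add: norm_mult del: of_nat_Suc of_nat_add)
      then have "norm (fps_deriv g $ i $ j) * (r / 2) ^ (i + j)
          = (real (Suc i) / 2 ^ (i + j)) * (norm (g $ Suc i $ j) * r ^ (i + j))"
        by (simp add: power_divide)
      also have "\<dots> \<le> 1 * (norm (g $ Suc i $ j) * r ^ (i + j))"
        using * r by (intro mult_right_mono) auto
      also have "\<dots> = G (Suc i) j / r" using r by (simp add: G_def)
      finally show "norm (fps_deriv g $ i $ j) * (r / 2) ^ (i + j) \<le> G (Suc i) j / r" .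
    qed
    also have "\<dots> = (\<Sum>i\<le>n. \<Sum>j\<le>n. G (Suc i) j) / r" by (simp add: sum_divide_distrib)
    also have "\<dots> \<le> (\<Sum>i\<le>Suc n. \<Sum>j\<le>Suc n. G i j) / r"
      using r by (intro divide_right_mono sum_Suc_left_le) (auto simp: G_def)
    also have "\<dots> \<le> B / r"
      using B r unfolding norm_bound_def G_def by (intro divide_right_mono) (blast, simp)
    finally show "square_sum (r / 2) (fps_deriv g) n \<le> B / r" .
  qed
  then show ?thesis by (rule norm_bound_imp_convergent) (use r in auto)
qed

lemma norm_bound_shrink:
  assumes B: "norm_bound r B z" and z: "z $ 0 $ 0 = 0" and r: "r \<ge> 0" and t: "0 \<le> t" "t \<le> 1"
  shows "norm_bound (t * r) (t * B) z"
  unfolding norm_bound_def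
proof
  fix n
  have "square_sum (t * r) z n
      \<le> (\<Sum>i\<le>n. \<Sum>j\<le>n. t * (norm (z $ i $ j) * r ^ (i + j)))"
  proof (intro sum_mono)
    fix i j
    show "norm (z $ i $ j) * (t * r) ^ (i + j) \<le> t * (norm (z $ i $ j) * r ^ (i + j))"
    proof (cases "i + j")
      case (Suc k)
      have "t ^ (i + j) \<le> t" using t Suc by (simp add: mult_left_le power_le_one)
      then have "t ^ (i + j) * (norm (z $ i $ j) * r ^ (i + j)) \<le> t * (norm (z $ i $ j) * r ^ (i + j))"
        using r by (intro mult_right_mono) auto
      then show ?thesis by (simp add: power_mult_distrib mult_ac)
    qed (use z in auto)
  qed
  also have "\<dots> = t * square_sum r z n"
    by (simp add: sum_distrib_left)
  also have "\<dots> \<le> t * B" using B t by (auto simp: norm_bound_def intro: mult_left_mono)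
  finally show "square_sum (t * r) z n \<le> t * B" .
qed

text \<open>Geometric series in z = 1 - g. Since z has no constant term, shrinking the radius by t
  shrinks the norm bound by t, and t is chosen to bring it down to 1/2.\<close>

lemma convergent_unit_inverse:
  assumes g: "g \<in> convergent_series" and g0: "g $ 0 $ 0 = 1"
  obtains v where "v \<in> convergent_series" "g * v = 1"
proof -
  define z where "z = 1 - g"
  have z0: "z $ 0 $ 0 = 0" by (simp add: z_def g0)
  have "z \<in> convergent_series"
    unfolding z_def using convergent_scal[of 1] g by (intro convergent_diff) auto
  then obtain r B where r: "r > 0" and B: "norm_bound r B z" by (rule convergent_imp_norm_bound)
  have B0: "B \<ge> 0" using norm_bound_nonneg[OF B] r by simp
  define t where "t = 1 / (2 * (B + 1))"
  have t: "0 < t" "t \<le> 1" "t * B \<le> 1 / 2" using B0 by (auto simp: t_def field_simps)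
  have half: "norm_bound (t * r) (1 / 2) z"
    by (rule norm_bound_mono[OF norm_bound_shrink[where t = t, OF B z0]]) (use t r in auto)
  have van: "null_seq (\<lambda>n. z ^ n)"
    by (rule null_seqI) (use order_ge_power[of 1 z] z0 in \<open>auto simp: order_ge_1_iff\<close>)
  have "norm_bound (t * r) (\<Sum>n. (1 / 2) ^ n) (sum_series (\<lambda>n. z ^ n))"
    by (intro norm_bound_sum_series norm_bound_power half van) (use t r in \<open>auto intro: summable_geometric\<close>)
  then have conv: "sum_series (\<lambda>n. z ^ n) \<in> convergent_series"
    by (rule norm_bound_imp_convergent) (use t r in auto)
  have "sum_series (\<lambda>n. z ^ n) = 1 + z * sum_series (\<lambda>n. z ^ n)"
    unfolding sum_series_mult[OF van] using sum_series_Suc[OF van] by simp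
  then have "g * sum_series (\<lambda>n. z ^ n) = 1" by (simp add: z_def algebra_simps)
  with conv that show ?thesis by blast
qed

section \<open>Homogeneous series\<close>

definition homogeneous :: "nat \<Rightarrow> series2 \<Rightarrow> bool" where
  "homogeneous n g \<longleftrightarrow> (\<forall>i j. i + j \<noteq> n \<longrightarrow> g $ i $ j = 0)"

lemma homogeneous_imp_order_ge: "homogeneous n g \<Longrightarrow> order_ge n g"
  by (auto simp: homogeneous_def order_ge_def)

lemma homogeneous_mult:
  assumes "homogeneous m g" "homogeneous n h"
  shows "homogeneous (m + n) (g * h)"
  unfolding homogeneous_def
proof (intro allI impI)
  fix i j assume ij: "i + j \<noteq> m + n"
  have "g $ k $ l * h $ (i - k) $ (j - l) = 0" if "k \<le> i" "l \<le> j" for k l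
  proof -
    have "k + l \<noteq> m \<or> (i - k) + (j - l) \<noteq> n" using ij that by linarith
    then show ?thesis using assms by (auto simp: homogeneous_def)
  qed
  then show "(g * h) $ i $ j = 0" unfolding mult_nth2 by (intro sum.neutral ballI) auto
qed

lemma homogeneous_power: "homogeneous m g \<Longrightarrow> homogeneous (n * m) (g ^ n)"
proof (induction n)
  case 0
  show ?case by (auto simp: homogeneous_def)
qed (auto intro: homogeneous_mult)

lemma homogeneous_var_x: "homogeneous 1 var_x"
  by (auto simp: homogeneous_def)

lemma homogeneous_line: "homogeneous 1 (line c)"
  by (auto simp: homogeneous_def line_def)

lemma homogeneous_deriv: "homogeneous (Suc n) g \<Longrightarrow> homogeneous n (fps_deriv g)"
  by (auto simp: homogeneous_def numeral_fps_const fps_of_nat[symmetric] simp del: of_nat_Suc)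

lemma homogeneous_norm_bound:
  assumes "homogeneous n g" "norm_bound 1 B g" "r \<ge> 0"
  shows "norm_bound r (r ^ n * B) g"
  unfolding norm_bound_def
proof
  fix m
  have "square_sum r g m = (\<Sum>i\<le>m. \<Sum>j\<le>m. r ^ n * (norm (g $ i $ j) * 1 ^ (i + j)))"
  proof (intro sum.cong refl)
    fix i j
    show "norm (g $ i $ j) * r ^ (i + j) = r ^ n * (norm (g $ i $ j) * 1 ^ (i + j))"
      using assms(1) by (cases "i + j = n") (auto simp: homogeneous_def)
  qed
  also have "\<dots> = r ^ n * square_sum 1 g m"
    by (simp add: sum_distrib_left)
  also have "\<dots> \<le> r ^ n * B"
    using assms(2,3) unfolding norm_bound_def by (intro mult_left_mono) (blast, simp)
  finally show "square_sum r g m \<le> r ^ n * B" .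
qed

text \<open>Homogeneity bounds the exponent of x, so a derivative costs a factor but no radius. This
  allows arbitrarily many derivatives in the flow.\<close>

lemma homogeneous_norm_bound_deriv:
  assumes "homogeneous (Suc n) g" "norm_bound 1 B g"
  shows "norm_bound 1 (real (Suc n) * B) (fps_deriv g)"
  unfolding norm_bound_def
proof
  fix m
  have "square_sum 1 (fps_deriv g) m
      \<le> (\<Sum>i\<le>m. \<Sum>j\<le>m. real (Suc n) * norm (g $ Suc i $ j))"
  proof (intro sum_mono)
    fix i j
    have "(of_nat (i + 1) :: complex fps) = fps_const (of_nat (Suc i))" by (simp only: fps_of_nat Suc_eq_plus1)
    then have *: "norm (fps_deriv g $ i $ j) = real (Suc i) * norm (g $ Suc i $ j)"
      by (simp add: norm_mult del: of_nat_Suc of_nat_add)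
    show "norm (fps_deriv g $ i $ j) * 1 ^ (i + j) \<le> real (Suc n) * norm (g $ Suc i $ j)"
    proof (cases "Suc i + j = Suc n")
      case True
      then show ?thesis unfolding * by (auto intro!: mult_right_mono)
    next
      case False
      then have "g $ Suc i $ j = 0" using assms(1) by (auto simp: homogeneous_def)
      then show ?thesis unfolding * by simp
    qed
  qed
  also have "\<dots> = real (Suc n) * (\<Sum>i\<le>m. \<Sum>j\<le>m. norm (g $ Suc i $ j))"
    by (simp add: sum_distrib_left)
  also have "(\<Sum>i\<le>m. \<Sum>j\<le>m. norm (g $ Suc i $ j)) \<le> (\<Sum>i\<le>Suc m. \<Sum>j\<le>Suc m. norm (g $ i $ j))"
    by (intro sum_Suc_left_le) auto
  also have "\<dots> = square_sum 1 g (Suc m)" by simp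
  also have "\<dots> \<le> B" using assms(2) unfolding norm_bound_def by blast
  finally show "square_sum 1 (fps_deriv g) m \<le> real (Suc n) * B"
    by (simp add: mult_left_mono)
qed

lemma homogeneous_imp_norm_bound:
  assumes "homogeneous n g"
  shows "\<exists>B. norm_bound 1 B g"
proof -
  have "square_sum 1 g m \<le> (\<Sum>i\<le>n. \<Sum>j\<le>n. norm (g $ i $ j))" for m
  proof -
    have "square_sum 1 g m \<le> (\<Sum>i\<le>max m n. \<Sum>j\<le>max m n. norm (g $ i $ j))"
      unfolding sum.cartesian_product power_one mult_1_right by (rule sum_mono2) auto
    also have "\<dots> = (\<Sum>i\<le>n. \<Sum>j\<le>n. norm (g $ i $ j))"
      unfolding sum.cartesian_product
    proof (intro sum.mono_neutral_right ballI)
      fix p assume "p \<in> {..max m n} \<times> {..max m n} - {..n} \<times> {..n}"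
      then have "fst p + snd p \<noteq> n" by auto
      then show "(case p of (i, j) \<Rightarrow> norm (g $ i $ j)) = 0"
        using assms by (auto simp: homogeneous_def split: prod.split)
    qed auto
    finally show ?thesis .
  qed
  then show ?thesis unfolding norm_bound_def by blast
qed

lemma convergent_homogeneous: "homogeneous n g \<Longrightarrow> g \<in> convergent_series"
  using homogeneous_imp_norm_bound norm_bound_imp_convergent[of 1] by fastforce

subsection \<open>Convergence along a line\<close>

lemma fps_conv_radius_pos_if_bounded:
  assumes "\<And>n. norm (h $ n) * r ^ n \<le> B" "r > 0"
  shows "fps_conv_radius (h :: complex fps) > 0"
proof -
  have "summable (\<lambda>n. h $ n * complex_of_real (r / 2) ^ n)"
  proof (rule summable_comparison_test')
    show "summable (\<lambda>n. B * (1 / 2) ^ n)" by (intro summable_mult summable_geometric) simp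
    fix n :: nat
    have "norm (h $ n * complex_of_real (r / 2) ^ n) = norm (h $ n) * r ^ n * (1 / 2) ^ n"
      using assms(2) by (simp add: norm_mult norm_power norm_divide power_divide)
    also have "\<dots> \<le> B * (1 / 2) ^ n" using assms(1) by (intro mult_right_mono) auto
    finally show "norm (h $ n * complex_of_real (r / 2) ^ n) \<le> B * (1 / 2) ^ n" .
  qed
  from conv_radius_geI[OF this] have "fps_conv_radius h \<ge> ereal (r / 2)"
    using assms(2) by (simp add: fps_conv_radius_def)
  moreover have "0 < ereal (r / 2)" using assms(2) by simp
  ultimately show ?thesis by order
qed

lemma fps_conv_radius_pos_imp_bounded:
  assumes "fps_conv_radius (h :: complex fps) > 0"
  obtains C :: nat where "\<And>n. norm (h $ n) \<le> real C ^ Suc n"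
proof -
  obtain r where r: "0 < ereal r" "ereal r < fps_conv_radius h"
    using assms ereal_dense2 by blast
  then have "summable (\<lambda>n. norm (h $ n * complex_of_real r ^ n))"
    by (intro norm_summable_fps) auto
  then have "(\<lambda>n. norm (h $ n * complex_of_real r ^ n)) \<longlonglongrightarrow> 0" by (rule summable_LIMSEQ_zero)
  then have "Bseq (\<lambda>n. norm (h $ n * complex_of_real r ^ n))" by (rule convergentI[THEN convergent_imp_Bseq])
  then obtain K where K: "\<And>n. norm (h $ n) * r ^ n \<le> K"
    using r by (auto simp: Bseq_def norm_mult norm_power)
  obtain C :: nat where C: "real C \<ge> max K (1 / r)" using real_arch_simple by blast
  have "norm (h $ n) \<le> real C ^ Suc n" for n
  proof -
    have "norm (h $ n) = norm (h $ n) * r ^ n * (1 / r) ^ n" using r by (simp add: field_simps)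
    also have "\<dots> \<le> real C * real C ^ n"
      using C r by (intro mult_mono power_mono order_trans[OF K]) auto
    finally show ?thesis by simp
  qed
  with that show ?thesis by blast
qed

lemma convergent_restr:
  assumes "g \<in> convergent_series" "norm c \<le> 1"
  shows "fps_conv_radius (restr c 1 g) > 0"
proof -
  obtain r B where r: "r > 0" and B: "norm_bound r B g" using assms(1) by (rule convergent_imp_norm_bound)
  have "norm (restr c 1 g $ n) * r ^ n \<le> B" for n
  proof -
    have "norm (restr c 1 g $ n) \<le> (\<Sum>i\<le>n. norm (g $ i $ (n - i)))"
      unfolding restr_def fps_nth_Abs_fps
    proof (rule sum_norm_le)
      fix i
      show "norm (g $ i $ (n - i) * (c ^ i * 1 ^ (n - i))) \<le> norm (g $ i $ (n - i))"
        using assms(2) by (simp add: norm_mult norm_power mult_left_le power_le_one)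
    qed
    then have "norm (restr c 1 g $ n) * r ^ n \<le> (\<Sum>i\<le>n. norm (g $ i $ (n - i))) * r ^ n"
      using r by (intro mult_right_mono) auto
    also have "\<dots> = (\<Sum>i\<le>n. norm (g $ i $ (n - i)) * r ^ (i + (n - i)))"
      unfolding sum_distrib_right by (intro sum.cong) auto
    also have "\<dots> \<le> square_sum r g n"
    proof (rule sum_mono)
      fix i assume "i \<in> {..n}"
      show "norm (g $ i $ (n - i)) * r ^ (i + (n - i)) \<le> (\<Sum>j\<le>n. norm (g $ i $ j) * r ^ (i + j))"
        by (rule member_le_sum[of "n - i" _ "\<lambda>j. norm (g $ i $ j) * r ^ (i + j)"]) (use r in auto)
    qed
    also have "\<dots> \<le> B" using B by (auto simp: norm_bound_def)
    finally show ?thesis .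
  qed
  then show ?thesis by (rule fps_conv_radius_pos_if_bounded) (rule r)
qed

section \<open>Convergence of the flow of a homogeneous field\<close>

locale homogeneous_field = planar_field +
  fixes d :: nat
  assumes hom_f: "homogeneous d f" and d_ge_2: "2 \<le> d"
begin

lemma homogeneous_X: "homogeneous (Suc n) h \<Longrightarrow> homogeneous (d + n) (X h)"
  unfolding X_def by (intro homogeneous_mult hom_f homogeneous_deriv)

lemma homogeneous_Xpow: "homogeneous (Suc (m * (d - 1))) ((X ^^ m) var_x)"
proof (induction m)
  case 0
  show ?case using homogeneous_var_x by simp
next
  case (Suc m)
  have "d + m * (d - 1) = Suc (Suc m * (d - 1))" using d_ge_2 by simp
  then show ?case using homogeneous_X[OF Suc] by simp
qed

lemma Suc_mult_le: "Suc (m * (d - 1)) \<le> d * Suc m"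
proof -
  have "m * (d - 1) \<le> d * m" by simp
  then show ?thesis using d_ge_2 unfolding mult_Suc_right by linarith
qed

text \<open>The degrees of the iterates grow linearly in m, so the derivatives contribute m! up to
  an exponential factor; the factorials in the flow compensate for it.\<close>

lemma norm_bound_Xpow:
  assumes F: "norm_bound 1 F f"
  shows "norm_bound 1 ((F * real d) ^ m * fact m) ((X ^^ m) var_x)"
proof (induction m)
  case 0
  have "square_sum 1 var_x n \<le> 1" for n
  proof -
    have "square_sum 1 var_x n
        = (\<Sum>i\<le>n. \<Sum>j\<le>n. if j = 0 then (if i = 1 then 1 else 0) else 0)"
      by (intro sum.cong refl) auto
    then show ?thesis by simp
  qed
  then show ?case by (simp add: norm_bound_def)
next
  case (Suc m)
  have F0: "F \<ge> 0" using norm_bound_nonneg[OF F] by simp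
  have "norm_bound 1 (F * (real (Suc (m * (d - 1))) * ((F * real d) ^ m * fact m))) ((X ^^ Suc m) var_x)"
    unfolding funpow.simps o_apply X_def[of "(X ^^ m) var_x"]
    by (intro norm_bound_mult F homogeneous_norm_bound_deriv homogeneous_Xpow Suc) simp
  moreover have "F * (real (Suc (m * (d - 1))) * ((F * real d) ^ m * fact m)) \<le> (F * real d) ^ Suc m * fact (Suc m)"
  proof -
    have "real (Suc (m * (d - 1))) \<le> real (d * Suc m)" using Suc_mult_le by (intro of_nat_mono)
    then have "F * (real (Suc (m * (d - 1))) * ((F * real d) ^ m * fact m)) \<le> F * (real (d * Suc m) * ((F * real d) ^ m * fact m))"
      using F0 by (intro mult_left_mono mult_right_mono) auto
    then show ?thesis by (simp add: algebra_simps)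
  qed
  ultimately show ?case by (rule norm_bound_mono) auto
qed

lemma convergent_flow_quot:
  assumes "w \<in> convergent_series"
  shows "flow_quot w var_x \<in> convergent_series"
proof -
  obtain r0 C where r0: "r0 > 0" and C: "norm_bound r0 C w" using assms by (rule convergent_imp_norm_bound)
  obtain F where F: "norm_bound 1 F f" using homogeneous_imp_norm_bound[OF hom_f] by blast
  have F0: "F \<ge> 0" "C \<ge> 0" using norm_bound_nonneg[OF F] norm_bound_nonneg[OF C] r0 by auto
  define K where "K = C * (F * real d)"
  have K0: "K \<ge> 0" using F0 by (simp add: K_def)
  \<comment> \<open>At radius r the m-th term is at most a constant times (K r)^m: homogeneity
    supplies r^(m (d - 1)) \<le> r^m, as r \<le> 1 and d \<ge> 2.\<close>
  define r where "r = min (min 1 r0) (1 / (2 * (K + 1)))"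
  have r: "0 < r" "r \<le> 1" "r \<le> r0" "r \<le> 1 / (2 * (K + 1))" using r0 K0 by (auto simp: r_def)
  have Kr: "K * r \<le> 1 / 2"
  proof -
    have "K * r \<le> (K + 1) * (1 / (2 * (K + 1)))" using r K0 by (intro mult_mono) auto
    also have "\<dots> = 1 / 2" using K0 by (auto simp: divide_simps)
    finally show ?thesis .
  qed
  have w: "norm_bound r C w" by (rule norm_bound_mono[OF C]) (use r in auto)
  let ?u = "\<lambda>m. scal (1 / fact (Suc m)) * (w ^ Suc m * fps_deriv ((X ^^ m) var_x))"
  let ?B = "\<lambda>m. norm (1 / fact (Suc m) :: complex) *
    (C ^ Suc m * (r ^ (m * (d - 1)) * (real (Suc (m * (d - 1))) * ((F * real d) ^ m * fact m))))"
  have "norm_bound r (C * real d * (1 / 2) ^ m) (?u m)" for m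
  proof (rule norm_bound_mono)
    show "norm_bound r (?B m) (?u m)"
      using r by (intro norm_bound_scal_mult norm_bound_mult norm_bound_power w homogeneous_norm_bound
          homogeneous_deriv homogeneous_norm_bound_deriv homogeneous_Xpow norm_bound_Xpow F) auto
    have "?B m
        \<le> norm (1 / fact (Suc m) :: complex) * (C ^ Suc m * (r ^ m * (real (d * Suc m) * ((F * real d) ^ m * fact m))))"
    proof (intro mult_left_mono mult_mono mult_right_mono)
      show "r ^ (m * (d - 1)) \<le> r ^ m" using r d_ge_2 by (intro power_decreasing) auto
      show "real (Suc (m * (d - 1))) \<le> real (d * Suc m)" using Suc_mult_le by (intro of_nat_mono)
    qed (use F0 r in auto)
    also have "\<dots> = C * real d * (K * r) ^ m"
    proof -
      have nf: "norm (1 / fact (Suc m) :: complex) = 1 / (real (Suc m) * fact m)"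
        by (simp only: norm_divide norm_one fact_Suc norm_mult norm_of_nat norm_fact)
      have "1 / (S * Q) * (C * u * (v * (real d * S * (z * Q)))) = C * real d * (u * z * v)"
        if "S \<noteq> 0" "Q \<noteq> 0" for S Q u v z :: real
        using that by (simp add: field_simps)
      from this[of "real (Suc m)" "fact m" "C ^ m" "r ^ m" "(F * real d) ^ m"] show ?thesis
        unfolding nf K_def power_Suc of_nat_mult power_mult_distrib
        by (simp only: of_nat_neq_0 fact_nonzero not_False_eq_True True_implies_equals simp_thms)
    qed
    also have "\<dots> \<le> C * real d * (1 / 2) ^ m"
      using Kr K0 r F0 by (intro mult_left_mono power_mono) auto
    finally show "?B m
        \<le> C * real d * (1 / 2) ^ m" .
  qed (use r in auto)
  then have "norm_bound r (\<Sum>m. C * real d * (1 / 2) ^ m) (sum_series ?u)"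
    using r by (intro norm_bound_sum_series null_seq_mult vanishing_deriv_Xpow summable_mult summable_geometric) auto
  then show ?thesis unfolding flow_quot_def by (rule norm_bound_imp_convergent) (rule r)
qed

lemma flow_quot_nth_0_0:
  assumes "w $ 0 $ 0 = 1"
  shows "flow_quot w var_x $ 0 $ 0 = 1"
proof -
  have "flow_quot 0 var_x = 0"
    unfolding flow_quot_def by (simp add: sum_series_zero)
  then have "order_ge (Suc 0) (flow_quot w var_x - w)"
    using flow_quot_var_x_diff[of 0 w 0] by simp
  then show ?thesis using assms by (simp add: order_ge_1_iff)
qed

lemma flow_in_D_set:
  assumes f: "f \<in> convergent_series"
  shows "(flow (1 + scal s * f) var_x, var_x1) \<in> D_set f"
proof -
  define w where "w = 1 + scal s * f"
  define u where "u = flow_quot w var_x"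
  have f00: "f $ 0 $ j = 0" "f $ 1 $ 0 = 0" for j
    using order_f by (auto simp: f_nth_0 order_ge_def)
  have w: "w \<in> convergent_series" "w $ 0 $ 0 = 1"
    unfolding w_def using f convergent_scal[of 1] f00
    by (auto intro!: convergent_add convergent_mult convergent_scal)
  have u: "u \<in> convergent_series" "u $ 0 $ 0 = 1"
    unfolding u_def by (rule convergent_flow_quot[OF w(1)], rule flow_quot_nth_0_0[OF w(2)])
  obtain v where v: "v \<in> convergent_series" "u * v = 1" using convergent_unit_inverse[OF u] by blast
  have eq: "flow w var_x = var_x + f * u" by (simp add: flow_eq u_def)
  have x: "var_x \<in> convergent_series" by (rule convergent_homogeneous[OF homogeneous_var_x])
  have x1: "var_x1 \<in> convergent_series" by (rule convergent_homogeneous[of 1]) (auto simp: homogeneous_def)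
  have conv: "flow w var_x \<in> convergent_series"
    unfolding eq by (intro convergent_add convergent_mult x f u)
  have coeffs: "flow w var_x $ 0 $ 0 = 0" "flow w var_x $ 1 $ 0 = 1"
    unfolding eq using f00 by (auto simp: mult_nth2)
  then have "(flow w var_x, var_x1) \<in> formal_diffeos" by (simp add: formal_diffeos_def)
  moreover have "fps_deriv (flow w var_x) $ 0 $ 0 = 1" using coeffs by simp
  ultimately have "(flow w var_x, var_x1) \<in> diff_up" using conv x1 by (simp add: diff_up_def)
  moreover have "flow w var_x - var_x = u * f" by (simp add: eq mult.commute)
  ultimately show ?thesis unfolding w_def[symmetric] D_set_def using u v by auto
qed

end

subsection \<open>The time of a flow on a line of singularities\<close>

context planar_field
begin

text \<open>On a line of zeros of f the x-derivative of X^m x is \<open>\<mu> ^ m\<close>. The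
  quotient is therefore (e^(\<mu> \<alpha>) - 1) / \<mu> there, read as \<alpha> if \<mu> = 0; the
  left side of the second formula is the x-derivative of the flow on the line.\<close>

lemma restrict_flow_quot:
  assumes f: "restr c 1 f = 0"
  defines "\<mu> \<equiv> restr c 1 (fps_deriv f)"
  shows "\<mu> = 0 \<Longrightarrow> restr c 1 (flow_quot \<alpha> var_x) = restr c 1 \<alpha>"
    and "1 + \<mu> * restr c 1 (flow_quot \<alpha> var_x) = fps_exp 1 oo (\<mu> * restr c 1 \<alpha>)"
proof -
  define A where "A = restr c 1 \<alpha>"
  define W where "W = restr c 1 (flow_quot \<alpha> var_x)"
  define t where "t m = fps_const (1 / fact (Suc m)) * (A ^ Suc m * \<mu> ^ m)" for m
  have r: "restr c 1 (fps_deriv ((X ^^ m) var_x)) = \<mu> ^ m" for m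
  proof (induction m)
    case (Suc m)
    then show ?case
      by (simp add: X_def restr_add restr_mult f \<mu>_def)
  qed simp
  have W: "W $ n = (\<Sum>m<Suc K. t m $ n)" if "n \<le> K" for n K
  proof -
    have "order_ge m (fps_deriv ((X ^^ m) var_x))" for m
      using order_Xpow[of 1 var_x m] by (intro order_ge_deriv) simp
    then have "W $ n = (\<Sum>m<Suc K. restr c 1 (scal (1 / fact (Suc m)) * (\<alpha> ^ Suc m * fps_deriv ((X ^^ m) var_x))) $ n)"
      unfolding W_def flow_quot_def using that
      by (intro restr_sum_series order_ge_mult_right) (rule order_ge_mono, auto)
    then show ?thesis
      by (simp only: restr_mult restr_power r restr_scal t_def A_def)
  qed
  show "restr c 1 (flow_quot \<alpha> var_x) = restr c 1 \<alpha>" if "\<mu> = 0"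
  proof (intro fps_ext)
    fix n
    have "W $ n = (\<Sum>m<Suc n. t m $ n)" by (rule W) simp
    also have "\<dots> = (\<Sum>m<Suc n. if m = 0 then A $ n else 0)"
      using that by (intro sum.cong refl) (auto simp: t_def power_0_left)
    also have "\<dots> = A $ n" by (simp only: sum.delta finite_lessThan) simp
    finally show "restr c 1 (flow_quot \<alpha> var_x) $ n = restr c 1 \<alpha> $ n"
      by (simp add: W_def A_def)
  qed
  show "1 + \<mu> * restr c 1 (flow_quot \<alpha> var_x) = fps_exp 1 oo (\<mu> * restr c 1 \<alpha>)"
    unfolding W_def[symmetric] A_def[symmetric]
  proof (intro fps_ext)
    fix n
    define y where "y = \<mu> * A"
    have "order_ge 1 (fps_deriv f)" using order_f by (intro order_ge_deriv) (simp add: numeral_2_eq_2)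
    then have "\<mu> $ 0 = 0" unfolding \<mu>_def by (intro order_restr) auto
    then have y0: "y $ 0 = 0" by (simp add: y_def)
    have "(\<mu> * W) $ n = (\<Sum>i=0..n. \<mu> $ i * W $ (n - i))" by (simp add: fps_mult_nth)
    also have "\<dots> = (\<Sum>i=0..n. \<mu> $ i * (\<Sum>m<Suc n. t m) $ (n - i))"
      by (intro sum.cong refl) (simp add: W[of _ n] fps_sum_nth del: sum.lessThan_Suc)
    also have "\<dots> = (\<mu> * (\<Sum>m<Suc n. t m)) $ n" by (simp add: fps_mult_nth del: sum.lessThan_Suc)
    also have "\<dots> = (\<Sum>m<Suc n. (fps_const (1 / fact (Suc m)) * y ^ Suc m) $ n)"
      unfolding sum_distrib_left fps_sum_nth
      by (intro sum.cong refl) (simp add: t_def y_def power_mult_distrib mult_ac del: fact_Suc)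
    also have "\<dots> = (\<Sum>m\<le>n. 1 / fact (Suc m) * y ^ Suc m $ n)" by (simp only: lessThan_Suc_atMost fps_mult_left_const_nth)
    also have "1 $ n + \<dots> = (\<Sum>m\<le>Suc n. 1 / fact m * y ^ m $ n)"
      by (simp only: sum.atMost_Suc_shift) simp
    also have "\<dots> = (\<Sum>m\<le>n. 1 / fact m * y ^ m $ n)"
      using startsby_zero_power_prefix[OF y0, of "Suc n"] by (simp del: power_Suc)
    also have "\<dots> = (fps_exp 1 oo y) $ n"
      by (simp add: fps_compose_nth atLeast0AtMost)
    finally show "(1 + \<mu> * W) $ n = (fps_exp 1 oo (\<mu> * A)) $ n" by (simp add: y_def)
  qed
qed

end

lemma fps_conv_radius_mult_pos:
  "fps_conv_radius g > 0 \<Longrightarrow> fps_conv_radius h > 0 \<Longrightarrow> fps_conv_radius (g * h :: complex fps) > 0"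
  by (rule less_le_trans[OF _ fps_conv_radius_mult]) simp

lemma fps_conv_radius_add_pos:
  "fps_conv_radius g > 0 \<Longrightarrow> fps_conv_radius h > 0 \<Longrightarrow> fps_conv_radius (g + h :: complex fps) > 0"
  by (rule less_le_trans[OF _ fps_conv_radius_add]) simp

lemma fps_conv_radius_monom_mult_posD:
  assumes "fps_conv_radius (fps_const l * fps_X ^ e * (h :: complex fps)) > 0" "l \<noteq> 0"
  shows "fps_conv_radius h > 0"
proof -
  have "fps_const (inverse l) * fps_shift e (fps_const l * fps_X ^ e * h) = h"
    using assms(2) by (intro fps_ext) (simp add: mult.assoc fps_X_power_mult_nth)
  moreover have "fps_conv_radius (fps_const (inverse l) * fps_shift e (fps_const l * fps_X ^ e * h)) > 0"
    using assms(1) by (intro fps_conv_radius_mult_pos) auto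
  ultimately show ?thesis by simp
qed

text \<open>By the logarithmic derivative: with E = e^y, the series y' = E' / E converges, and
  integration only divides coefficients by integers.\<close>

lemma fps_conv_radius_log_pos:
  fixes y :: "complex fps"
  assumes y0: "y $ 0 = 0" and V: "fps_conv_radius (fps_exp 1 oo y) > 0"
  shows "fps_conv_radius y > 0"
proof -
  define E where "E = (fps_exp 1 :: complex fps) oo y"
  have E0: "E $ 0 = 1" by (simp add: E_def)
  have "fps_deriv E = E * fps_deriv y" unfolding E_def by (subst fps_compose_deriv[OF y0]) simp
  then have "inverse E * fps_deriv E = (inverse E * E) * fps_deriv y" by (simp add: mult.assoc)
  also have "inverse E * E = 1" using E0 by (intro inverse_mult_eq_1) simp
  finally have dy: "fps_deriv y = inverse E * fps_deriv E" by simp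
  have "fps_conv_radius (inverse E) > 0"
    using V E0 by (intro fps_conv_radius_inverse_pos) (auto simp: E_def)
  moreover have "fps_conv_radius (fps_deriv E) > 0"
    using V unfolding E_def[symmetric] by (rule less_le_trans[OF _ fps_conv_radius_deriv])
  ultimately have "fps_conv_radius (fps_deriv y) > 0"
    unfolding dy by (rule fps_conv_radius_mult_pos)
  then obtain C :: nat where C: "\<And>n. norm (fps_deriv y $ n) \<le> real C ^ Suc n"
    by (rule fps_conv_radius_pos_imp_bounded) blast
  have "norm (y $ n) * (1 / real (Suc C)) ^ n \<le> 1" for n
  proof (cases n)
    case (Suc m)
    have "norm (y $ n) \<le> real (Suc m) * norm (y $ n)" by (simp add: mult_le_cancel_right1)
    also have "\<dots> = norm (fps_deriv y $ m)" using Suc by (simp add: norm_mult del: of_nat_Suc)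
    also have "\<dots> \<le> real C ^ n" using C[of m] Suc by simp
    also have "\<dots> \<le> real (Suc C) ^ n" by (intro power_mono) auto
    finally show ?thesis by (simp add: power_one_over divide_simps)
  qed (use y0 in auto)
  then show ?thesis by (rule fps_conv_radius_pos_if_bounded) simp
qed

text \<open>Solves the preceding relation for the time, by a logarithm if the field has a linear
  part across the line and directly otherwise. A monomial \<mu> can be divided out.\<close>

lemma (in planar_field) convergent_time:
  assumes f: "restr c 1 f = 0" and W: "fps_conv_radius (restr c 1 (flow_quot \<alpha> var_x)) > 0"
    and \<mu>: "restr c 1 (fps_deriv f) = fps_const l * fps_X ^ e"
  shows "fps_conv_radius (restr c 1 \<alpha>) > 0"
proof (cases "l = 0")
  case True
  then show ?thesis using restrict_flow_quot(1)[OF f, of \<alpha>] W \<mu> by simp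
next
  case False
  define \<mu> where "\<mu> = restr c 1 (fps_deriv f)"
  have "order_ge 1 (fps_deriv f)" using order_f by (intro order_ge_deriv) (simp add: numeral_2_eq_2)
  then have \<mu>0: "\<mu> $ 0 = 0" unfolding \<mu>_def by (intro order_restr) auto
  have "fps_conv_radius (1 + \<mu> * restr c 1 (flow_quot \<alpha> var_x)) > 0"
    unfolding \<mu>_def \<mu> by (intro fps_conv_radius_add_pos fps_conv_radius_mult_pos W) auto
  then have "fps_conv_radius (fps_exp 1 oo (\<mu> * restr c 1 \<alpha>)) > 0"
    unfolding \<mu>_def restrict_flow_quot(2)[OF f] .
  then have "fps_conv_radius (\<mu> * restr c 1 \<alpha>) > 0"
    by (rule fps_conv_radius_log_pos[rotated]) (simp add: \<mu>0)
  then show ?thesis using False unfolding \<mu>_def \<mu> by (rule fps_conv_radius_monom_mult_posD)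
qed

subsection \<open>The homological equation\<close>

definition integral_x :: "series2 \<Rightarrow> series2" where
  "integral_x h = Abs_fps (\<lambda>i. if i = 0 then 0 else fps_const (1 / of_nat i) * h $ (i - 1))"

lemma deriv_integral_x [simp]: "fps_deriv (integral_x h) = h"
proof (intro fps_ext[where ?'a = "complex fps"])
  fix n
  have "of_nat (n + 1) = (fps_const (of_nat (Suc n)) :: complex fps)" by (simp only: fps_of_nat Suc_eq_plus1)
  then show "fps_deriv (integral_x h) $ n = h $ n"
    by (simp add: integral_x_def mult.assoc[symmetric] del: of_nat_Suc of_nat_add)
qed

lemma integral_x_nth_0 [simp]: "integral_x h $ 0 = 0"
  by (simp add: integral_x_def)

lemma integral_x_add: "integral_x (g + h) = integral_x g + integral_x h"
  by (intro fps_ext) (simp add: integral_x_def algebra_simps)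

lemma integral_x_scal: "integral_x (scal c * h) = scal c * integral_x h"
  by (intro fps_ext) (simp add: integral_x_def algebra_simps)

lemma integral_x_0 [simp]: "integral_x 0 = 0"
  by (intro fps_ext) (simp add: integral_x_def)

lemma order_integral_x: "order_ge n h \<Longrightarrow> order_ge (Suc n) (integral_x h)"
  by (auto simp: order_ge_def integral_x_def)

lemma homogeneous_integral_x: "homogeneous n h \<Longrightarrow> homogeneous (Suc n) (integral_x h)"
  by (auto simp: homogeneous_def integral_x_def)

lemma formal_cont_integral_x: "formal_cont integral_x"
  by (rule formal_contI[of _ 0]) (auto simp: integral_x_add intro: order_ge_mono[OF order_integral_x])

lemma restr_0_1: "restr 0 1 g = g $ 0"
proof (intro fps_ext)
  fix n
  have "restr 0 1 g $ n = (\<Sum>i\<le>n. if i = 0 then g $ 0 $ n else 0)"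
    unfolding restr_def fps_nth_Abs_fps by (intro sum.cong) auto
  then show "restr 0 1 g $ n = g $ 0 $ n" by simp
qed

lemma restr_homogeneous:
  "homogeneous m g \<Longrightarrow> n \<noteq> m \<Longrightarrow> restr c e g $ n = 0"
  unfolding restr_def homogeneous_def by (auto intro!: sum.neutral)

text \<open>The generating function \<open>z / (e\<^sup>z - 1)\<close> of the Bernoulli numbers.\<close>

definition bernoulli_fps :: "complex fps" where
  "bernoulli_fps = inverse (fps_shift 1 (fps_exp 1))"

lemma fps_exp_minus_1_eq: "fps_exp 1 - 1 = fps_shift 1 (fps_exp 1) * (fps_X :: complex fps)"
  by (intro fps_ext) auto

lemma shift_exp_mult_bernoulli: "fps_shift 1 (fps_exp 1) * bernoulli_fps = 1"
  unfolding bernoulli_fps_def by (rule inverse_mult_eq_1') simp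

lemma bernoulli_fps_nth_0: "bernoulli_fps $ 0 = 1"
  by (simp add: bernoulli_fps_def)

context planar_field
begin

lemma X_oper: "X (oper c h) = oper (fps_X * c) h"
  by (simp add: oper_oper[symmetric] oper_fps_X)

text \<open>Solves \<open>\<alpha> \<circ> exp (f \<partial>/\<partial>x) - \<alpha> = f h\<close> with \<open>\<alpha> = 0\<close> on \<open>x = 0\<close> (Euler-Maclaurin).\<close>

definition hom_solution :: "series2 \<Rightarrow> series2" where
  "hom_solution h = integral_x h + oper (fps_shift 1 bernoulli_fps) (f * h)"

text \<open>Inverting e^X - 1 asks for X \<alpha> = B(X) (f h) with B = z / (e^z - 1). The constant
  coefficient of B gives f h, which is X of the integral of h; the others have a factor X to remove,
  hence the shift in the definition.\<close>

lemma X_hom_solution: "X (hom_solution h) = oper bernoulli_fps (f * h)"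
proof -
  have "X (hom_solution h) = oper 1 (f * h) + oper (fps_X * fps_shift 1 bernoulli_fps) (f * h)"
    unfolding hom_solution_def X_add X_oper by (simp add: oper_1 X_def)
  also have "\<dots> = oper (1 + fps_X * fps_shift 1 bernoulli_fps) (f * h)"
    by (rule oper_add_left[symmetric])
  also have "1 + fps_X * fps_shift 1 bernoulli_fps = bernoulli_fps"
    by (intro fps_ext) (auto simp: bernoulli_fps_nth_0)
  finally show ?thesis .
qed

lemma flow_hom_solution:
  "flow 1 (hom_solution h) = hom_solution h + f * h"
proof -
  have "flow 1 (hom_solution h) = oper (1 + (fps_exp 1 - 1)) (hom_solution h)"
    by (simp add: oper_exp)
  also have "\<dots> = hom_solution h + oper (fps_shift 1 (fps_exp 1)) (X (hom_solution h))"
    unfolding oper_add_left oper_1 fps_exp_minus_1_eq oper_oper[symmetric] oper_fps_X ..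
  also have "oper (fps_shift 1 (fps_exp 1)) (X (hom_solution h)) = f * h"
    unfolding X_hom_solution oper_oper shift_exp_mult_bernoulli oper_1 ..
  finally show ?thesis .
qed

lemma order_hom_solution:
  assumes "order_ge n h" shows "order_ge (Suc n) (hom_solution h)"
proof -
  have "order_ge (2 + n) (f * h)" by (intro order_ge_mult order_f assms)
  then have "order_ge (Suc n) (oper (fps_shift 1 bernoulli_fps) (f * h))"
    by (intro order_oper) (rule order_ge_mono, auto)
  then show ?thesis unfolding hom_solution_def
    by (intro order_ge_add order_integral_x assms)
qed

lemma restr_oper:
  assumes "restr c 1 f = 0"
  shows "restr c 1 (oper b (f * h)) = 0"
proof (intro fps_ext)
  fix n
  have 0: "restr c 1 ((X ^^ k) (f * h)) = 0" for k
    by (cases k) (auto simp: X_def restr_mult assms)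
  have "restr c 1 (oper b (f * h)) $ n = (\<Sum>k<Suc n. restr c 1 (scal (b $ k) * (X ^^ k) (f * h)) $ n)"
    unfolding oper_def
    by (intro restr_sum_series order_ge_mult_right) (rule order_ge_mono[OF order_Xpow0])
  then show "restr c 1 (oper b (f * h)) $ n = 0 $ n"
    by (simp only: restr_mult 0) simp
qed

text \<open>The boundary terms of the Euler-Maclaurin formula all contain f, so only the integral
  survives on a line of zeros.\<close>

lemma restrict_hom_solution:
  assumes "restr c 1 f = 0"
  shows "restr c 1 (hom_solution h) = restr c 1 (integral_x h)"
  unfolding hom_solution_def restr_add restr_oper[OF assms] by simp

text \<open>The coefficients of the powers of the parameter \<open>s\<close> in the solution \<open>\<alpha>\<close> of
  \<open>\<alpha> \<circ> \<phi> - \<alpha> = - s f\<close>, where \<open>\<phi>\<close> is the flow of \<open>f \<partial>/\<partial>x\<close> at the time \<open>1 + s f\<close>.\<close>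

fun sol :: "nat \<Rightarrow> series2" where
  "sol k = hom_solution (- (if k = 1 then 1 else 0)
     - (\<Sum>i<k. scal (1 / fact (k - i)) * (f ^ (k - i - 1) * flow 1 ((X ^^ (k - i)) (sol i)))))"

declare sol.simps [simp del]

text \<open>Besides summability over k, this makes each coefficient of the solution a polynomial in
  s: only the indices k \<le> n reach degree n.\<close>

lemma order_sol: "order_ge k (sol k)"
proof (induction k rule: less_induct)
  case (less k)
  have "order_ge (k - 1) (- (if k = 1 then 1 else 0 :: series2))" by simp
  moreover have "order_ge (k - 1) (scal (1 / fact (k - i)) * (f ^ (k - i - 1) * flow 1 ((X ^^ (k - i)) (sol i))))"
    if "i \<in> {..<k}" for i
  proof -
    have "order_ge (k - i + i) (flow 1 ((X ^^ (k - i)) (sol i)))"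
      using that by (intro order_flow order_Xpow less) auto
    then show ?thesis by (intro order_ge_mult_right) (rule order_ge_mono, auto)
  qed
  ultimately have "order_ge (Suc (k - 1)) (sol k)"
    unfolding sol.simps[of k] by (intro order_hom_solution order_ge_diff order_ge_sum)
  then show ?case by (rule order_ge_mono) simp
qed

text \<open>The coefficients of s^k are compared after expanding the flow at time 1 + s f around
  time 1. All terms with m > 0 contain f, so the equation for \<open>sol k\<close> has the form that
  \<open>hom_solution\<close> solves.\<close>

lemma flow_sol:
  "(\<Sum>m\<le>k. scal (1 / fact m) * (f ^ m * flow 1 ((X ^^ m) (sol (k - m))))) = sol k - (if k = 1 then f else 0)"
proof -
  let ?t = "\<lambda>m i. scal (1 / fact m) * (f ^ m * flow 1 ((X ^^ m) (sol i)))"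
  let ?s = "\<lambda>i. scal (1 / fact (k - i)) * (f ^ (k - i - 1) * flow 1 ((X ^^ (k - i)) (sol i)))"
  have "(\<Sum>m\<le>k. ?t m (k - m))
      = flow 1 (sol k) + (\<Sum>m=1..k. ?t m (k - m))"
    by (simp add: atMost_atLeast0 sum.atLeast_Suc_atMost)
  also have "(\<Sum>m=1..k. ?t m (k - m))
      = (\<Sum>i<k. ?t (k - i) i)"
    by (rule sum.reindex_bij_witness[of _ "\<lambda>i. k - i" "\<lambda>m. k - m"]) auto
  also have "\<dots> = f * (\<Sum>i<k. ?s i)"
    unfolding sum_distrib_left
  proof (intro sum.cong refl)
    fix i assume "i \<in> {..<k}"
    then have "f ^ (k - i) = f * f ^ (k - i - 1)" by (cases "k - i") auto
    then show "?t (k - i) i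
        = f * (?s i)"
      by (simp only: mult_ac)
  qed
  also have "flow 1 (sol k) = sol k + f * (- (if k = 1 then 1 else 0)
     - (\<Sum>i<k. ?s i))"
    unfolding sol.simps[of k] by (rule flow_hom_solution)
  finally show ?thesis by (simp add: right_diff_distrib)
qed

definition param_solution :: "complex \<Rightarrow> series2" where
  "param_solution s = sum_series (\<lambda>k. scal (s ^ k) * sol k)"

lemma vanishing_sol: "null_seq (\<lambda>k. scal (s ^ k) * sol k)"
  by (intro null_seqI order_ge_mult_right order_sol)

text \<open>Expansion of the time around 1 yields a double series whose n-th antidiagonal collects
  the terms with s^n.\<close>

lemma flow_param_solution:
  "flow (1 + scal s * f) (param_solution s) = param_solution s - scal s * f"
proof -
  let ?E = "\<lambda>n k. flow 1 ((X ^^ n) (sol k))"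
  define a where "a n k = scal (1 / fact n) * ((scal s * f) ^ n * (scal (s ^ k) * ?E n k))" for n k
  have ord: "order_ge (n + k) (?E n k)" for n k
    by (intro order_flow order_Xpow order_sol)
  have a: "order_ge (n + k) (a n k)" for n k
    unfolding a_def by (intro order_ge_mult_right ord)
  have van: "null_seq (\<lambda>k. scal (s ^ k) * ?E n k)" for n
    by (intro null_seq_mult null_seqI order_ge_mono[OF ord]) simp
  have "flow (1 + scal s * f) (param_solution s)
      = sum_series (\<lambda>n. scal (1 / fact n) * ((scal s * f) ^ n * flow 1 ((X ^^ n) (param_solution s))))"
    by (rule flow_plus)
  also have "\<dots> = sum_series (\<lambda>n. sum_series (a n))"
  proof (rule sum_series_cong)
    fix n
    have "(X ^^ n) (param_solution s) = sum_series (\<lambda>k. (X ^^ n) (scal (s ^ k) * sol k))"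
      unfolding param_solution_def by (rule sum_series_map[OF formal_cont_Xpow vanishing_sol])
    also have "flow 1 \<dots> = sum_series (\<lambda>k. flow 1 ((X ^^ n) (scal (s ^ k) * sol k)))"
      by (rule sum_series_map[OF formal_cont_flow null_seq_map[OF formal_cont_Xpow vanishing_sol]])
    also have "\<dots> = sum_series (\<lambda>k. scal (s ^ k) * ?E n k)"
      by (simp only: Xpow_fps_const_mult flow_mult flow_fps_const)
    finally have eq: "flow 1 ((X ^^ n) (param_solution s)) = sum_series (\<lambda>k. scal (s ^ k) * ?E n k)" .
    show "scal (1 / fact n) * ((scal s * f) ^ n * flow 1 ((X ^^ n) (param_solution s))) = sum_series (a n)"
      unfolding eq sum_series_mult[OF van] sum_series_mult[OF null_seq_mult[OF van]]
      by (rule sum_series_cong) (simp only: a_def)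
  qed
  also have "\<dots> = sum_series (\<lambda>n. \<Sum>m\<le>n. a m (n - m))"
    using a by (rule sum_series_triangle)
  also have "\<dots> = sum_series (\<lambda>n. scal (s ^ n) * sol n - (if n = 1 then scal s * f else 0))"
  proof (rule sum_series_cong)
    fix n
    have "(\<Sum>m\<le>n. a m (n - m)) = (\<Sum>m\<le>n. scal (s ^ n) * (scal (1 / fact m) * (f ^ m * ?E m (n - m))))"
    proof (intro sum.cong refl)
      fix m assume "m \<in> {..n}"
      then have "scal (s ^ n) = scal (s ^ m) * scal (s ^ (n - m))" by (simp add: power_add[symmetric])
      then show "a m (n - m) = scal (s ^ n) * (scal (1 / fact m) * (f ^ m * ?E m (n - m)))"
        unfolding a_def power_mult_distrib by (simp only: fps_const_power mult_ac)
    qed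
    also have "\<dots> = scal (s ^ n) * (sol n - (if n = 1 then f else 0))"
      unfolding sum_distrib_left[symmetric] flow_sol ..
    also have "\<dots> = scal (s ^ n) * sol n - (if n = 1 then scal s * f else 0)"
      by (simp add: right_diff_distrib)
    finally show "(\<Sum>m\<le>n. a m (n - m)) = scal (s ^ n) * sol n - (if n = 1 then scal s * f else 0)" .
  qed
  also have "\<dots> = param_solution s - scal s * f"
  proof -
    have "null_seq (\<lambda>n. if n = 1 then scal s * f else 0)"
      by (auto simp: null_seq_def eventually_sequentially intro!: exI[of _ 2])
    then show ?thesis
      by (simp only: sum_series_diff[OF vanishing_sol] param_solution_def sum_series_single)
  qed
  finally show ?thesis .
qed

lemma restrict_param_solution:
  "restr c 1 (param_solution s) $ n = (\<Sum>k\<le>n. restr c 1 (sol k) $ n * s ^ k)"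
proof -
  have "restr c 1 (param_solution s) $ n = (\<Sum>k<Suc n. restr c 1 (scal (s ^ k) * sol k) $ n)"
    unfolding param_solution_def
    by (intro restr_sum_series order_ge_mult_right) (rule order_ge_mono[OF order_sol])
  then show ?thesis by (simp add: restr_mult lessThan_Suc_atMost mult.commute)
qed

text \<open>Integration starts at x = 0 and the boundary terms vanish there. With this choice the
  restriction to x = x1 is the invariant delta_s itself.\<close>

lemma restrict_0_param_solution: "restr 0 1 (param_solution s) = 0"
proof (intro fps_ext)
  fix n
  have f0: "restr 0 1 f = 0" by (simp add: restr_0_1 f_nth_0)
  have "restr 0 1 (sol k) = 0" for k
    unfolding sol.simps[of k] restrict_hom_solution[OF f0] by (simp add: restr_0_1)
  then show "restr 0 1 (param_solution s) $ n = 0 $ n"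
    unfolding restrict_param_solution by simp
qed

lemma sol_0: "sol 0 = 0"
proof -
  have "hom_solution 0 = 0"
    by (rule order_ge_raise_eq_0) (metis order_ge_zero order_hom_solution)
  then show ?thesis by (simp add: sol.simps[of 0])
qed

text \<open>The factor e^z comes from the flow at time 1, applied to X (sol 1) = - B(X) f with B = z
  / (e^z - 1).\<close>

lemma sol_2: "sol 2 = hom_solution (oper (fps_exp 1 * bernoulli_fps) f)"
proof -
  have "sol 1 = hom_solution (- 1)"
    unfolding sol.simps[of 1] by (simp add: sol_0 formal_cont_zero[OF formal_cont_flow])
  then have "X (sol 1) = oper bernoulli_fps (- f)"
    by (simp add: X_hom_solution)
  moreover have "sol 2 = hom_solution (- flow 1 (X (sol 1)))"
    unfolding sol.simps[of 2] by (simp add: numeral_2_eq_2 sol_0 formal_cont_zero[OF formal_cont_flow])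
  ultimately show ?thesis
    by (simp add: oper_exp[symmetric] oper_oper oper_minus)
qed

end

context homogeneous_field
begin

lemma homogeneous_Xpow_f: "homogeneous (n * (d - 1) + d) ((X ^^ n) f)"
proof (induction n)
  case (Suc n)
  obtain d' where d': "d = Suc d'" using d_ge_2 by (cases d) auto
  have "homogeneous (d + (n * (d - 1) + d')) (X ((X ^^ n) f))"
    using Suc d' by (intro homogeneous_X) simp
  then show ?case using d' by (simp add: algebra_simps)
qed (use hom_f in simp)

text \<open>Since d \<ge> 2, the terms are homogeneous of pairwise distinct degrees, and each
  coefficient on the line isolates a single power of X.\<close>

lemma restrict_sol_2:
  assumes f: "restr c 1 f = 0"
  defines "N n \<equiv> Suc (n * (d - 1) + d)"
  shows "restr c 1 (sol 2) $ N n
    = (fps_exp 1 * bernoulli_fps) $ n * restr c 1 (integral_x ((X ^^ n) f)) $ N n"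
proof -
  define b where "b = fps_exp 1 * bernoulli_fps"
  have hom: "homogeneous (N k) (integral_x ((X ^^ k) f))" for k
    unfolding N_def by (intro homogeneous_integral_x homogeneous_Xpow_f)
  have ord: "order_ge k (integral_x ((X ^^ k) f))" for k
    by (rule order_ge_mono[OF order_integral_x[OF order_Xpow0]]) simp
  have "integral_x (oper b f) = sum_series (\<lambda>k. integral_x (scal (b $ k) * (X ^^ k) f))"
    unfolding oper_def by (rule sum_series_map[OF formal_cont_integral_x vanishing_oper_term])
  also have "\<dots> = sum_series (\<lambda>k. scal (b $ k) * integral_x ((X ^^ k) f))"
    by (simp only: integral_x_scal)
  finally have "restr c 1 (sol 2) $ N n
      = restr c 1 (sum_series (\<lambda>k. scal (b $ k) * integral_x ((X ^^ k) f))) $ N n"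
    unfolding sol_2 restrict_hom_solution[OF f] b_def by simp
  also have "\<dots> = (\<Sum>k<Suc (N n). restr c 1 (scal (b $ k) * integral_x ((X ^^ k) f)) $ N n)"
    by (intro restr_sum_series order_ge_mult_right) (rule order_ge_mono[OF ord])
  also have "\<dots> = (\<Sum>k<Suc (N n). if k = n then b $ n * restr c 1 (integral_x ((X ^^ n) f)) $ N n else 0)"
  proof (intro sum.cong refl)
    fix k
    have "N n \<noteq> N k" if "k \<noteq> n" using that d_ge_2 by (auto simp: N_def)
    then show "restr c 1 (scal (b $ k) * integral_x ((X ^^ k) f)) $ N n
        = (if k = n then b $ n * restr c 1 (integral_x ((X ^^ n) f)) $ N n else 0)"
      using restr_homogeneous[OF hom, of "N n" k c 1] by (auto simp: restr_mult)
  qed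
  also have "\<dots> = b $ n * restr c 1 (integral_x ((X ^^ n) f)) $ N n"
  proof -
    have "n * 1 \<le> n * (d - 1)" using d_ge_2 by (intro mult_le_mono2) simp
    then have "n < Suc (N n)" unfolding N_def by linarith
    then show ?thesis by (simp only: sum.delta finite_lessThan lessThan_iff if_True)
  qed
  finally show ?thesis by (simp add: b_def)
qed

end

subsection \<open>Leading coefficients and growth\<close>

text \<open>Chebyshev's extremal problem on [0, 1] with a cruder constant: the leading coefficient
  over 4^m is the value at 0 of a polynomial that is bounded by M on the unit circle.\<close>

lemma lead_coeff_le_sup:
  fixes P :: "real poly"
  assumes M: "\<And>x. 0 \<le> x \<Longrightarrow> x \<le> 1 \<Longrightarrow> \<bar>poly P x\<bar> \<le> M"
  shows "\<bar>lead_coeff P\<bar> \<le> 4 ^ degree P * M"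
proof -
  define m where "m = degree P"
  text \<open>On the unit circle this is \<open>z ^ m * P ((1 + Re z) / 2)\<close>.\<close>
  define Q :: "complex \<Rightarrow> complex" where
    "Q z = (\<Sum>i\<le>m. of_real (coeff P i) * (z ^ (m - i) * ((1 + z)\<^sup>2 / 4) ^ i))" for z
  have Q0: "Q 0 = of_real (coeff P m) / 4 ^ m"
  proof -
    have "Q 0 = (\<Sum>i\<le>m. if i = m then of_real (coeff P m) / 4 ^ m else 0)"
      unfolding Q_def by (intro sum.cong refl) (auto simp: power_0_left power_one_over)
    then show ?thesis by simp
  qed
  have bound: "norm (Q z) \<le> M" if z: "norm z = 1" for z
  proof -
    define x where "x = (1 + Re z) / 2"
    have "\<bar>Re z\<bar> \<le> 1" using abs_Re_le_cmod[of z] z by simp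
    then have x: "0 \<le> x" "x \<le> 1" by (auto simp: x_def)
    have z0: "z \<noteq> 0" using z by auto
    have zc: "z * cnj z = 1" using z by (simp add: complex_norm_square[symmetric])
    have "(1 + z)\<^sup>2 / 4 = z * of_real x"
    proof -
      have "z * of_real x = z * (2 + (z + cnj z)) / 4"
        by (simp add: x_def complex_add_cnj algebra_simps)
      also have "\<dots> = (2 * z + z\<^sup>2 + z * cnj z) / 4" by (simp add: algebra_simps power2_eq_square)
      also have "\<dots> = (1 + z)\<^sup>2 / 4" unfolding zc by (simp add: algebra_simps power2_eq_square)
      finally show ?thesis ..
    qed
    then have "Q z = (\<Sum>i\<le>m. z ^ m * of_real (coeff P i * x ^ i))"
      unfolding Q_def
    proof (intro sum.cong refl)
      fix i assume eq: "(1 + z)\<^sup>2 / 4 = z * of_real x" and i: "i \<in> {..m}"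
      have "z ^ m = z ^ (m - i) * z ^ i" using i by (simp add: power_add[symmetric])
      then show "of_real (coeff P i) * (z ^ (m - i) * ((1 + z)\<^sup>2 / 4) ^ i) = z ^ m * of_real (coeff P i * x ^ i)"
        unfolding eq by (simp add: power_mult_distrib mult_ac)
    qed
    also have "\<dots> = z ^ m * of_real (poly P x)"
      by (simp add: poly_altdef m_def sum_distrib_left)
    finally show ?thesis using M[OF x] z by (simp add: norm_mult norm_power)
  qed
  have hol: "Q holomorphic_on A" for A unfolding Q_def by (intro holomorphic_intros) auto
  \<comment> \<open>Cauchy's inequality for the derivative of order 0 serves as the maximum
    principle.\<close>
  have "norm ((deriv ^^ 0) Q 0) \<le> fact 0 * M / 1 ^ 0"
    by (rule Cauchy_inequality) (auto intro: hol holomorphic_on_imp_continuous_on bound)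
  then have "norm (Q 0) \<le> M" by simp
  then show ?thesis unfolding Q0 by (simp add: norm_divide norm_power m_def field_simps)
qed

lemma pderiv_sum: "pderiv (sum p A) = (\<Sum>k\<in>A. pderiv (p k))"
  by (induction A rule: infinite_finite_induct) (auto simp: pderiv_add)

definition antideriv :: "real poly \<Rightarrow> real poly" where
  "antideriv Q = (\<Sum>i\<le>degree Q. monom (coeff Q i / real (Suc i)) (Suc i))"

lemma pderiv_antideriv: "pderiv (antideriv Q) = Q"
proof -
  have "pderiv (antideriv Q) = (\<Sum>i\<le>degree Q. monom (coeff Q i) i)"
    unfolding antideriv_def pderiv_sum by (intro sum.cong refl) (simp add: pderiv_monom del: of_nat_Suc)
  then show ?thesis by (simp add: poly_as_sum_of_monoms)
qed

lemma poly_antideriv_0: "poly (antideriv Q) 0 = 0"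
  by (simp add: antideriv_def poly_sum poly_monom)

lemma antideriv_eq: "pderiv A = Q \<Longrightarrow> poly (antideriv Q) 1 = poly A 1 - poly A 0"
proof -
  assume "pderiv A = Q"
  then have "pderiv (A - antideriv Q) = 0" by (simp add: pderiv_diff pderiv_antideriv)
  then obtain c where "A - antideriv Q = [:c:]" by (auto simp: pderiv_eq_0_iff elim: degree_eq_zeroE)
  then have "poly (A - antideriv Q) x = c" for x by simp
  from this[of 0] this[of 1] show ?thesis by (simp add: poly_antideriv_0)
qed

text \<open>The antiderivative of a function of constant sign is monotone, hence largest in modulus
  at 1; the value there is bounded below by its leading coefficient.\<close>

lemma antideriv_lower_bound:
  fixes Q :: "real poly"
  assumes sgn: "\<And>x. 0 \<le> x \<Longrightarrow> x \<le> 1 \<Longrightarrow> 0 \<le> \<epsilon> * poly Q x" and \<epsilon>: "\<bar>\<epsilon>\<bar> = 1" and Q: "Q \<noteq> 0"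
  shows "\<bar>lead_coeff Q\<bar> \<le> real (Suc (degree Q)) * 4 ^ Suc (degree Q) * \<bar>poly (antideriv Q) 1\<bar>"
proof -
  define A where "A = antideriv Q"
  have mono: "\<epsilon> * poly A x \<le> \<epsilon> * poly A y" if "0 \<le> x" "x \<le> y" "y \<le> 1" for x y
  proof (rule DERIV_nonneg_imp_nondecreasing[OF that(2)])
    fix t assume "x \<le> t" "t \<le> y"
    moreover have "((\<lambda>x. \<epsilon> * poly A x) has_real_derivative \<epsilon> * poly Q t) (at t)"
      using poly_DERIV[of A t] pderiv_antideriv[of Q] by (auto simp: A_def intro!: DERIV_cmult)
    ultimately show "\<exists>y. ((\<lambda>x. \<epsilon> * poly A x) has_real_derivative y) (at t) \<and> 0 \<le> y"
      using sgn that by (intro exI[of _ "\<epsilon> * poly Q t"]) auto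
  qed
  have "\<bar>poly A x\<bar> \<le> \<bar>poly A 1\<bar>" if "0 \<le> x" "x \<le> 1" for x
  proof -
    have "0 \<le> \<epsilon> * poly A x" "\<epsilon> * poly A x \<le> \<epsilon> * poly A 1"
      using mono[of 0 x] mono[of x 1] that by (auto simp: A_def poly_antideriv_0)
    then have "\<bar>\<epsilon> * poly A x\<bar> \<le> \<bar>\<epsilon> * poly A 1\<bar>" by linarith
    then show ?thesis using \<epsilon> by (simp add: abs_mult)
  qed
  then have *: "\<bar>lead_coeff A\<bar> \<le> 4 ^ degree A * \<bar>poly A 1\<bar>" by (rule lead_coeff_le_sup)
  have degQ: "degree Q = degree A - 1" using degree_pderiv[of A] by (simp add: A_def pderiv_antideriv)
  have "degree A \<noteq> 0"
  proof
    assume "degree A = 0"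
    then have "pderiv A = 0" by (simp add: pderiv_eq_0_iff)
    then show False using Q by (simp add: A_def pderiv_antideriv)
  qed
  then have degA: "degree A = Suc (degree Q)" using degQ by simp
  have "lead_coeff Q = real (Suc (degree Q)) * lead_coeff A"
    using coeff_pderiv[of A "degree Q"] by (simp add: A_def pderiv_antideriv degA[unfolded A_def])
  then have "\<bar>lead_coeff Q\<bar> = real (Suc (degree Q)) * \<bar>lead_coeff A\<bar>" by (simp add: abs_mult)
  also have "\<dots> \<le> real (Suc (degree Q)) * (4 ^ degree A * \<bar>poly A 1\<bar>)"
    using * by (intro mult_left_mono) auto
  finally show ?thesis unfolding degA unfolding A_def by (simp only: mult.assoc)
qed

text \<open>The polynomial \<open>F * iter_poly F n\<close> is the \<open>n\<close>-th Lie derivative of \<open>F\<close> along \<open>F \<partial>/\<partial>y\<close>.\<close>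

fun iter_poly :: "real poly \<Rightarrow> nat \<Rightarrow> real poly" where
  "iter_poly F 0 = 1"
| "iter_poly F (Suc n) = pderiv (F * iter_poly F n)"

text \<open>Integration by parts: (F R_i)' = R_(i+1), and the boundary terms vanish at both zeros of
  F. Each step moves one iteration to the other factor and changes the sign.\<close>

lemma antideriv_iter_swap:
  assumes "poly F 0 = 0" "poly F 1 = 0"
  shows "poly (antideriv (F * iter_poly F (i + m) * iter_poly F j)) 1
    = (-1) ^ m * poly (antideriv (F * iter_poly F i * iter_poly F (j + m))) 1"
proof (induction m arbitrary: j)
  case (Suc m)
  let ?R = "iter_poly F"
  have lin: "poly (antideriv (p + q)) 1 = poly (antideriv p) 1 + poly (antideriv q) 1" for p q
    using antideriv_eq[of "antideriv p + antideriv q" "p + q"]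
    by (simp add: pderiv_add pderiv_antideriv poly_antideriv_0)
  have "poly (antideriv (pderiv ((F * ?R (i + m)) * (F * ?R j)))) 1 = 0"
    using antideriv_eq[OF refl, of "(F * ?R (i + m)) * (F * ?R j)"] assms by simp
  moreover have "pderiv ((F * ?R (i + m)) * (F * ?R j))
      = F * ?R (i + m) * ?R (Suc j) + F * ?R (i + Suc m) * ?R j"
    by (subst pderiv_mult) (simp add: mult_ac)
  ultimately have "poly (antideriv (F * ?R (i + Suc m) * ?R j)) 1
      = - poly (antideriv (F * ?R (i + m) * ?R (Suc j))) 1"
    by (simp only: lin)
  also have "\<dots> = - ((-1) ^ m * poly (antideriv (F * ?R i * ?R (Suc j + m))) 1)"
    by (simp only: Suc.IH)
  finally show ?case by simp
qed simp

text \<open>Each step multiplies the leading coefficient by the degree (n + 1) e + 1 \<ge> n + 1,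
  which is the source of the factorial.\<close>

lemma iter_poly_degree_lead:
  assumes F: "lead_coeff F = 1" "degree F = Suc e" "e \<ge> 1"
  shows "degree (iter_poly F n) = n * e \<and> lead_coeff (iter_poly F n) \<ge> fact n"
proof (induction n)
  case (Suc n)
  have R0: "iter_poly F n \<noteq> 0"
  proof
    assume "iter_poly F n = 0"
    with Suc have "(fact n :: real) \<le> 0" by simp
    then show False by (metis fact_gt_zero not_le)
  qed
  have F0: "F \<noteq> 0" using F by auto
  have deg: "degree (F * iter_poly F n) = Suc (Suc n * e)"
    using Suc F R0 F0 by (simp add: degree_mult_eq)
  have lead: "lead_coeff (F * iter_poly F n) = lead_coeff (iter_poly F n)"
    using F by (simp add: lead_coeff_mult)
  have dS: "degree (iter_poly F (Suc n)) = Suc n * e" using deg by (simp add: degree_pderiv)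
  have "lead_coeff (iter_poly F (Suc n)) = real (Suc (Suc n * e)) * lead_coeff (iter_poly F n)"
    unfolding dS unfolding iter_poly.simps coeff_pderiv lead[symmetric] deg by simp
  moreover have "real (Suc n) * fact n \<le> real (Suc (Suc n * e)) * lead_coeff (iter_poly F n)"
  proof (intro mult_mono)
    have "Suc n * 1 \<le> Suc n * e" using F(3) by (intro mult_le_mono2)
    then show "real (Suc n) \<le> real (Suc (Suc n * e))" by (intro of_nat_mono) simp
  qed (use Suc in auto)
  ultimately show ?case using dS by simp
qed simp

text \<open>Sharing the 2 k iterations equally between two factors produces F R_k^2, of constant
  sign; \<open>M k\<close> is the degree of its antiderivative.\<close>

lemma iter_poly_lower_bound:
  assumes F: "lead_coeff F = 1" "degree F = Suc e" "e \<ge> 1" "poly F 0 = 0" "poly F 1 = 0"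
    and sgn: "\<And>x. 0 \<le> x \<Longrightarrow> x \<le> 1 \<Longrightarrow> 0 \<le> \<epsilon> * poly F x" "\<bar>\<epsilon>\<bar> = 1"
  defines "M k \<equiv> Suc (Suc e + 2 * (k * e))"
  shows "(fact k)\<^sup>2 \<le> real (M k) * 4 ^ M k * \<bar>poly (antideriv (F * iter_poly F (2 * k))) 1\<bar>"
proof -
  define R where "R = iter_poly F k"
  define Q where "Q = F * R * R"
  have R: "degree R = k * e" "lead_coeff R \<ge> fact k"
    using iter_poly_degree_lead[OF F(1-3), of k] by (auto simp: R_def)
  have fk: "(0 :: real) < fact k" by simp
  then have R0: "R \<noteq> 0" using R(2) by (metis coeff_0 not_le)
  have F0: "F \<noteq> 0" using F by auto
  have Q0: "Q \<noteq> 0" using R0 F0 by (simp add: Q_def)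
  have deg: "Suc (degree Q) = M k" using R0 F0 R F by (simp add: Q_def degree_mult_eq M_def)
  have "lead_coeff Q = (lead_coeff R)\<^sup>2" using F by (simp add: Q_def lead_coeff_mult power2_eq_square)
  then have "(fact k)\<^sup>2 \<le> \<bar>lead_coeff Q\<bar>" using R(2) by (simp add: power_mono)
  also have "\<bar>lead_coeff Q\<bar> \<le> real (M k) * 4 ^ M k * \<bar>poly (antideriv Q) 1\<bar>"
    unfolding deg[symmetric]
  proof (rule antideriv_lower_bound[OF _ sgn(2) Q0])
    fix x :: real assume "0 \<le> x" "x \<le> 1"
    from sgn(1)[OF this] have "0 \<le> (\<epsilon> * poly F x) * (poly R x)\<^sup>2" by simp
    then show "0 \<le> \<epsilon> * poly Q x" by (simp add: Q_def power2_eq_square mult_ac)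
  qed
  also have "poly (antideriv (F * iter_poly F (k + k) * iter_poly F 0)) 1 = (-1) ^ k * poly (antideriv Q) 1"
    unfolding Q_def R_def by (subst antideriv_iter_swap[OF F(4,5)]) simp
  then have "\<bar>poly (antideriv Q) 1\<bar> = \<bar>poly (antideriv (F * iter_poly F (2 * k))) 1\<bar>"
    by (simp add: abs_mult mult_2)
  finally show ?thesis .
qed

subsection \<open>The exponential generating function of the Bernoulli numbers is not entire\<close>

lemma exp_mult_bernoulli: "fps_exp 1 * bernoulli_fps * (fps_exp 1 - 1) = fps_exp 1 * fps_X"
  unfolding fps_exp_minus_1_eq using shift_exp_mult_bernoulli by (simp add: algebra_simps)

lemma fps_exp_minus_1_neq_0: "fps_exp 1 - 1 \<noteq> (0 :: complex fps)"
proof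
  assume "fps_exp 1 - 1 = (0 :: complex fps)"
  then have "(fps_exp 1 - 1) $ 1 = (0 :: complex)" by simp
  then show False by simp
qed

text \<open>With B(z) = z / (e^z - 1), the series e^z B(z) equals both B(z) + z and B(- z), so its
  odd coefficients beyond the first are their own negatives.\<close>

lemma bernoulli_odd:
  assumes "odd n" "n \<noteq> 1"
  shows "(fps_exp 1 * bernoulli_fps) $ n = 0"
proof -
  define b where "b = fps_exp 1 * bernoulli_fps"
  define E where "E = (fps_exp 1 - 1 :: complex fps)"
  have bern: "bernoulli_fps * E = fps_X"
    unfolding E_def fps_exp_minus_1_eq using shift_exp_mult_bernoulli by (simp add: algebra_simps)
  have "(b - fps_X) * E = bernoulli_fps * E"
    using exp_mult_bernoulli bern unfolding b_def[symmetric] E_def by (simp add: algebra_simps)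
  moreover have E0: "E \<noteq> 0" unfolding E_def by (rule fps_exp_minus_1_neq_0)
  ultimately have "b - fps_X = bernoulli_fps" by simp
  then have b1: "b = bernoulli_fps + fps_X" by (simp add: diff_eq_eq)
  have "(bernoulli_fps oo (- fps_X)) * (E oo (- fps_X)) = - fps_X"
    by (subst fps_compose_mult_distrib[symmetric]) (auto simp: bern)
  moreover have "E oo (- fps_X) = fps_exp (-1) - 1"
    unfolding E_def fps_compose_sub_distrib fps_compose_uminus'
    by (intro fps_ext) (auto simp: power_minus')
  ultimately have "(bernoulli_fps oo (- fps_X)) * (fps_exp (-1) - 1) * fps_exp 1 = - fps_X * fps_exp 1"
    by simp
  moreover have "(fps_exp (-1) - 1) * fps_exp 1 = - E"
    using fps_exp_add_mult[of "-1" "1 :: complex"] by (simp add: E_def algebra_simps)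
  ultimately have "(bernoulli_fps oo (- fps_X)) * (- E) = - fps_X * fps_exp 1"
    by (simp only: mult.assoc)
  moreover have "b * E = fps_exp 1 * fps_X"
    unfolding b_def E_def by (rule exp_mult_bernoulli)
  ultimately have "(bernoulli_fps oo (- fps_X)) * E = b * E"
    by (simp add: mult.commute)
  then have b2: "b = bernoulli_fps oo (- fps_X)"
    using E0 by simp
  have "b $ n = - bernoulli_fps $ n" unfolding b2 fps_compose_uminus' using assms by simp
  moreover have "b $ n = bernoulli_fps $ n" unfolding b1 using assms by simp
  ultimately show ?thesis by (simp add: b_def)
qed

text \<open>The bound makes the series b = e^z z / (e^z - 1) entire, so that b(z) (e^z - 1) = z e^z
  can be evaluated at 2 pi i, where only the left side vanishes.\<close>

lemma bernoulli_not_entire: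
  assumes "\<And>n. norm ((fps_exp 1 * bernoulli_fps) $ n) \<le> K * E ^ n / fact n"
  shows False
proof -
  define b where "b = fps_exp 1 * bernoulli_fps"
  have rad: "fps_conv_radius b = \<infinity>"
    unfolding fps_conv_radius_def
  proof (rule conv_radius_inftyI')
    fix r :: real
    have "summable (\<lambda>n. norm (b $ n * of_real r ^ n))"
    proof (rule summable_comparison_test')
      show "summable (\<lambda>n. K * (inverse (fact n) * (E * \<bar>r\<bar>) ^ n))"
        by (intro summable_mult summable_exp)
      fix n :: nat
      have "norm (b $ n * of_real r ^ n) \<le> K * E ^ n / fact n * \<bar>r\<bar> ^ n"
        unfolding norm_mult b_def using order_trans[OF norm_ge_zero assms]
        by (intro mult_mono assms) (auto simp: norm_power)
      then show "norm (norm (b $ n * of_real r ^ n)) \<le> K * (inverse (fact n) * (E * \<bar>r\<bar>) ^ n)"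
        by (simp add: power_mult_distrib field_simps)
    qed
    then show "\<exists>z. norm z = r \<and> summable (\<lambda>n. b $ n * z ^ n)" if "r > 0"
      using that by (intro exI[of _ "of_real r"]) (auto dest: summable_norm_cancel)
  qed
  define z where "z = 2 * of_real pi * \<i>"
  have "eval_fps (b * (fps_exp 1 - 1)) z = eval_fps b z * (exp z - 1)"
  proof -
    have "fps_conv_radius (fps_exp 1 - 1 :: complex fps) = \<infinity>"
      using fps_conv_radius_diff[of "fps_exp 1" "1 :: complex fps"] by simp
    then show ?thesis using rad by (subst eval_fps_mult) (auto simp: eval_fps_diff)
  qed
  moreover have "eval_fps (fps_exp 1 * fps_X) z = exp z * z"
    by (subst eval_fps_mult) auto
  moreover have "exp z = 1" by (simp add: z_def)
  ultimately have "z = 0" using exp_mult_bernoulli by (simp add: b_def)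
  then show False by (simp add: z_def)
qed

section \<open>Growth of the coefficient of s^2 for two lines\<close>

lemma line_0: "line 0 = var_x" and line_1: "line 1 = var_x - var_x1"
  by (simp_all add: line_def)

text \<open>The homogenization \<open>x1 ^ m * Q (x / x1)\<close> of a polynomial.\<close>

definition homogenize :: "nat \<Rightarrow> real poly \<Rightarrow> series2" where
  "homogenize m Q = Abs_fps (\<lambda>i. Abs_fps (\<lambda>j. if i + j = m then of_real (coeff Q i) else 0))"

text \<open>The degree bounds matter: \<open>homogenize m\<close> cuts off all coefficients beyond
  m.\<close>

lemma homogenize_mult:
  assumes "degree P \<le> m" "degree Q \<le> n"
  shows "homogenize m P * homogenize n Q = homogenize (m + n) (P * Q)"
proof (intro fps_ext)
  fix i j
  have P0: "coeff P k = 0" if "k > m" for k using assms(1) that by (intro coeff_eq_0) simp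
  have Q0: "coeff Q k = 0" if "k > n" for k using assms(2) that by (intro coeff_eq_0) simp
  have "(homogenize m P * homogenize n Q) $ i $ j
      = (\<Sum>k\<le>i. \<Sum>l\<le>j. if k + l = m \<and> (i - k) + (j - l) = n then of_real (coeff P k * coeff Q (i - k)) else 0)"
    unfolding mult_nth2 atLeast0AtMost by (intro sum.cong refl) (auto simp: homogenize_def)
  also have "\<dots> = (\<Sum>k\<le>i. if i + j = m + n then of_real (coeff P k * coeff Q (i - k)) else 0)"
  proof (intro sum.cong refl)
    fix k assume k: "k \<in> {..i}"
    show "(\<Sum>l\<le>j. if k + l = m \<and> (i - k) + (j - l) = n then of_real (coeff P k * coeff Q (i - k)) else (0::complex))
      = (if i + j = m + n then of_real (coeff P k * coeff Q (i - k)) else 0)"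
    proof (cases "i + j = m + n \<and> k \<le> m \<and> i - k \<le> n")
      case True
      then have "(\<Sum>l\<le>j. if k + l = m \<and> (i - k) + (j - l) = n then of_real (coeff P k * coeff Q (i - k)) else (0::complex))
          = (\<Sum>l\<le>j. if l = m - k then of_real (coeff P k * coeff Q (i - k)) else 0)"
        using k by (intro sum.cong refl) auto
      then show ?thesis using True k by auto
    next
      case False
      then have "(if k + l = m \<and> (i - k) + (j - l) = n then of_real (coeff P k * coeff Q (i - k)) else (0::complex)) = 0"
        if "l \<in> {..j}" for l using that k P0[of k] Q0[of "i - k"] by auto
      moreover have "(if i + j = m + n then of_real (coeff P k * coeff Q (i - k)) else (0::complex)) = 0"
        using False P0[of k] Q0[of "i - k"] by auto
      ultimately show ?thesis by (simp only: sum.neutral_const cong: sum.cong)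
    qed
  qed
  also have "\<dots> = homogenize (m + n) (P * Q) $ i $ j"
    by (simp add: homogenize_def coeff_mult)
  finally show "(homogenize m P * homogenize n Q) $ i $ j = homogenize (m + n) (P * Q) $ i $ j" .
qed

lemma homogenize_power:
  assumes "degree P \<le> 1"
  shows "homogenize 1 P ^ n = homogenize n (P ^ n)"
proof (induction n)
  case 0
  show ?case by (intro fps_ext) (auto simp: homogenize_def)
next
  case (Suc n)
  have "degree (P ^ n) \<le> n"
    using degree_power_le[of P n] mult_le_mono1[OF assms, of n] by linarith
  then show ?case using homogenize_mult[OF assms, of "P ^ n" n] Suc by simp
qed

lemma deriv_homogenize: "fps_deriv (homogenize (Suc m) Q) = homogenize m (pderiv Q)"
proof (intro fps_ext)
  fix i j
  have "of_nat (i + 1) = (fps_const (of_nat (Suc i)) :: complex fps)" by (simp only: fps_of_nat Suc_eq_plus1)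
  then show "fps_deriv (homogenize (Suc m) Q) $ i $ j = homogenize m (pderiv Q) $ i $ j"
    by (simp add: homogenize_def coeff_pderiv del: of_nat_Suc of_nat_add)
qed

text \<open>The substitution x = x1 y turns the integral from 0 to x1 into x1^(m+1) times that of Q
  over [0, 1].\<close>

lemma restrict_integral_homogenize:
  assumes "degree Q \<le> m"
  shows "restr 1 1 (integral_x (homogenize m Q)) $ Suc m = of_real (poly (antideriv Q) 1)"
proof -
  have "restr 1 1 (integral_x (homogenize m Q)) $ Suc m
      = (\<Sum>i\<le>Suc m. integral_x (homogenize m Q) $ i $ (Suc m - i))"
    by (simp add: restr_def del: sum.atMost_Suc)
  also have "\<dots> = (\<Sum>i\<le>m. of_real (coeff Q i / real (Suc i)))"
    unfolding sum.atMost_Suc_shift by (simp add: integral_x_def homogenize_def del: of_nat_Suc)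
  also have "\<dots> = of_real (\<Sum>i\<le>m. coeff Q i / real (Suc i))" by simp
  also have "(\<Sum>i\<le>m. coeff Q i / real (Suc i)) = (\<Sum>i\<le>degree Q. coeff Q i / real (Suc i))"
    using assms by (intro sum.mono_neutral_right) (auto simp: coeff_eq_0)
  finally show ?thesis by (simp add: antideriv_def poly_sum poly_monom)
qed

lemma fact_double_le: "(fact (2 * k) :: real) \<le> 4 ^ k * (fact k)\<^sup>2"
proof (induction k)
  case (Suc k)
  have "(fact (2 * Suc k) :: real) = real (2 * k + 2) * real (2 * k + 1) * fact (2 * k)"
    by (simp add: algebra_simps)
  also have "\<dots> \<le> (real (2 * k + 2) * real (2 * k + 2)) * (4 ^ k * (fact k)\<^sup>2)"
    using Suc by (intro mult_mono) auto
  also have "\<dots> = 4 ^ Suc k * (fact (Suc k))\<^sup>2" by (simp add: power2_eq_square algebra_simps)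
  finally show ?case .
qed simp

locale two_lines =
  fixes a b :: nat
  assumes a: "a \<ge> 1" and b: "b \<ge> 1"
begin

definition f :: series2 where "f = line 0 ^ a * line 1 ^ b"

definition F :: "real poly" where "F = [:0, 1:] ^ a * [:-1, 1:] ^ b"

lemma F_props:
  "lead_coeff F = 1" "degree F = Suc (a + b - 1)" "poly F 0 = 0" "poly F 1 = 0"
proof -
  show "lead_coeff F = 1" by (simp add: F_def lead_coeff_mult lead_coeff_power)
  show "degree F = Suc (a + b - 1)"
    using a by (simp add: F_def degree_mult_eq degree_power_eq)
qed (use a b in \<open>auto simp: F_def power_0_left\<close>)

lemma f_eq_homogenize: "f = homogenize (a + b) F"
proof -
  have "line 0 = homogenize 1 [:0, 1:]" "line 1 = homogenize 1 [:-1, 1:]"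
    by (intro fps_ext, auto simp: line_def homogenize_def coeff_pCons split: nat.split)+
  moreover have "degree ([:0, 1:] ^ a :: real poly) \<le> a" "degree ([:-1, 1:] ^ b :: real poly) \<le> b"
    by (simp_all add: degree_power_eq)
  moreover have "degree [:0, 1 :: real:] \<le> 1" "degree [:-1, 1 :: real:] \<le> 1" by simp_all
  ultimately show ?thesis
    unfolding f_def F_def by (simp only: homogenize_power homogenize_mult)
qed

end

sublocale two_lines \<subseteq> homogeneous_field f "a + b"
proof
  have hom: "homogeneous (a + b) f"
    unfolding f_def using homogeneous_mult[OF homogeneous_power[OF homogeneous_line[of 0], of a] homogeneous_power[OF homogeneous_line[of 1], of b]]
    by simp
  then show "homogeneous (a + b) f" .
  show "2 \<le> a + b" using a b by simp
  then show "order_ge 2 f" using homogeneous_imp_order_ge[OF hom] order_ge_mono by blast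
  show "f \<noteq> 0" by (simp add: f_def)
  show "f $ 0 = 0" unfolding f_def line_0 power_eq_if[of var_x a] using a by simp
qed

context two_lines
begin

text \<open>In the chart y = x / x1 the field becomes F d/dy up to a power of x1. The degree bound
  is part of the induction because products of homogenizations require it.\<close>

lemma Xpow_f_eq: "(X ^^ n) f = homogenize (n * (a + b - 1) + (a + b)) (F * iter_poly F n)
    \<and> degree (F * iter_poly F n) \<le> n * (a + b - 1) + (a + b)"
proof (induction n)
  case 0
  show ?case using F_props(2) a by (simp add: f_eq_homogenize)
next
  case (Suc n)
  define m where "m = n * (a + b - 1) + (a + b - 1)"
  have m: "n * (a + b - 1) + (a + b) = Suc m" using a by (simp add: m_def)
  have IH: "(X ^^ n) f = homogenize (Suc m) (F * iter_poly F n)" "degree (F * iter_poly F n) \<le> Suc m"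
    using Suc unfolding m by auto
  have dF: "degree F \<le> a + b" using F_props(2) a by simp
  have dR: "degree (iter_poly F (Suc n)) \<le> m" using IH(2) by (simp add: degree_pderiv)
  have "(X ^^ Suc n) f = homogenize (a + b) F * homogenize m (iter_poly F (Suc n))"
    unfolding funpow.simps o_apply IH(1) X_def deriv_homogenize iter_poly.simps f_eq_homogenize[symmetric] ..
  also have "\<dots> = homogenize (a + b + m) (F * iter_poly F (Suc n))"
    by (rule homogenize_mult[OF dF dR])
  finally have "(X ^^ Suc n) f = homogenize (a + b + m) (F * iter_poly F (Suc n))" .
  moreover have "degree (F * iter_poly F (Suc n)) \<le> a + b + m"
    using degree_mult_le[of F "iter_poly F (Suc n)"] dF dR by linarith
  moreover have "a + b + m = Suc n * (a + b - 1) + (a + b)" by (simp add: m_def)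
  ultimately show ?case by simp
qed

lemma restr_f: "restr 0 1 f = 0" "restr 1 1 f = 0"
  using a b by (simp_all add: f_def restr_mult restr_power power_0_left)

lemma restrict_sol_2_even:
  defines "N k \<equiv> Suc (2 * k * (a + b - 1) + (a + b))"
  shows "norm ((fps_exp 1 * bernoulli_fps) $ (2 * k)) * (fact k)\<^sup>2
    \<le> real (N k) * 4 ^ N k * norm (restr 1 1 (sol 2) $ N k)"
proof -
  define e where "e = a + b - 1"
  have e: "e \<ge> 1" "degree F = Suc e" using a b F_props(2) by (auto simp: e_def)
  have sgn: "0 \<le> (-1) ^ b * poly F x" if "0 \<le> x" "x \<le> 1" for x
  proof -
    have "(-1) ^ b * poly F x = x ^ a * (1 - x) ^ b"
      by (simp add: F_def mult_ac flip: power_mult_distrib)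
    then show ?thesis using that by simp
  qed
  have lower: "(fact k)\<^sup>2 \<le> real (Suc (Suc e + 2 * (k * e))) * 4 ^ Suc (Suc e + 2 * (k * e)) *
      \<bar>poly (antideriv (F * iter_poly F (2 * k))) 1\<bar>"
    by (rule iter_poly_lower_bound[OF F_props(1) e(2,1) F_props(3,4) sgn]) auto
  have N: "Suc (Suc e + 2 * (k * e)) = N k" using a by (simp add: N_def e_def)
  have "norm (restr 1 1 (sol 2) $ N k)
      = norm ((fps_exp 1 * bernoulli_fps) $ (2 * k)) * \<bar>poly (antideriv (F * iter_poly F (2 * k))) 1\<bar>"
    unfolding N_def restrict_sol_2[OF restr_f(2)]
    using Xpow_f_eq[of "2 * k"] by (simp add: norm_mult restrict_integral_homogenize)
  moreover have "norm ((fps_exp 1 * bernoulli_fps) $ (2 * k)) * (fact k)\<^sup>2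
      \<le> norm ((fps_exp 1 * bernoulli_fps) $ (2 * k)) * (real (N k) * 4 ^ N k * \<bar>poly (antideriv (F * iter_poly F (2 * k))) 1\<bar>)"
    using lower unfolding N by (intro mult_left_mono) auto
  ultimately show ?thesis by (simp add: mult_ac)
qed

theorem restrict_sol_2_unbounded:
  assumes C: "\<And>n. norm (restr 1 1 (sol 2) $ n) \<le> C ^ Suc n"
  shows False
proof -
  define \<beta> where "\<beta> = fps_exp 1 * bernoulli_fps"
  \<comment> \<open>8 = 2 * 4 absorbs the factors N \<le> 2^N and 4^N; the maximum with 1 makes
    powers increase with the exponent.\<close>
  define D where "D = 8 * max C 1"
  \<comment> \<open>The index N grows by less than 2 (a + b) when k grows by one.\<close>
  define E where "E = D ^ (2 * (a + b))"
  \<comment> \<open>The first entry of the maximum covers n = 1, the one odd index not settled by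
    parity.\<close>
  define K where "K = max (norm (\<beta> $ 1)) (D ^ (a + b + 2))"
  have D: "D \<ge> 1" "C \<le> D" by (auto simp: D_def)
  have even_case: "norm (\<beta> $ (2 * k)) \<le> D ^ (a + b + 2) * E ^ k * 4 ^ k / fact (2 * k)" for k
  proof -
    define N where "N = Suc (2 * k * (a + b - 1) + (a + b))"
    have N2: "real N \<le> 2 ^ N" using of_nat_less_two_power[of N] by (simp add: less_imp_le)
    have "norm (\<beta> $ (2 * k)) * (fact k)\<^sup>2 \<le> real N * 4 ^ N * norm (restr 1 1 (sol 2) $ N)"
      unfolding \<beta>_def N_def by (rule restrict_sol_2_even)
    also have "\<dots> \<le> 2 ^ N * 4 ^ N * (max C 1) ^ Suc N"
    proof (intro mult_mono N2)
      show "norm (restr 1 1 (sol 2) $ N) \<le> (max C 1) ^ Suc N"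
        using C[of 0] by (intro order_trans[OF C power_mono]) (auto intro: order_trans[OF norm_ge_zero])
    qed auto
    also have "\<dots> \<le> 8 ^ Suc N * (max C 1) ^ Suc N"
      by (intro mult_right_mono) (auto simp: power_mult_distrib[symmetric])
    also have "\<dots> = D ^ Suc N" by (simp only: D_def power_mult_distrib)
    also have "\<dots> \<le> D ^ (a + b + 2 + 2 * (a + b) * k)"
    proof (rule power_increasing[OF _ D(1)])
      have "2 * k * (a + b - 1) \<le> 2 * k * (a + b)" by (intro mult_le_mono2) simp
      then show "Suc N \<le> a + b + 2 + 2 * (a + b) * k" by (simp add: N_def mult_ac)
    qed
    also have "\<dots> = D ^ (a + b + 2) * E ^ k" by (simp add: E_def power_add power_mult)
    finally have 1: "norm (\<beta> $ (2 * k)) * (fact k)\<^sup>2 \<le> D ^ (a + b + 2) * E ^ k" .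
    have "norm (\<beta> $ (2 * k)) * fact (2 * k) \<le> norm (\<beta> $ (2 * k)) * (4 ^ k * (fact k)\<^sup>2)"
      by (intro mult_left_mono fact_double_le) auto
    also have "\<dots> = (norm (\<beta> $ (2 * k)) * (fact k)\<^sup>2) * 4 ^ k" by simp
    also have "\<dots> \<le> D ^ (a + b + 2) * E ^ k * 4 ^ k" by (intro mult_right_mono 1) auto
    finally show ?thesis by (simp add: field_simps)
  qed
  have E: "E \<ge> 1" unfolding E_def using D by (intro one_le_power)
  have K: "K \<ge> 0" "D ^ (a + b + 2) \<le> K" "norm (\<beta> $ 1) \<le> K" by (auto simp: K_def le_max_iff_disj)
  have "norm (\<beta> $ n) \<le> K * (4 * E) ^ n / fact n" for n
  proof (cases "even n")
    case True
    then obtain k where n: "n = 2 * k" by auto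
    have "norm (\<beta> $ n) \<le> D ^ (a + b + 2) * (4 * E) ^ k / fact n"
      using even_case[of k] by (simp add: n power_mult_distrib mult_ac)
    also have "\<dots> \<le> K * (4 * E) ^ n / fact n"
      using K E D n by (intro divide_right_mono mult_mono power_increasing) auto
    finally show ?thesis .
  next
    case False
    show ?thesis
    proof (cases "n = 1")
      case True
      have "K * 1 \<le> K * (4 * E)" using K E by (intro mult_left_mono) auto
      then show ?thesis using K True by simp
    next
      case n1: False
      then show ?thesis using bernoulli_odd[of n] False K E by (simp add: \<beta>_def)
    qed
  qed
  then show False unfolding \<beta>_def by (rule bernoulli_not_entire)
qed

end

subsection \<open>Polynomial families with pointwise exponential bounds\<close>

lemma higher_deriv_poly: "(deriv ^^ k) (poly (R :: complex poly)) = poly ((pderiv ^^ k) R)"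
proof (induction k)
  case (Suc k)
  have "deriv (poly p) = poly (pderiv p)" for p :: "complex poly"
    by (rule ext) (rule DERIV_imp_deriv[OF poly_DERIV])
  with Suc show ?case by simp
qed simp

lemma coeff_0_higher_pderiv: "coeff ((pderiv ^^ k) R) 0 = fact k * coeff (R :: complex poly) k"
proof (induction k arbitrary: R)
  case (Suc k)
  have "coeff ((pderiv ^^ Suc k) R) 0 = fact k * coeff (pderiv R) k"
    by (simp only: funpow_Suc_right o_apply Suc)
  then show ?case by (simp add: coeff_pderiv algebra_simps)
qed simp

lemma Cauchy_inequality_poly:
  fixes R :: "complex poly"
  assumes "r > 0" "\<And>u. norm u = r \<Longrightarrow> norm (poly R u) \<le> M"
  shows "norm (coeff R k) \<le> M / r ^ k"
proof -
  have "norm ((deriv ^^ k) (poly R) 0) \<le> fact k * M / r ^ k"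
    using assms by (intro Cauchy_inequality holomorphic_intros continuous_intros) auto
  also have "(deriv ^^ k) (poly R) 0 = fact k * coeff R k"
    by (simp add: higher_deriv_poly coeff_0_higher_pderiv[symmetric] poly_0_coeff_0)
  finally have "fact k * norm (coeff R k) \<le> fact k * (M / r ^ k)" by (simp add: norm_mult)
  then show ?thesis by (rule mult_left_le_imp_le) simp
qed

lemma norm_coeff_linear_power_le: "norm (coeff ([:c, 1:] ^ j) k) \<le> (1 + norm (c :: complex)) ^ j"
proof (induction j arbitrary: k)
  case 0
  show ?case by (cases k) auto
next
  case (Suc j)
  have "coeff ([:c, 1:] ^ Suc j) k = c * coeff ([:c, 1:] ^ j) k + (case k of 0 \<Rightarrow> 0 | Suc i \<Rightarrow> coeff ([:c, 1:] ^ j) i)"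
    by (simp add: coeff_pCons split: nat.split)
  also have "norm \<dots> \<le> norm c * (1 + norm c) ^ j + (1 + norm c) ^ j"
    by (rule order_trans[OF norm_triangle_ineq add_mono])
      (auto simp: norm_mult intro!: mult_left_mono Suc split: nat.split)
  finally show ?case by (simp add: algebra_simps)
qed

text \<open>Cauchy's inequalities bound the expansion at s0; going back to powers of s costs an
  exponential factor only.\<close>

lemma coeff_bound_translate:
  fixes P :: "complex poly"
  assumes deg: "degree P \<le> n" and r: "r > 0" and M: "\<And>s. norm (s - s0) = r \<Longrightarrow> norm (poly P s) \<le> M"
  shows "norm (coeff P k) \<le> (\<Sum>j\<le>n. M / r ^ j * (1 + norm s0) ^ j)"
proof -
  define R where "R = pcompose P [:s0, 1:]"
  have degR: "degree R \<le> n" using deg by (simp add: R_def degree_pcompose)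
  have R: "norm (coeff R j) \<le> M / r ^ j" for j
    by (rule Cauchy_inequality_poly[OF r]) (simp add: R_def poly_pcompose M)
  have "poly P s = poly (\<Sum>j\<le>n. smult (coeff R j) ([:-s0, 1:] ^ j)) s" for s
  proof -
    have "poly P s = poly R (s - s0)" by (simp add: R_def poly_pcompose)
    also have "\<dots> = (\<Sum>j\<le>n. coeff R j * (s - s0) ^ j)"
      unfolding poly_altdef using degR by (intro sum.mono_neutral_left) (auto simp: coeff_eq_0)
    finally show ?thesis by (simp add: poly_sum poly_power)
  qed
  then have P: "P = (\<Sum>j\<le>n. smult (coeff R j) ([:-s0, 1:] ^ j))"
    by (simp add: poly_eq_poly_eq_iff[symmetric] fun_eq_iff)
  have "norm (coeff P k) \<le> (\<Sum>j\<le>n. norm (coeff R j * coeff ([:-s0, 1:] ^ j) k))"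
    by (subst P) (simp add: coeff_sum norm_sum)
  also have "\<dots> \<le> (\<Sum>j\<le>n. M / r ^ j * (1 + norm s0) ^ j)"
  proof (intro sum_mono)
    fix j
    show "norm (coeff R j * coeff ([:-s0, 1:] ^ j) k) \<le> M / r ^ j * (1 + norm s0) ^ j"
      unfolding norm_mult using norm_coeff_linear_power_le[of "-s0" j k] order_trans[OF norm_ge_zero R]
      by (intro mult_mono R) auto
  qed
  finally show ?thesis .
qed

text \<open>The constant depends on s, but integral constants leave countably many closed sets that
  cover the plane. One of them contains a disc, on which the bound is uniform in s.\<close>

lemma polynomial_family_bound:
  fixes c :: "nat \<Rightarrow> nat \<Rightarrow> complex"
  assumes "\<And>s. \<exists>C :: nat. \<forall>n. norm (\<Sum>k\<le>n. c n k * s ^ k) \<le> real C ^ Suc n"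
  shows "\<exists>C\<ge>0. \<forall>n. \<forall>k\<le>n. norm (c n k) \<le> C ^ Suc n"
proof -
  define E where "E C = {s. \<forall>n. norm (\<Sum>k\<le>n. c n k * s ^ k) \<le> real C ^ Suc n}" for C :: nat
  have closed: "closed (E C)" for C
    unfolding E_def Collect_all_eq
    by (intro closed_INT ballI closed_Collect_le continuous_intros)
  have "\<exists>C. interior (E C) \<noteq> {}"
  proof (rule ccontr)
    assume "\<not> (\<exists>C. interior (E C) \<noteq> {})"
    then have "closure (- E C) = UNIV" for C by (simp add: closure_complement)
    then have "UNIV \<subseteq> closure (\<Inter>(range (\<lambda>C. - E C)))"
      using closed by (intro Baire) (auto simp: open_Compl)
    moreover have "\<Inter>(range (\<lambda>C. - E C)) = {}" using assms by (auto simp: E_def)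
    ultimately show False by simp
  qed
  then obtain C s0 where "s0 \<in> interior (E C)" by blast
  then obtain r where r: "r > 0" "cball s0 r \<subseteq> E C"
    by (meson mem_interior_cball)
  define G where "G = max 1 ((1 + norm s0) / r)"
  \<comment> \<open>The factor 2 absorbs the n + 1 summands of the translated expansion.\<close>
  define K where "K = 2 * (real C * G)"
  have G: "G \<ge> 1" "(1 + norm s0) / r \<le> G" by (auto simp: G_def)
  have "norm (c n k) \<le> K ^ Suc n" if k: "k \<le> n" for n k
  proof -
    define P where "P = (\<Sum>k\<le>n. monom (c n k) k)"
    have coeff: "coeff P k = c n k" using k by (simp add: P_def coeff_sum)
    have "degree P \<le> n" unfolding P_def by (intro degree_sum_le) (auto intro: order_trans[OF degree_monom_le])
    moreover have "norm (poly P s) \<le> real C ^ Suc n" if "norm (s - s0) = r" for s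
    proof -
      have "s \<in> E C" using that r by (auto simp: dist_norm norm_minus_commute)
      then show ?thesis by (simp add: E_def P_def poly_sum poly_monom)
    qed
    ultimately have "norm (c n k) \<le> (\<Sum>j\<le>n. real C ^ Suc n / r ^ j * (1 + norm s0) ^ j)"
      unfolding coeff[symmetric] using r(1) by (intro coeff_bound_translate)
    also have "\<dots> \<le> (\<Sum>j\<le>n. real C ^ Suc n * G ^ Suc n)"
    proof (intro sum_mono)
      fix j assume j: "j \<in> {..n}"
      have "real C ^ Suc n / r ^ j * (1 + norm s0) ^ j = real C ^ Suc n * ((1 + norm s0) / r) ^ j"
        by (simp add: power_divide)
      also have "((1 + norm s0) / r) ^ j \<le> G ^ j" using G r(1) by (intro power_mono) auto
      also have "G ^ j \<le> G ^ Suc n" using G j by (intro power_increasing) auto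
      finally show "real C ^ Suc n / r ^ j * (1 + norm s0) ^ j \<le> real C ^ Suc n * G ^ Suc n"
        by (simp add: mult_left_mono)
    qed
    also have "\<dots> = real (Suc n) * (real C * G) ^ Suc n" by (simp add: power_mult_distrib)
    also have "\<dots> \<le> 2 ^ Suc n * (real C * G) ^ Suc n"
    proof (rule mult_right_mono)
      show "real (Suc n) \<le> 2 ^ Suc n" using of_nat_less_two_power[of "Suc n"] by (rule less_imp_le)
    qed (use G in auto)
    finally show ?thesis by (simp only: K_def power_mult_distrib)
  qed
  moreover have "K \<ge> 0" using G by (simp add: K_def)
  ultimately show ?thesis by blast
qed

subsection \<open>The irreducible components of a pair of lines\<close>

lemma restr_scale: "restr (c * y) (e * y) g $ n = restr c e g $ n * y ^ n"
proof -
  have "(c * y) ^ i * (e * y) ^ (n - i) = c ^ i * e ^ (n - i) * y ^ n" if "i \<le> n" for i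
  proof -
    have "y ^ i * y ^ (n - i) = y ^ n" using that by (simp add: power_add[symmetric])
    then show ?thesis by (simp add: power_mult_distrib mult_ac)
  qed
  then show ?thesis
    unfolding restr_def fps_nth_Abs_fps sum_distrib_right
    by (intro sum.cong refl) (simp add: mult.assoc)
qed

text \<open>Summation by total degree: the n-th coefficient of \<open>restr v w g\<close> is the
  value at (v, w) of the homogeneous part of degree n.\<close>

lemma eval_series_eq_infsum_restr:
  assumes "(\<lambda>(i, j). g $ i $ j * v ^ i * w ^ j) summable_on UNIV"
  shows "(\<lambda>n. restr v w g $ n) summable_on UNIV"
    and "eval_series g (v, w) = infsum (\<lambda>n. restr v w g $ n) UNIV"
proof -
  define h where "h = (\<lambda>(i, j). g $ i $ j * v ^ i * w ^ j)"
  have bij: "bij_betw (\<lambda>(n, i). (i, n - i)) (SIGMA n:UNIV. {..n}) (UNIV :: (nat \<times> nat) set)"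
    by (rule bij_betwI[where g = "\<lambda>(i, j). (i + j, i)"]) auto
  have sig: "(\<lambda>(n, i). h (i, n - i)) summable_on (SIGMA n:UNIV. {..n})"
    using summable_on_reindex_bij_betw[OF bij, of h] assms by (simp add: h_def case_prod_unfold)
  have inner: "infsum (\<lambda>i. h (i, n - i)) {..n} = restr v w g $ n" for n
    by (simp add: h_def restr_def mult.assoc)
  show "(\<lambda>n. restr v w g $ n) summable_on UNIV"
    using summable_on_Sigma_banach[OF sig] by (simp add: inner)
  have "infsum (\<lambda>n. restr v w g $ n) UNIV = infsum (\<lambda>(n, i). h (i, n - i)) (SIGMA n:UNIV. {..n})"
    using infsum_Sigma'_banach[OF sig] by (simp add: inner)
  also have "\<dots> = infsum h UNIV"
    using infsum_reindex_bij_betw[OF bij, of h] by (simp add: case_prod_unfold)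
  finally show "eval_series g (v, w) = infsum (\<lambda>n. restr v w g $ n) UNIV"
    by (simp add: eval_series_def h_def)
qed

lemma eval_series_homogeneous:
  assumes "homogeneous m g"
  shows "eval_series g (v, w) = restr v w g $ m"
proof -
  have "(\<lambda>(i, j). g $ i $ j * v ^ i * w ^ j) summable_on ({..m} \<times> {..m})" by simp
  then have "(\<lambda>(i, j). g $ i $ j * v ^ i * w ^ j) summable_on UNIV"
  proof (subst summable_on_cong_neutral[where T = "{..m} \<times> {..m}"])
    fix p :: "nat \<times> nat" assume "p \<in> UNIV - {..m} \<times> {..m}"
    then have "fst p + snd p \<noteq> m" by (cases p) auto
    then show "(case p of (i, j) \<Rightarrow> g $ i $ j * v ^ i * w ^ j) = 0"
      using assms by (auto simp: homogeneous_def split: prod.split)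
  qed auto
  from eval_series_eq_infsum_restr(2)[OF this]
  have "eval_series g (v, w) = infsum (\<lambda>n. restr v w g $ n) UNIV" .
  also have "\<dots> = infsum (\<lambda>n. restr v w g $ n) {m}"
    using assms by (intro infsum_cong_neutral) (auto intro: restr_homogeneous)
  finally show ?thesis by simp
qed

lemma restr_line_general: "restr v w (line c) = fps_const (v - c * w) * fps_X"
  by (simp only: line_def restr_diff restr_mult restr_var_x restr_var_x1
      restr_scal fps_const_sub[symmetric] left_diff_distrib fps_const_mult[symmetric] mult.assoc)

lemma eval_series_line: "eval_series (line c) (v, w) = v - c * w"
  by (simp add: eval_series_homogeneous[OF homogeneous_line] restr_line_general)

lemma convergent_line: "line c \<in> convergent_series"
  by (rule convergent_homogeneous[OF homogeneous_line])

definition line_set :: "complex \<Rightarrow> (complex \<times> complex) set" where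
  "line_set c = {p. fst p = c * snd p}"

lemma zero_set_line: "zero_set {line c} = line_set c"
  by (auto simp: zero_set_def line_set_def eval_series_line)

lemma eval_series_on_line:
  assumes "g \<in> convergent_series" "norm c \<le> 1"
  shows "\<forall>\<^sub>F y in nhds 0. eval_series g (c * y, y) = eval_fps (restr c 1 g) y"
proof -
  obtain r where r: "r > 0" and s: "(\<lambda>(i, j). norm (g $ i $ j) * r ^ (i + j)) summable_on UNIV"
    using assms(1) by (auto simp: convergent_series_def)
  have "eval_series g (c * y, y) = eval_fps (restr c 1 g) y" if y: "norm y < r" for y
  proof -
    have "(\<lambda>p. norm ((\<lambda>(i, j). g $ i $ j * (c * y) ^ i * y ^ j) p)) summable_on UNIV"
    proof (rule summable_on_comparison_test[OF s])
      fix p :: "nat \<times> nat"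
      obtain i j where p: "p = (i, j)" by force
      have "norm (c * y) \<le> r" using assms(2) y mult_mono[of "norm c" 1 "norm y" r] r by (simp add: norm_mult)
      then have "norm (c * y) ^ i * norm y ^ j \<le> r ^ i * r ^ j"
        using y r by (intro mult_mono power_mono) auto
      then show "norm (case p of (i, j) \<Rightarrow> g $ i $ j * (c * y) ^ i * y ^ j) \<le> (case p of (i, j) \<Rightarrow> norm (g $ i $ j) * r ^ (i + j))"
        unfolding p by (simp add: norm_mult norm_power power_add mult.assoc mult_left_mono)
    qed auto
    then have sum: "(\<lambda>(i, j). g $ i $ j * (c * y) ^ i * y ^ j) summable_on UNIV"
      by (rule abs_summable_summable)
    have eq: "restr (c * y) y g $ n = restr c 1 g $ n * y ^ n" for n
      using restr_scale[of c y 1 g n] by simp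
    have "((\<lambda>n. restr (c * y) y g $ n) has_sum eval_series g (c * y, y)) UNIV"
      unfolding eval_series_eq_infsum_restr(2)[OF sum]
      by (rule has_sum_infsum[OF eval_series_eq_infsum_restr(1)[OF sum]])
    then have "(\<lambda>n. restr c 1 g $ n * y ^ n) sums eval_series g (c * y, y)"
      unfolding eq by (rule has_sum_imp_sums)
    then show ?thesis by (simp add: eval_fps_def sums_iff)
  qed
  then show ?thesis unfolding eventually_nhds_metric using r by (auto simp: dist_norm)
qed

text \<open>Zeros are isolated: splitting off a power of y leaves a series that is continuous and
  nonzero at 0.\<close>

lemma eventually_eval_fps_neq_0:
  fixes h :: "complex fps"
  assumes "fps_conv_radius h > 0" "h \<noteq> 0"
  shows "\<forall>\<^sub>F y in at 0. eval_fps h y \<noteq> 0"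
proof -
  define k where "k = subdegree h"
  define h' where "h' = fps_shift k h"
  have h: "h = h' * fps_X ^ k" unfolding h'_def k_def by (rule subdegree_decompose)
  have rad: "fps_conv_radius h' > 0" using assms(1) by (simp add: h'_def)
  have "h' $ 0 \<noteq> 0" using assms(2) by (simp add: h'_def k_def)
  then have nz: "eval_fps h' 0 \<noteq> 0" by (simp add: eval_fps_at_0)
  have "isCont (eval_fps h') 0"
    using rad by (intro continuous_eval_fps) (auto simp: zero_ereal_def)
  then have "((\<lambda>y. eval_fps h' y) \<longlongrightarrow> eval_fps h' 0) (at 0)" by (simp add: isCont_def)
  then have "\<forall>\<^sub>F y in at 0. eval_fps h' y \<noteq> 0" using nz by (rule tendsto_imp_eventually_ne)
  moreover have "\<forall>\<^sub>F y in at 0. y \<in> eball 0 (fps_conv_radius h')"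
    using rad by (intro eventually_at_in_open') (auto simp: zero_ereal_def)
  moreover have "\<forall>\<^sub>F y in at (0 :: complex). y \<noteq> 0" by (simp add: eventually_at_filter)
  ultimately show ?thesis
  proof eventually_elim
    case (elim y)
    then have "eval_fps h y = eval_fps h' y * y ^ k"
      unfolding h by (subst eval_fps_mult) auto
    then show ?case using elim by simp
  qed
qed

lemma eventually_line_if_eventually:
  assumes "\<forall>\<^sub>F p in nhds (0 :: complex \<times> complex). Q p"
  shows "\<forall>\<^sub>F y in nhds 0. Q (c * y, y)"
proof -
  have "filterlim (\<lambda>y :: complex. (c * y, y)) (nhds (c * 0, 0)) (nhds 0)"
    by (intro tendsto_intros filterlim_ident)
  then show ?thesis using assms by (intro eventually_compose_filterlim[OF assms]) (simp add: zero_prod_def)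
qed

lemma eventually_if_eventually_line:
  assumes "\<forall>\<^sub>F y in nhds 0. Q (c * y, y)"
  shows "\<forall>\<^sub>F p in nhds (0 :: complex \<times> complex). p \<in> line_set c \<longrightarrow> Q p"
proof -
  have "filterlim snd (nhds (snd (0 :: complex \<times> complex))) (nhds (0 :: complex \<times> complex))"
    by (intro tendsto_intros filterlim_ident)
  then have "\<forall>\<^sub>F p in nhds (0 :: complex \<times> complex). Q (c * snd p, snd p)"
    using assms by (intro eventually_compose_filterlim[OF assms]) simp
  then show ?thesis by eventually_elim (auto simp: line_set_def)
qed

lemma germ_subset_line_set:
  "germ_subset (line_set c) B \<longleftrightarrow> (\<forall>\<^sub>F y in nhds 0. (c * y, y) \<in> B)"
proof
  assume "germ_subset (line_set c) B"
  then have "\<forall>\<^sub>F p in nhds 0. p \<in> line_set c \<longrightarrow> p \<in> B" by (simp add: germ_subset_def)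
  from eventually_line_if_eventually[OF this, of c] show "\<forall>\<^sub>F y in nhds 0. (c * y, y) \<in> B"
    by (simp add: line_set_def)
next
  assume "\<forall>\<^sub>F y in nhds 0. (c * y, y) \<in> B"
  from eventually_if_eventually_line[OF this] show "germ_subset (line_set c) B"
    by (simp add: germ_subset_def)
qed

lemma germ_eq_iff_subset: "germ_eq A B \<longleftrightarrow> germ_subset A B \<and> germ_subset B A"
  unfolding germ_eq_def germ_subset_def eventually_conj_iff[symmetric]
  by (rule arg_cong[where f = "\<lambda>P. eventually P _"]) auto

lemma germ_subset_trans:
  assumes "germ_subset A B" "germ_subset B C" shows "germ_subset A C"
  using assms unfolding germ_subset_def by eventually_elim blast

lemma restr_eq_0_if_vanishing:
  assumes "g \<in> vanishing_germs A" "germ_subset (line_set c) A" "norm c \<le> 1"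
  shows "restr c 1 g = 0"
proof (rule ccontr)
  assume nz: "restr c 1 g \<noteq> 0"
  have g: "g \<in> convergent_series" using assms(1) by (simp add: vanishing_germs_def)
  have "germ_subset (line_set c) (zero_set {g})"
    using assms by (auto simp: vanishing_germs_def intro: germ_subset_trans)
  then have "\<forall>\<^sub>F y in nhds 0. (c * y, y) \<in> zero_set {g}" by (simp add: germ_subset_line_set)
  then have "\<forall>\<^sub>F y in nhds 0. eval_fps (restr c 1 g) y = 0"
    using eval_series_on_line[OF g assms(3)] by eventually_elim (simp add: zero_set_def)
  then have "\<forall>\<^sub>F y in at 0. eval_fps (restr c 1 g) y = 0" by (simp add: eventually_at_filter eventually_mono)
  then have "\<forall>\<^sub>F y in at (0 :: complex). False"
    using eventually_eval_fps_neq_0[OF convergent_restr[OF g assms(3)] nz] by eventually_elim simp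
  then show False by simp
qed

text \<open>By the identity theorem, an analytic germ contains a line or meets it in the origin at most.\<close>

lemma analytic_germ_line_dichotomy:
  assumes "analytic_germ B" "norm c \<le> 1"
  shows "germ_subset (line_set c) B \<or> (\<forall>\<^sub>F y in at 0. (c * y, y) \<notin> B)"
proof -
  obtain G where G: "finite G" "G \<subseteq> convergent_series" and B: "germ_eq B (zero_set G)"
    using assms(1) by (auto simp: analytic_germ_def)
  have BG: "\<forall>\<^sub>F y in nhds 0. (c * y, y) \<in> B \<longleftrightarrow> (c * y, y) \<in> zero_set G"
    using eventually_line_if_eventually[OF B[unfolded germ_eq_def]] .
  show ?thesis
  proof (cases "\<forall>g\<in>G. restr c 1 g = 0")
    case True
    have "\<forall>\<^sub>F y in nhds 0. \<forall>g\<in>G. eval_series g (c * y, y) = 0"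
    proof (intro eventually_ball_finite G(1) ballI)
      fix g assume g: "g \<in> G"
      then have "g \<in> convergent_series" using G(2) by blast
      from eval_series_on_line[OF this assms(2)] show "\<forall>\<^sub>F y in nhds 0. eval_series g (c * y, y) = 0"
        by eventually_elim (use True g in simp)
    qed
    with BG have "\<forall>\<^sub>F y in nhds 0. (c * y, y) \<in> B" by eventually_elim (auto simp: zero_set_def)
    then show ?thesis by (simp add: germ_subset_line_set)
  next
    case False
    then obtain g where g: "g \<in> G" "restr c 1 g \<noteq> 0" by blast
    then have gc: "g \<in> convergent_series" using G(2) by blast
    have "\<forall>\<^sub>F y in at 0. ((c * y, y) \<in> B \<longleftrightarrow> (c * y, y) \<in> zero_set G)
        \<and> eval_series g (c * y, y) = eval_fps (restr c 1 g) y"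
      using eventually_conj[OF BG eval_series_on_line[OF gc assms(2)]]
      by (simp add: eventually_at_filter eventually_mono)
    moreover have "\<forall>\<^sub>F y in at 0. eval_fps (restr c 1 g) y \<noteq> 0"
      by (rule eventually_eval_fps_neq_0[OF convergent_restr[OF gc assms(2)] g(2)])
    ultimately have "\<forall>\<^sub>F y in at 0. (c * y, y) \<notin> B"
      by eventually_elim (use g(1) in \<open>auto simp: zero_set_def\<close>)
    then show ?thesis ..
  qed
qed

lemma analytic_germ_line_set: "analytic_germ (line_set c)"
  unfolding analytic_germ_def
  by (rule exI[of _ "{line c}"]) (auto simp: zero_set_line germ_eq_def convergent_line)

text \<open>If neither part contained the line, both would miss it in a punctured neighbourhood, by
  the dichotomy.\<close>

lemma irreducible_line_set:
  assumes "norm c \<le> 1"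
  shows "irreducible_germ (line_set c)"
  unfolding irreducible_germ_def
proof (intro conjI allI impI)
  show "analytic_germ (line_set c)" by (rule analytic_germ_line_set)
  show "\<not> germ_eq (line_set c) {}"
  proof
    assume "germ_eq (line_set c) {}"
    then have "\<forall>\<^sub>F p in nhds (0 :: complex \<times> complex). p \<notin> line_set c" by (simp add: germ_eq_def)
    from eventually_nhds_x_imp_x[OF this] show False by (simp add: line_set_def)
  qed
  fix B C assume BC: "analytic_germ B \<and> analytic_germ C \<and> germ_eq (line_set c) (B \<union> C)"
  then have sub: "germ_subset (line_set c) (B \<union> C)" "germ_subset (B \<union> C) (line_set c)"
    by (auto simp: germ_eq_iff_subset)
  have "germ_subset (line_set c) B \<or> germ_subset (line_set c) C"
  proof (rule ccontr)
    assume "\<not> (germ_subset (line_set c) B \<or> germ_subset (line_set c) C)"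
    then have "\<forall>\<^sub>F y in at 0. (c * y, y) \<notin> B" "\<forall>\<^sub>F y in at 0. (c * y, y) \<notin> C"
      using BC analytic_germ_line_dichotomy assms by blast+
    moreover have "\<forall>\<^sub>F y in at 0. (c * y, y) \<in> B \<union> C"
      using sub(1) by (simp add: germ_subset_line_set eventually_at_filter eventually_mono)
    ultimately have "\<forall>\<^sub>F y in at (0 :: complex). False" by eventually_elim auto
    then show False by simp
  qed
  moreover have "germ_subset B (line_set c)" "germ_subset C (line_set c)"
    using sub(2) unfolding germ_subset_def by (auto elim: eventually_mono)
  ultimately show "germ_eq (line_set c) B \<or> germ_eq (line_set c) C"
    by (auto simp: germ_eq_iff_subset)
qed

lemma not_fibered_line_set: "\<not> fibered_germ (line_set c)"
proof
  assume "fibered_germ (line_set c)"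
  then obtain r where r: "r > 0"
    and *: "\<And>s t y. norm s < r \<Longrightarrow> norm t < r \<Longrightarrow> norm y < r \<Longrightarrow> (s, y) \<in> line_set c \<longleftrightarrow> (t, y) \<in> line_set c"
    unfolding fibered_germ_def by blast
  have "norm (complex_of_real (r / 2)) < r" using r by simp
  from *[OF _ this, of 0 0] r show False by (simp add: line_set_def)
qed

text \<open>A larger irreducible germ is cut by the two lines into two analytic germs and so equals
  one of them. It cannot lie in the second line, which meets the first at the origin only.\<close>

lemma irreducible_component_line_set:
  assumes A: "A = line_set c \<union> line_set c'" and c: "norm c \<le> 1" "norm c' \<le> 1" "c \<noteq> c'"
  shows "irreducible_component (line_set c) A"
  unfolding irreducible_component_def
proof (intro conjI allI impI)
  show "irreducible_germ (line_set c)" by (rule irreducible_line_set[OF c(1)])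
  show "germ_subset (line_set c) A" by (simp add: A germ_subset_def)
  fix \<delta> assume \<delta>: "irreducible_germ \<delta> \<and> germ_subset (line_set c) \<delta> \<and> germ_subset \<delta> A"
  then obtain G where G: "finite G" "G \<subseteq> convergent_series" and \<delta>G: "germ_eq \<delta> (zero_set G)"
    by (auto simp: irreducible_germ_def analytic_germ_def)
  define B where "B e = zero_set (insert (line e) G)" for e
  have B: "B e = zero_set G \<inter> line_set e" for e
    using zero_set_line[of e] by (auto simp: B_def zero_set_def)
  have an: "analytic_germ (B e)" for e
    unfolding analytic_germ_def B_def
    by (rule exI[of _ "insert (line e) G"]) (use G convergent_line in \<open>auto simp: germ_eq_def\<close>)
  have "\<forall>\<^sub>F p in nhds 0. p \<in> \<delta> \<longrightarrow> p \<in> A" using \<delta> by (simp add: germ_subset_def)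
  then have "germ_eq \<delta> (B c \<union> B c')"
    using \<delta>G unfolding germ_eq_def B by eventually_elim (auto simp: A)
  then have "germ_eq \<delta> (B c) \<or> germ_eq \<delta> (B c')"
    using \<delta> an by (auto simp: irreducible_germ_def)
  then show "germ_eq (line_set c) \<delta>"
  proof
    assume "germ_eq \<delta> (B c)"
    then have "germ_subset \<delta> (line_set c)"
      unfolding germ_eq_def germ_subset_def B by (auto elim: eventually_mono)
    then show ?thesis using \<delta> by (simp add: germ_eq_iff_subset)
  next
    assume "germ_eq \<delta> (B c')"
    then have "germ_subset \<delta> (line_set c')"
      unfolding germ_eq_def germ_subset_def B by (auto elim: eventually_mono)
    then have "germ_subset (line_set c) (line_set c')" using \<delta> germ_subset_trans by blast
    then have "\<forall>\<^sub>F y in nhds 0. (c * y, y) \<in> line_set c'" unfolding germ_subset_line_set .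
    then have "\<forall>\<^sub>F y in nhds 0. c * y = c' * y" by (simp add: line_set_def)
    then have "\<forall>\<^sub>F y in at (0 :: complex). False" using c(3) by (simp add: eventually_at_filter eventually_mono)
    then show ?thesis by simp
  qed
qed

section \<open>Ideals, substitution and jets along a line\<close>

lemma ideal_gen_subset_dvd:
  assumes "S \<subseteq> {g. p dvd g}"
  shows "ideal_gen S \<subseteq> {g. (p :: series2) dvd g}"
proof -
  interpret module "(*) :: series2 \<Rightarrow> series2 \<Rightarrow> series2"
    by unfold_locales (auto simp: algebra_simps)
  show ?thesis unfolding ideal_gen_def
    by (rule span_minimal[OF assms]) (auto simp: subspace_def)
qed

lemma mult_in_ideal_gen: "g \<in> S \<Longrightarrow> (h :: series2) * g \<in> ideal_gen S"
proof -
  interpret module "(*) :: series2 \<Rightarrow> series2 \<Rightarrow> series2"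
    by unfold_locales (auto simp: algebra_simps)
  assume "g \<in> S"
  then show ?thesis unfolding ideal_gen_def by (intro span_scale span_base)
qed

lemma formal_ideal_dvd:
  assumes "g \<in> formal_ideal A" "germ_subset (line_set c) A" "norm c \<le> 1"
  shows "line c dvd g"
proof -
  have "vanishing_germs A \<subseteq> {g. line c dvd g}"
    using restr_eq_0_if_vanishing[OF _ assms(2,3)] by (auto simp: line_dvd_iff)
  from ideal_gen_subset_dvd[OF this] show ?thesis using assms(1) by (auto simp: formal_ideal_def)
qed

lemma ideal_power_dvd:
  assumes "I \<subseteq> {g. p dvd g}" "h \<in> ideal_power I k"
  shows "p ^ k dvd (h :: series2)"
  using assms(2)
proof (induction k arbitrary: h)
  case (Suc k)
  have "ideal_gen {g * h |g h. g \<in> I \<and> h \<in> ideal_power I k} \<subseteq> {g. p ^ Suc k dvd g}"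
    using assms(1) Suc.IH by (intro ideal_gen_subset_dvd) (auto intro!: mult_dvd_mono)
  then show ?case using Suc.prems by auto
qed simp

text \<open>With x1 preserved, substitution is composition of power series in x over the ring of
  series in x1. For this, x has to divide h; vanishing of h at the origin would be too weak.\<close>

lemma subst2_eq_compose:
  assumes h: "h $ 0 = 0"
  shows "subst2 g h var_x1 = g oo h"
proof (intro fps_ext)
  fix m n
  have pow: "(h ^ i) $ m = 0" if "m < i" for i m
    using startsby_zero_power_prefix[OF h] that by blast
  have monom_nth: "(h ^ i * var_x1 ^ j) $ m $ n = (if j \<le> n then (h ^ i) $ m $ (n - j) else 0)" for i j
  proof -
    have "h ^ i * var_x1 ^ j = fps_const (fps_X ^ j) * h ^ i" by (simp add: mult.commute)
    then have "(h ^ i * var_x1 ^ j) $ m = fps_X ^ j * (h ^ i) $ m" by (simp only: fps_mult_left_const_nth)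
    then show ?thesis by (simp add: fps_X_power_mult_nth fps_X_power_mult_right_nth)
  qed
  have "subst2 g h var_x1 $ m $ n = (\<Sum>(i, j)\<in>{(i, j). i + j \<le> m + n}. g $ i $ j * (h ^ i * var_x1 ^ j) $ m $ n)"
    by (simp add: subst2_def)
  also have "\<dots> = (\<Sum>(i, j)\<in>{..m} \<times> {..n}. g $ i $ j * (h ^ i) $ m $ (n - j))"
  proof (rule sum.mono_neutral_cong_right)
    show "finite {(i, j). i + j \<le> m + n}"
      by (rule finite_subset[of _ "{..m + n} \<times> {..m + n}"]) auto
    show "{..m} \<times> {..n} \<subseteq> {(i, j). i + j \<le> m + n}" by auto
    show "\<forall>p\<in>{(i, j). i + j \<le> m + n} - {..m} \<times> {..n}. (case p of (i, j) \<Rightarrow> g $ i $ j * (h ^ i * var_x1 ^ j) $ m $ n) = 0"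
    proof
      fix p assume "p \<in> {(i, j). i + j \<le> m + n} - {..m} \<times> {..n}"
      then have "m < fst p \<or> n < snd p" by auto
      then show "(case p of (i, j) \<Rightarrow> g $ i $ j * (h ^ i * var_x1 ^ j) $ m $ n) = 0"
        unfolding monom_nth by (auto simp: pow split: prod.split)
    qed
    show "(case p of (i, j) \<Rightarrow> g $ i $ j * (h ^ i * var_x1 ^ j) $ m $ n) = (case p of (i, j) \<Rightarrow> g $ i $ j * (h ^ i) $ m $ (n - j))"
      if "p \<in> {..m} \<times> {..n}" for p
      using that unfolding monom_nth by auto
  qed
  also have "\<dots> = (\<Sum>i\<le>m. (g $ i * (h ^ i) $ m) $ n)"
    by (simp add: sum.cartesian_product[symmetric] fps_mult_nth atLeast0AtMost)
  also have "\<dots> = (g oo h) $ m $ n"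
    by (simp add: fps_compose_nth fps_sum_nth atLeast0AtMost)
  finally show "subst2 g h var_x1 $ m $ n = (g oo h) $ m $ n" .
qed

lemma higher_deriv_formal_cont: "formal_cont (fps_deriv ^^ m)"
proof (rule formal_contI[of _ m])
  show "(fps_deriv ^^ m) (g + h) = (fps_deriv ^^ m) g + (fps_deriv ^^ m) h" for g h :: series2
    by (induction m) auto
  show "order_ge n ((fps_deriv ^^ m) g)" if "order_ge (n + m) g" for n and g :: series2
    using that by (induction m arbitrary: n) (auto intro!: order_ge_deriv)
qed

lemma convergent_higher_deriv: "g \<in> convergent_series \<Longrightarrow> (fps_deriv ^^ m) g \<in> convergent_series"
  by (induction m) (auto intro: convergent_deriv)

text \<open>The terms with k > m are divisible by the power m + 1 of the line and drop out of the
  m-th derivative on it. What remains is a finite sum of convergent series.\<close>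

lemma transversally_formal_convergent_jet:
  assumes g: "transversally_formal_series f g" and I: "formal_ideal (zero_set {f}) \<subseteq> {g. line c dvd g}"
    and c: "norm c \<le> 1"
  shows "fps_conv_radius (restr c 1 ((fps_deriv ^^ m) g)) > 0"
proof -
  obtain u where u: "\<And>k. u k \<in> convergent_series" "\<And>k. u k \<in> ideal_power (formal_ideal (zero_set {f})) k"
    and sums: "formal_sums u g"
    using g by (auto simp: transversally_formal_series_def)
  have zero: "restr c 1 ((fps_deriv ^^ m) (u k)) = 0" if "m < k" for k
  proof -
    have "line c ^ Suc m dvd u k"
      using ideal_power_dvd[OF I u(2)] that by (meson Suc_leI dvd_trans le_imp_power_dvd)
    then obtain v where "u k = line c ^ m * (line c * v)" by (auto simp: dvd_def mult_ac)
    then show ?thesis by (simp add: restrict_deriv_line_power restr_mult)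
  qed
  have eq: "restr c 1 ((fps_deriv ^^ m) g) = (\<Sum>k\<le>m. restr c 1 ((fps_deriv ^^ m) (u k)))"
  proof (intro fps_ext)
    fix n
    have "formal_sums (\<lambda>k. (fps_deriv ^^ m) (u k)) ((fps_deriv ^^ m) g)"
      by (rule formal_sums_map[OF higher_deriv_formal_cont sums])
    from restr_formal_sums[OF this, of c 1 n]
    obtain M0 where M0: "\<And>M. M0 \<le> M \<Longrightarrow> restr c 1 ((fps_deriv ^^ m) g) $ n
        = (\<Sum>k<M. restr c 1 ((fps_deriv ^^ m) (u k)) $ n)"
      by (auto simp: eventually_sequentially)
    have "restr c 1 ((fps_deriv ^^ m) g) $ n
        = (\<Sum>k<max M0 (Suc m). restr c 1 ((fps_deriv ^^ m) (u k)) $ n)"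
      by (rule M0) simp
    also have "\<dots> = (\<Sum>k\<le>m. restr c 1 ((fps_deriv ^^ m) (u k)) $ n)"
      by (rule sum.mono_neutral_right) (auto simp: zero)
    finally show "restr c 1 ((fps_deriv ^^ m) g) $ n
        = (\<Sum>k\<le>m. restr c 1 ((fps_deriv ^^ m) (u k))) $ n"
      by (simp add: fps_sum_nth)
  qed
  have "fps_conv_radius (\<Sum>k\<in>A. restr c 1 ((fps_deriv ^^ m) (u k))) > 0" if "finite A" for A
    using that
    by induction (auto intro!: fps_conv_radius_add_pos convergent_restr convergent_higher_deriv u c)
  then show ?thesis unfolding eq by blast
qed

section \<open>Conjugacies of the family and the invariant\<close>

context two_lines
begin

lemma convergent_f: "f \<in> convergent_series"
  unfolding f_def by (intro convergent_mult convergent_power convergent_line)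

lemma zero_set_f: "zero_set {f} = line_set 0 \<union> line_set 1"
proof -
  have "eval_series f (v, w) = v ^ a * (v - w) ^ b" for v w
  proof -
    have "restr v w f = fps_const (v ^ a * (v - w) ^ b) * fps_X ^ (a + b)"
      unfolding f_def restr_mult restr_power restr_line_general
      by (simp add: power_mult_distrib power_add mult_ac flip: fps_const_mult)
    then show ?thesis
      by (simp only: eval_series_homogeneous[OF hom_f]) simp
  qed
  then show ?thesis using a b by (auto simp: zero_set_def line_set_def)
qed

lemma formal_ideal_zero_set_f:
  "formal_ideal (zero_set {f}) \<subseteq> {g. line 0 dvd g}" "formal_ideal (zero_set {f}) \<subseteq> {g. line 1 dvd g}"
  by (auto intro!: formal_ideal_dvd[of _ "zero_set {f}"] simp: zero_set_f germ_subset_def)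

lemma normalized_dvd:
  assumes "normalized f \<sigma>" "c = 0 \<or> c = 1"
  shows "line c dvd fst \<sigma> - var_x"
proof -
  have "irreducible_component (line_set c) (zero_set {f})"
    using assms(2) irreducible_component_line_set[of "zero_set {f}" c "1 - c"]
    by (auto simp: zero_set_f Un_commute)
  then have "fst \<sigma> - var_x \<in> formal_ideal (line_set c)"
    using assms(1) not_fibered_line_set by (auto simp: normalized_def)
  then show ?thesis
    by (rule formal_ideal_dvd) (use assms(2) in \<open>auto simp: germ_subset_def\<close>)
qed

text \<open>f vanishes on every component of its own zero set, so it lies in each of the ideals
  concerned.\<close>

lemma normalized_if_f_dvd:
  assumes "f dvd fst \<sigma> - var_x"
  shows "normalized f \<sigma>"
  unfolding normalized_def
proof (intro allI impI)
  fix \<gamma> assume "irreducible_component \<gamma> (zero_set {f}) \<and> \<not> fibered_germ \<gamma>"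
  then have "f \<in> vanishing_germs \<gamma>"
    by (simp add: vanishing_germs_def convergent_f irreducible_component_def)
  moreover obtain W where "fst \<sigma> - var_x = W * f" using assms by (auto simp: dvd_def mult.commute)
  ultimately show "fst \<sigma> - var_x \<in> formal_ideal \<gamma>"
    unfolding formal_ideal_def by (simp add: mult_in_ideal_gen)
qed

definition phi :: "complex \<Rightarrow> formal_map" where
  "phi s = (flow (1 + scal s * f) var_x, var_x1)"

lemma phi_in_D_set: "phi s \<in> D_set f"
  unfolding phi_def by (rule flow_in_D_set[OF convergent_f])

lemma comp_map_var_x1:
  assumes "g $ 0 = 0"
  shows "comp_map (h, var_x1) (g, var_x1) = (h oo g, var_x1)"
  by (simp add: comp_map_def subst2_eq_compose[OF assms])

lemma formally_conjugate_phi: "formally_conjugate f (phi s) (phi 0)"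
proof -
  define \<alpha> where "\<alpha> = param_solution s"
  define \<sigma> where "\<sigma> = (flow \<alpha> var_x, var_x1)"
  have eq: "flow \<alpha> var_x = var_x + f * flow_quot \<alpha> var_x" by (rule flow_eq)
  have f0: "f $ 0 = 0" "f $ 1 $ 0 = 0" using order_f by (auto simp: f_nth_0 order_ge_def)
  have "flow \<alpha> var_x $ 0 $ 0 = 0" "flow \<alpha> var_x $ 1 $ 0 = 1"
    unfolding eq using f0 by (auto simp: mult_nth2)
  then have "\<sigma> \<in> formal_diff_p" by (simp add: \<sigma>_def formal_diff_p_def formal_diffeos_def)
  moreover have "normalized f \<sigma>" by (rule normalized_if_f_dvd) (simp add: \<sigma>_def eq)
  moreover have "comp_map \<sigma> (phi s) = comp_map (phi 0) \<sigma>"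
  proof -
    \<comment> \<open>Both times are \<open>\<alpha> + 1\<close>: the change - s f of
      \<open>\<alpha>\<close> under the first map cancels the excess of 1 + s f.\<close>
    have "flow (1 + scal s * f) (flow \<alpha> var_x) = flow \<alpha> (flow 1 var_x)"
      unfolding flow_flow flow_1 \<alpha>_def flow_param_solution by (simp add: algebra_simps)
    then show ?thesis
      unfolding \<sigma>_def phi_def by (simp add: comp_map_var_x1 flow_var_x_nth_0 compose_flow)
  qed
  ultimately show ?thesis by (auto simp: formally_conjugate_def)
qed

text \<open>Each line yields its full power in the displacement, and the powers combine to f since
  the lines are distinct. So the conjugacy is a flow at some time, and injectivity in the time gives
  the equation.\<close>

lemma conjugacy_time:
  assumes \<sigma>: "\<sigma> \<in> formal_diff_p" "normalized f \<sigma>" and conj: "comp_map \<sigma> (phi s) = comp_map (phi 0) \<sigma>"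
  obtains \<alpha> where "fst \<sigma> = flow \<alpha> var_x" "flow (1 + scal s * f) \<alpha> = \<alpha> - scal s * f"
proof -
  define S where "S = fst \<sigma>"
  have \<sigma>S: "\<sigma> = (S, var_x1)" using \<sigma>(1) by (cases \<sigma>) (simp add: S_def formal_diff_p_def)
  have dvd: "line 0 dvd S - var_x" "line 1 dvd S - var_x"
    using normalized_dvd[OF \<sigma>(2)] by (auto simp: S_def)
  then obtain g where g: "S - var_x = line 0 * g" by (auto simp: dvd_def)
  have "line 1 ^ 1 dvd line 0 * g" using dvd(2) g by simp
  then have "line 1 ^ 1 dvd g" by (rule line_power_dvd_mult[rotated]) (simp add: restr_line)
  then obtain \<rho> where "g = line 1 * \<rho>" by (auto simp: dvd_def)
  then have S: "S = var_x + line 0 * line 1 * \<rho>" "S = var_x + line 1 * line 0 * \<rho>"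
    using g by (auto simp: algebra_simps)
  have S0: "S $ 0 = 0" unfolding S by (simp add: line_0)
  have conj': "flow (1 + scal s * f) S = flow 1 var_x oo S"
    using conj unfolding \<sigma>S phi_def
    by (simp add: comp_map_var_x1 S0 flow_var_x_nth_0 compose_flow)
  have d0: "line 0 ^ a dvd S - var_x"
    using conjugacy_dvd[OF f_def a _ S(1) S0 conj'] by (simp add: S(1))
  have f': "f = line 1 ^ b * line 0 ^ a" by (simp add: f_def mult.commute)
  have d1: "line 1 ^ b dvd S - var_x"
    using conjugacy_dvd[OF f' b _ S(2) S0 conj'] by (simp add: S(2))
  obtain z where z: "S - var_x = line 0 ^ a * z" using d0 by (auto simp: dvd_def)
  have "line 1 ^ b dvd z"
    by (rule line_power_dvd_mult[OF _ d1[unfolded z]]) (simp add: restr_power restr_line)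
  then obtain W where "S = var_x + f * W" using z by (auto simp: dvd_def f_def algebra_simps)
  moreover obtain \<alpha> where \<alpha>: "flow \<alpha> var_x = var_x + f * W" using flow_surj by blast
  ultimately have S\<alpha>: "S = flow \<alpha> var_x" by simp
  have "flow (1 + scal s * f + flow (1 + scal s * f) \<alpha>) var_x = flow (\<alpha> + 1) var_x"
    using conj' unfolding S\<alpha> compose_flow flow_flow flow_1 .
  from flow_inj[OF this] have "flow (1 + scal s * f) \<alpha> = \<alpha> - scal s * f" by (simp add: algebra_simps)
  with S\<alpha> that show ?thesis by (simp add: S_def)
qed

text \<open>As the flow is x + f W, its derivative of order m + 1 on the line is (m + 1)! Q W plus
  that of x. This jet converges and Q is a nonzero monomial on the line, hence W converges there,
  and then so does the time.\<close>

lemma transversally_formal_time: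
  assumes g: "transversally_formal_series f (flow \<alpha> var_x)"
    and f: "f = line c ^ Suc m * Q" and Q: "restr c 1 Q = fps_const l * fps_X ^ e" "l \<noteq> 0"
    and I: "formal_ideal (zero_set {f}) \<subseteq> {g. line c dvd g}" and c: "norm c \<le> 1"
  shows "fps_conv_radius (restr c 1 \<alpha>) > 0"
proof (rule convergent_time)
  define W where "W = flow_quot \<alpha> var_x"
  show "restr c 1 f = 0" by (simp add: f restr_mult)
  have "fps_deriv f = line c ^ m * (of_nat (Suc m) * Q + line c * fps_deriv Q)"
    unfolding f by (rule deriv_line_power_mult)
  then have "restr c 1 (fps_deriv f) = (if m = 0 then restr c 1 Q else 0)"
    by (simp add: restr_mult restr_add restr_power power_0_left)
  then show "restr c 1 (fps_deriv f) = fps_const (if m = 0 then l else 0) * fps_X ^ e"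
    by (simp add: Q)
  have "(fps_deriv ^^ Suc m) (flow \<alpha> var_x) = (fps_deriv ^^ Suc m) var_x + (fps_deriv ^^ Suc m) (line c ^ Suc m * (Q * W))"
    using higher_deriv_formal_cont[of "Suc m"] flow_eq[of \<alpha> var_x]
    by (simp only: formal_cont_def W_def f mult.assoc)
  then have "restr c 1 ((fps_deriv ^^ Suc m) (flow \<alpha> var_x))
      = restr c 1 ((fps_deriv ^^ Suc m) var_x) + of_nat (fact (Suc m)) * (restr c 1 Q * restr c 1 W)"
    by (simp only: restr_add restrict_deriv_line_power restr_mult)
  then have "fps_const (fact (Suc m) * l) * fps_X ^ e * restr c 1 W
      = restr c 1 ((fps_deriv ^^ Suc m) (flow \<alpha> var_x)) + fps_const (- 1) * restr c 1 ((fps_deriv ^^ Suc m) var_x)"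
    by (simp add: Q fps_of_nat[symmetric] mult.assoc[symmetric] fps_const_neg[symmetric] del: fps_const_neg fact_Suc)
  moreover have "fps_conv_radius \<dots> > 0"
  proof (intro fps_conv_radius_add_pos fps_conv_radius_mult_pos)
    show "fps_conv_radius (restr c 1 ((fps_deriv ^^ Suc m) (flow \<alpha> var_x))) > 0"
      by (rule transversally_formal_convergent_jet[OF g I c])
    have "var_x \<in> convergent_series" using convergent_line[of 0] by (simp add: line_0)
    then show "fps_conv_radius (restr c 1 ((fps_deriv ^^ Suc m) var_x)) > 0"
      by (intro convergent_restr convergent_higher_deriv c)
  qed simp
  ultimately have "fps_conv_radius (fps_const (fact (Suc m) * l) * fps_X ^ e * restr c 1 W) > 0"
    by (simp only:)
  moreover have "fact (Suc m) * l \<noteq> 0" using Q(2) by (simp del: fact_Suc)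
  ultimately show "fps_conv_radius (restr c 1 (flow_quot \<alpha> var_x)) > 0"
    unfolding W_def by (rule fps_conv_radius_monom_mult_posD)
qed

text \<open>The time \<open>\<alpha>\<close> of a conjugacy is unique up to a series in \<open>x1\<close>, so that the difference of its
  restrictions to the two lines is an invariant.\<close>

lemma transversally_conjugate_imp_convergent:
  assumes "transversally_conjugate f (phi s) (phi 0)"
  shows "fps_conv_radius (restr 1 1 (param_solution s)) > 0"
proof -
  obtain \<sigma> where \<sigma>: "\<sigma> \<in> formal_diff_p" "normalized f \<sigma>" "transversally_formal f \<sigma>"
      "comp_map \<sigma> (phi s) = comp_map (phi 0) \<sigma>"
    using assms by (auto simp: transversally_conjugate_def)
  obtain \<alpha> where \<alpha>: "fst \<sigma> = flow \<alpha> var_x" "flow (1 + scal s * f) \<alpha> = \<alpha> - scal s * f"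
    using conjugacy_time[OF \<sigma>(1,2,4)] by blast
  have tf: "transversally_formal_series f (flow \<alpha> var_x)"
    using \<sigma>(3) by (simp add: transversally_formal_def \<alpha>)
  obtain a' where a': "a = Suc a'" using a by (metis Suc_le_D One_nat_def)
  obtain b' where b': "b = Suc b'" using b by (metis Suc_le_D One_nat_def)
  have r0: "fps_conv_radius (restr 0 1 \<alpha>) > 0"
  proof (rule transversally_formal_time[OF tf])
    show "f = line 0 ^ Suc a' * line 1 ^ b" unfolding f_def a'[symmetric] ..
    show "restr 0 1 (line 1 ^ b) = fps_const ((-1) ^ b) * fps_X ^ b"
      by (simp add: restr_power restr_line power_mult_distrib)
  qed (use formal_ideal_zero_set_f in auto)
  have r1: "fps_conv_radius (restr 1 1 \<alpha>) > 0"
  proof (rule transversally_formal_time[OF tf])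
    show "f = line 1 ^ Suc b' * line 0 ^ a" unfolding f_def b'[symmetric] by (rule mult.commute)
    show "restr 1 1 (line 0 ^ a) = fps_const 1 * fps_X ^ a"
      by (simp add: restr_power restr_line)
  qed (use formal_ideal_zero_set_f in auto)
  define \<beta> where "\<beta> = \<alpha> - param_solution s"
  have "flow (1 + scal s * f) \<beta> = \<beta>"
    by (simp add: \<beta>_def flow_diff \<alpha>(2) flow_param_solution)
  then have "fps_deriv \<beta> = 0" by (rule flow_invariant) (simp add: f_nth_0)
  then obtain k where "\<beta> = fps_const k" by (auto simp: fps_deriv_eq_0_iff)
  \<comment> \<open>Both lines are parametrized by x1, so a series in x1 has the same restriction to
    each.\<close>
  then have "restr 1 1 \<beta> = restr 0 1 \<beta>"
    by (intro fps_ext) (simp add: restr_fps_const)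
  then have "restr 1 1 (param_solution s) = restr 1 1 \<alpha> + fps_const (- 1) * restr 0 1 \<alpha>"
    by (simp add: \<beta>_def restr_diff restrict_0_param_solution algebra_simps fps_const_neg[symmetric] del: fps_const_neg)
  then show ?thesis
    by (simp only:) (intro fps_conv_radius_add_pos fps_conv_radius_mult_pos r0 r1, simp)
qed

theorem exists_not_transversally_conjugate: "\<exists>s. \<not> transversally_conjugate f (phi s) (phi 0)"
proof (rule ccontr)
  assume "\<not> (\<exists>s. \<not> transversally_conjugate f (phi s) (phi 0))"
  then have rad: "fps_conv_radius (restr 1 1 (param_solution s)) > 0" for s
    using transversally_conjugate_imp_convergent by blast
  have "\<exists>C :: nat. \<forall>n. norm (\<Sum>k\<le>n. restr 1 1 (sol k) $ n * s ^ k) \<le> real C ^ Suc n" for s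
    using fps_conv_radius_pos_imp_bounded[OF rad[of s]] unfolding restrict_param_solution by metis
  from polynomial_family_bound[where c = "\<lambda>n k. restr 1 1 (sol k) $ n", OF this]
  obtain C where C: "C \<ge> 0" "\<And>n k. k \<le> n \<Longrightarrow> norm (restr 1 1 (sol k) $ n) \<le> C ^ Suc n"
    by blast
  have "norm (restr 1 1 (sol 2) $ n) \<le> C ^ Suc n" for n
  proof (cases "2 \<le> n")
    \<comment> \<open>The bound on the family covers k \<le> n only; below degree 2 the order of
      \<open>sol 2\<close> makes the coefficient vanish.\<close>
    case False
    then have "restr 1 1 (sol 2) $ n = 0" by (intro order_restr[OF order_sol]) simp
    then show ?thesis using C(1) by simp
  qed (rule C(2))
  then show False by (rule restrict_sol_2_unbounded)
qed

end

theorem theorem2p1: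
  fixes a b :: nat and f :: series2
  assumes "a \<ge> 1" and "b \<ge> 1"
    and "f = var_x ^ a * (var_x - var_x1) ^ b"
  shows "\<exists>\<phi>1\<in>D_set f. \<exists>\<phi>2\<in>D_set f.
           formally_conjugate f \<phi>1 \<phi>2 \<and> \<not> transversally_conjugate f \<phi>1 \<phi>2"
proof -
  interpret L: two_lines a b using assms by unfold_locales
  have f: "f = L.f" by (simp only: L.f_def assms(3) line_0 line_1)
  obtain s where "\<not> transversally_conjugate L.f (L.phi s) (L.phi 0)"
    using L.exists_not_transversally_conjugate by blast
  then show ?thesis
    unfolding f using L.phi_in_D_set L.formally_conjugate_phi by blast
qed

end
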